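(* Let $m\in\mathbb N$ and let $\mathcal L=\sum_{|\gamma|=m}a_\gamma\partial^\gamma$ (with $a_\gamma\in\mathbb C$) be an elliptic operator of anisotropic order $m$ on $\mathbb R^d$. Suppose $0<\alpha<\eta<m$ and $\alpha,\eta\notin\mathbb N$. There exists a constant $C$ such that for all $\rho>0$ and all germs $U$ over $\mathbb R^d$ with $[U]_{G^\eta_\rho}<\infty$ it holds $$[U]_{G^\eta_\rho}\le C\big([\mathcal LU]_{G^{\eta-m}_\rho}+[U]_{G^{\eta,\alpha}_\rho}+\rho^{-\eta}\|U\|_{<\rho}\big).$$
   Context: Fix a scaling $\mathfrak s\in\mathbb N^d$; for $\beta\in\mathbb N_0^d$, $|\beta|:=\sum_i\mathfrak s_i\beta_i$; $d(x,y):=\sum_i|x_i-y_i|^{1/\mathfrak s_i}$, $B_R(x)$ the open ball for $d$, $\mathcal P_k$ the polynomials $\sum_{|\beta|\le k}c_\beta z^\beta$. $\mathcal L$ is elliptic if for every open $D\subseteq\mathbb R^d$ and $u\in\mathcal D'(D)$, $\mathcal Lu\in C^\infty(D)$ implies $u\in C^\infty(D)$. A germ over $\mathbb R^d$ is a family $U=(U_x)_{x\in\mathbb R^d}$ of continuous $U_x:\mathbb R^d\to\mathbb C$; $\mathcal LU:=(\mathcal LU_x)_x$ ($\mathcal L$ acting distributionally in the active variable). For $R>0$: $\|U\|_{<R}:=\sup_{x,y:\,d(x,y)<R}|U_x(y)|$; for $\gamma>0$, $[U]_{G^\gamma_R}:=\sup_{x,y:\,0<d(x,y)<R}|U_x(y)|/d(x,y)^\gamma$;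 for $\gamma<0$ and a family $V=(V_x)_x$ of distributions on $\mathbb R^d$, $[V]_{G^\gamma_R}:=\sup_{\varphi\in\mathcal B}\sup_{0<\lambda<R}\sup_{x\in\mathbb R^d}\lambda^{-\gamma}|\langle V_x,\varphi^\lambda_x\rangle|$, where, with $k:=\lceil|\gamma|\rceil$, $\mathcal B$ is the set of $\varphi\in C_c^\infty(\mathbb R^d)$ supported in $B_1(0)$ with $\sup_{|\beta|\le k}\sup|\partial^\beta\varphi|\le1$ and $\varphi_x^\lambda(y):=\lambda^{-\sum_i\mathfrak s_i}\varphi(\lambda^{-\mathfrak s_1}(y_1-x_1),\dots,\lambda^{-\mathfrak s_d}(y_d-x_d))$; for $\gamma>0$ and $\alpha\in(0,\gamma)$, $$[U]_{G^{\gamma,\alpha}_R}:=\sup_{x,y:\,0<d(x,y)<R}\ \inf_{P\in\mathcal P_{\lfloor\gamma\rfloor}}\ \sup_{z:\,0<d(y,z)<R}\frac{|(U_x-U_y-P)(z)|}{d(y,z)^\alpha(d(x,y)+d(y,z))^{\gamma-\alpha}}.$$ *)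

theory Defs
  imports "HOL-Analysis.Analysis"
begin

definition partial_dir :: "'d::finite \<Rightarrow> (real^'d \<Rightarrow> complex) \<Rightarrow> real^'d \<Rightarrow> complex" where
  "partial_dir i f x = vector_derivative (\<lambda>t::real. f (x + t *\<^sub>R axis i 1)) (at 0)"

definition iter_partial :: "'d::finite list \<Rightarrow> (real^'d \<Rightarrow> complex) \<Rightarrow> real^'d \<Rightarrow> complex" where
  "iter_partial is f = foldr partial_dir is f"

definition Cinf_on :: "(real^'d::finite) set \<Rightarrow> (real^'d \<Rightarrow> complex) \<Rightarrow> bool" where
  "Cinf_on D f \<longleftrightarrow> (\<forall>is. continuous_on D (iter_partial is f) \<and>
      (\<forall>i. \<forall>x\<in>D. (\<lambda>t::real. iter_partial is f (x + t *\<^sub>R axis i 1)) differentiable (at 0)))"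

definition mi_list :: "('d::finite \<Rightarrow> nat) \<Rightarrow> 'd list" where
  "mi_list \<beta> = (SOME L. \<forall>i. count_list L i = \<beta> i)"

definition pd :: "('d::finite \<Rightarrow> nat) \<Rightarrow> (real^'d \<Rightarrow> complex) \<Rightarrow> real^'d \<Rightarrow> complex" where
  "pd \<beta> f = iter_partial (mi_list \<beta>) f"

definition adeg :: "('d::finite \<Rightarrow> nat) \<Rightarrow> ('d \<Rightarrow> nat) \<Rightarrow> nat" where
  "adeg s \<beta> = (\<Sum>i\<in>UNIV. s i * \<beta> i)"

definition odeg :: "('d::finite \<Rightarrow> nat) \<Rightarrow> nat" where
  "odeg \<beta> = (\<Sum>i\<in>UNIV. \<beta> i)"

definition adist :: "('d::finite \<Rightarrow> nat) \<Rightarrow> real^'d \<Rightarrow> real^'d \<Rightarrow> real" where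
  "adist s x y = (\<Sum>i\<in>UNIV. \<bar>x$i - y$i\<bar> powr (1 / real (s i)))"

definition supp :: "(real^'d::finite \<Rightarrow> complex) \<Rightarrow> (real^'d) set" where
  "supp f = closure {x. f x \<noteq> 0}"

definition test_fun :: "(real^'d::finite) set \<Rightarrow> (real^'d \<Rightarrow> complex) \<Rightarrow> bool" where
  "test_fun D \<phi> \<longleftrightarrow> Cinf_on UNIV \<phi> \<and> compact (supp \<phi>) \<and> supp \<phi> \<subseteq> D"

definition distribution :: "(real^'d::finite) set \<Rightarrow> ((real^'d \<Rightarrow> complex) \<Rightarrow> complex) \<Rightarrow> bool" where
  "distribution D T \<longleftrightarrow>
     (\<forall>\<phi> \<psi>. test_fun D \<phi> \<longrightarrow> test_fun D \<psi> \<longrightarrow> T (\<lambda>x. \<phi> x + \<psi> x) = T \<phi> + T \<psi>) \<and>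
     (\<forall>c \<phi>. test_fun D \<phi> \<longrightarrow> T (\<lambda>x. c * \<phi> x) = c * T \<phi>) \<and>
     (\<forall>K. compact K \<and> K \<subseteq> D \<longrightarrow> (\<exists>C N. \<forall>\<phi>. test_fun D \<phi> \<and> supp \<phi> \<subseteq> K \<longrightarrow>
         norm (T \<phi>) \<le> C * (\<Sum>\<beta>\<in>{\<beta>::'d\<Rightarrow>nat. \<forall>i. \<beta> i \<le> N}. (SUP x. norm (pd \<beta> \<phi> x)))))"

definition fdist :: "(real^'d::finite \<Rightarrow> complex) \<Rightarrow> (real^'d \<Rightarrow> complex) \<Rightarrow> complex" where
  "fdist f \<phi> = (LINT y|lborel. f y * \<phi> y)"

definition Lop :: "('d::finite \<Rightarrow> nat) \<Rightarrow> nat \<Rightarrow> (('d \<Rightarrow> nat) \<Rightarrow> complex)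
     \<Rightarrow> ((real^'d \<Rightarrow> complex) \<Rightarrow> complex) \<Rightarrow> (real^'d \<Rightarrow> complex) \<Rightarrow> complex" where
  "Lop s m a T = (\<lambda>\<phi>. \<Sum>\<gamma>\<in>{\<gamma>. adeg s \<gamma> = m}. a \<gamma> * (-1) ^ odeg \<gamma> * T (pd \<gamma> \<phi>))"

definition elliptic :: "('d::finite \<Rightarrow> nat) \<Rightarrow> nat \<Rightarrow> (('d \<Rightarrow> nat) \<Rightarrow> complex) \<Rightarrow> bool" where
  "elliptic s m a \<longleftrightarrow> (\<forall>D u. open D \<longrightarrow> distribution D u \<longrightarrow>
      (\<exists>f. Cinf_on D f \<and> (\<forall>\<phi>. test_fun D \<phi> \<longrightarrow> Lop s m a u \<phi> = fdist f \<phi>)) \<longrightarrow>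
      (\<exists>g. Cinf_on D g \<and> (\<forall>\<phi>. test_fun D \<phi> \<longrightarrow> u \<phi> = fdist g \<phi>)))"

definition germ_sup :: "('d::finite \<Rightarrow> nat) \<Rightarrow> real \<Rightarrow> (real^'d \<Rightarrow> real^'d \<Rightarrow> complex) \<Rightarrow> ereal" where
  "germ_sup s R U = (SUP (x,y)\<in>{(x,y). adist s x y < R}. ereal (norm (U x y)))"

definition germ_hoelder :: "('d::finite \<Rightarrow> nat) \<Rightarrow> real \<Rightarrow> real \<Rightarrow> (real^'d \<Rightarrow> real^'d \<Rightarrow> complex) \<Rightarrow> ereal" where
  "germ_hoelder s \<gamma> R U = (SUP (x,y)\<in>{(x,y). 0 < adist s x y \<and> adist s x y < R}.
       ereal (norm (U x y) / adist s x y powr \<gamma>))"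

definition testB :: "('d::finite \<Rightarrow> nat) \<Rightarrow> nat \<Rightarrow> (real^'d \<Rightarrow> complex) set" where
  "testB s k = {\<phi>. test_fun UNIV \<phi> \<and> supp \<phi> \<subseteq> {y. adist s 0 y < 1} \<and>
       (\<forall>\<beta>. adeg s \<beta> \<le> k \<longrightarrow> (\<forall>x. norm (pd \<beta> \<phi> x) \<le> 1))}"

definition rescale :: "('d::finite \<Rightarrow> nat) \<Rightarrow> (real^'d \<Rightarrow> complex) \<Rightarrow> real \<Rightarrow> real^'d \<Rightarrow> real^'d \<Rightarrow> complex" where
  "rescale s \<phi> lam x = (\<lambda>y. complex_of_real (lam powr (- real (\<Sum>i\<in>UNIV. s i))) *
       \<phi> (\<chi> i. lam powr (- real (s i)) * (y$i - x$i)))"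

definition neg_hoelder :: "('d::finite \<Rightarrow> nat) \<Rightarrow> real \<Rightarrow> real
     \<Rightarrow> (real^'d \<Rightarrow> (real^'d \<Rightarrow> complex) \<Rightarrow> complex) \<Rightarrow> ereal" where
  "neg_hoelder s \<gamma> R V = (SUP (\<phi>, lam, x)\<in>testB s (nat \<lceil>\<bar>\<gamma>\<bar>\<rceil>) \<times> {0<..<R} \<times> UNIV.
       ereal (lam powr (- \<gamma>) * norm (V x (rescale s \<phi> lam x))))"

definition polys :: "('d::finite \<Rightarrow> nat) \<Rightarrow> nat \<Rightarrow> (real^'d \<Rightarrow> complex) set" where
  "polys s k = {P. \<exists>c. P = (\<lambda>z. \<Sum>\<beta>\<in>{\<beta>. adeg s \<beta> \<le> k}.
       c \<beta> * (\<Prod>i\<in>UNIV. complex_of_real (z$i) ^ \<beta> i))}"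

definition germ_hoelder2 :: "('d::finite \<Rightarrow> nat) \<Rightarrow> real \<Rightarrow> real \<Rightarrow> real
     \<Rightarrow> (real^'d \<Rightarrow> real^'d \<Rightarrow> complex) \<Rightarrow> ereal" where
  "germ_hoelder2 s \<gamma> \<alpha> R U = (SUP (x,y)\<in>{(x,y). 0 < adist s x y \<and> adist s x y < R}.
      (INF P\<in>polys s (nat \<lfloor>\<gamma>\<rfloor>).
        (SUP z\<in>{z. 0 < adist s y z \<and> adist s y z < R}.
          ereal (norm (U x z - U y z - P z) /
                 (adist s y z powr \<alpha> * (adist s x y + adist s y z) powr (\<gamma> - \<alpha>))))))"

end

(* Blow-up and compactness. If no constant works, rescaling a sequence of germs that violates the
   estimate around almost-extremal pairs yields germs V_n on balls of radius tending to infinity with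
   |V_n(x, z)| <= d(x, z)^eta and |V_n(0, w_n)| >= 1/2 for some w_n with d(0, w_n) = 1, while
   L V_n(0, .) tends to 0. The bound on the second seminorm compares V_n(0, .) near y with V_n(y, .)
   up to a polynomial; that polynomial is bounded, hence Lipschitz, so the V_n(0, .) are locally
   equicontinuous. A limit F is L-harmonic, satisfies |F(z)| <= d(0, z)^eta and does not vanish
   identically. This contradicts a Liouville theorem: along a curve g(t) = F(t^s w), finite
   differences of order q > eta vanish, because ellipticity and a uniform boundedness argument
   applied to the rescalings r^(-eta) F(r^s .) make them O(r^(eta - q)); Newton's forward formula
   with steps 1/n and |g(t)| <= t^eta then give g(1) = 0 as eta is not an integer. *)

theory Submission
  imports Defs "HOL-Complex_Analysis.Great_Picard" "HOL-Computational_Algebra.Polynomial"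
begin

section \<open>Iterated partial derivatives and test functions\<close>

text \<open>Ellipticity is available only as a qualitative regularity statement, without any a
  priori estimate, and this shapes the whole argument: the constant in \<open>theorem3p7\<close>
  comes from a contradiction, and the decay of differences in \<open>liouville_growth\<close> from a
  gliding hump. The hump acts on series of rescaled solutions with summable coefficients. Such a
  series is again a continuous solution on the unit ball, hence smooth there, so its q-th
  differences at step h/r are O(r^(-q)); a nonzero q-th difference of F would force them to exceed
  this by an unbounded factor r^(q - eta). Finite differences replace derivatives because they pass
  through pointwise convergent series without any control of derivatives. Of the lower-order terms
  in the estimate, the supremum forces the radii to infinity, since it compares the extremal
  distance with rho. The second seminorm is the only link between different base points, hence the
  source of a modulus of continuity in the active variable: the first one makes \<open>U x\<close>
  small only near its own base point x.\<close>

lemma iter_partial_Nil [simp]: "iter_partial [] f = f"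
  by (simp add: iter_partial_def)

lemma iter_partial_Cons [simp]: "iter_partial (i # is) f = partial_dir i (iter_partial is f)"
  by (simp add: iter_partial_def)

lemma Cinf_on_continuous: "Cinf_on D f \<Longrightarrow> continuous_on D (iter_partial is f)"
  by (simp add: Cinf_on_def)

lemma Cinf_on_has_partial_at_0:
  assumes "Cinf_on D f" "x \<in> D"
  shows "((\<lambda>t. iter_partial is f (x + t *\<^sub>R axis i 1)) has_vector_derivative
     iter_partial (i # is) f x) (at 0)"
  using assms by (auto simp: Cinf_on_def partial_dir_def vector_derivative_works)

text \<open>By induction every iterated partial of \<open>f\<close> stays in \<open>S\<close>, so
  smoothness of an explicit function reduces to finding a family closed under partial
  differentiation.\<close>

lemma Cinf_on_UNIV_closed_class:
  assumes "f \<in> S" and cont: "\<And>g. g \<in> S \<Longrightarrow> continuous_on UNIV g"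
    and der: "\<And>g i. g \<in> S \<Longrightarrow>
      \<exists>h\<in>S. \<forall>x. ((\<lambda>t. g (x + t *\<^sub>R axis i 1)) has_vector_derivative h x) (at 0)"
  shows "Cinf_on UNIV f"
proof -
  have it: "iter_partial is f \<in> S" for "is"
  proof (induction "is")
    case (Cons i "is")
    then obtain h where h: "h \<in> S"
      "\<forall>x. ((\<lambda>t. iter_partial is f (x + t *\<^sub>R axis i 1)) has_vector_derivative h x) (at 0)"
      using der by blast
    then have "partial_dir i (iter_partial is f) = h"
      by (auto simp: partial_dir_def vector_derivative_at)
    with h show ?case by simp
  qed (use assms in simp)
  show ?thesis
    unfolding Cinf_on_def using cont[OF it] der[OF it]
    by (auto simp: differentiableI_vector) (meson differentiableI_vector)
qed

text \<open>Each derivative in direction \<open>i\<close> brings out one factor \<open>b i\<close>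
  by the chain rule. Both \<open>rescale\<close> (\<open>b i\<close> a negative power of the scale)
  and multiplication by a constant (\<open>b i = 1\<close>) are instances.\<close>

lemma iter_partial_affine:
  fixes \<phi> :: "real^'d::finite \<Rightarrow> complex" and b :: "'d \<Rightarrow> real"
  assumes "Cinf_on UNIV \<phi>"
  shows "iter_partial is (\<lambda>y. A * \<phi> (\<chi> i. b i * (y$i - x$i))) =
    (\<lambda>y. A * (\<Prod>i\<leftarrow>is. complex_of_real (b i)) * iter_partial is \<phi> (\<chi> i. b i * (y$i - x$i)))"
proof (induction "is")
  case (Cons j "is")
  show ?case
  proof
    fix y
    define p where "p = (\<chi> i. b i * (y$i - x$i))"
    let ?c = "A * (\<Prod>i\<leftarrow>is. complex_of_real (b i))"
    let ?F = "iter_partial is \<phi>"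
    have eq: "(\<chi> i. b i * ((y + t *\<^sub>R axis j 1)$i - x$i)) = p + (b j * t) *\<^sub>R axis j 1" for t
      by (auto simp: p_def vec_eq_iff axis_def algebra_simps)
    have "((\<lambda>t. ?F (p + t *\<^sub>R axis j 1)) has_vector_derivative iter_partial (j # is) \<phi> p) (at (b j * 0))"
      using Cinf_on_has_partial_at_0[OF assms, of p] by simp
    moreover have "((\<lambda>t. b j * t) has_vector_derivative b j) (at 0)"
      by (auto intro!: derivative_eq_intros simp: has_real_derivative_iff_has_vector_derivative[symmetric])
    ultimately have "(((\<lambda>t. ?F (p + t *\<^sub>R axis j 1)) \<circ> (\<lambda>t. b j * t)) has_vector_derivative
        b j *\<^sub>R iter_partial (j # is) \<phi> p) (at 0)"
      by (rule vector_diff_chain_at[rotated])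
    then have "((\<lambda>t. ?c * ?F (p + (b j * t) *\<^sub>R axis j 1)) has_vector_derivative
        ?c * (b j *\<^sub>R iter_partial (j # is) \<phi> p)) (at 0)"
      unfolding o_def by (rule has_vector_derivative_mult_right)
    then have "vector_derivative (\<lambda>t. ?c * ?F (p + (b j * t) *\<^sub>R axis j 1)) (at 0) =
        ?c * (b j *\<^sub>R iter_partial (j # is) \<phi> p)"
      by (rule vector_derivative_at)
    then show "iter_partial (j # is) (\<lambda>y. A * \<phi> (\<chi> i. b i * (y$i - x$i))) y =
      A * (\<Prod>i\<leftarrow>j # is. complex_of_real (b i)) * iter_partial (j # is) \<phi> (\<chi> i. b i * (y$i - x$i))"
      unfolding iter_partial_Cons Cons partial_dir_def[of j "\<lambda>y. ?c * ?F (\<chi> i. b i * (y$i - x$i))"] eq p_def[symmetric]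
      by (simp add: scaleR_conv_of_real mult_ac)
  qed
qed simp

lemma iter_partial_cmult:
  assumes "Cinf_on UNIV \<phi>"
  shows "iter_partial is (\<lambda>y. A * \<phi> y) = (\<lambda>y. A * iter_partial is \<phi> y)"
proof -
  have "(\<Prod>i\<leftarrow>is. 1) = (1::complex)" by (induction "is") auto
  then show ?thesis using iter_partial_affine[OF assms, of "is" A "\<lambda>_. 1" 0] by simp
qed

lemma Cinf_on_cmult:
  assumes "Cinf_on UNIV \<phi>"
  shows "Cinf_on UNIV (\<lambda>y. A * \<phi> y)"
  unfolding Cinf_on_def iter_partial_cmult[OF assms]
proof (intro allI conjI ballI)
  show "continuous_on UNIV (\<lambda>y. A * iter_partial is \<phi> y)" for "is"
    by (intro continuous_intros Cinf_on_continuous assms)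
  show "(\<lambda>t. A * iter_partial is \<phi> (x + t *\<^sub>R axis i 1)) differentiable at 0" for "is" i x
    by (rule differentiableI_vector)
      (rule has_vector_derivative_mult_right[OF Cinf_on_has_partial_at_0[OF assms]], simp)
qed

lemma iter_partial_eq_0:
  assumes "x \<notin> supp \<phi>"
  shows "iter_partial is \<phi> x = 0"
  using assms
proof (induction "is" arbitrary: x)
  case Nil
  then show ?case using closure_subset by (force simp: supp_def)
next
  case (Cons i "is")
  have "open (- supp \<phi>)" by (simp add: supp_def open_Compl)
  moreover have "continuous_on UNIV (\<lambda>t::real. x + t *\<^sub>R axis i 1)"
    by (intro continuous_intros)
  ultimately have "open ((\<lambda>t::real. x + t *\<^sub>R axis i 1) -` (- supp \<phi>))"
    by (metis open_vimage)
  moreover have "0 \<in> (\<lambda>t::real. x + t *\<^sub>R axis i 1) -` (- supp \<phi>)"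
    using Cons.prems by simp
  ultimately have "((\<lambda>t::real. iter_partial is \<phi> (x + t *\<^sub>R axis i 1)) has_vector_derivative 0) (at 0)"
    by (intro has_vector_derivative_transform_within_open[OF has_vector_derivative_const])
      (auto simp: Cons.IH)
  then show ?case by (simp add: partial_dir_def vector_derivative_at)
qed

lemma test_fun_continuous: "test_fun D \<phi> \<Longrightarrow> continuous_on UNIV (iter_partial is \<phi>)"
  by (simp add: test_fun_def Cinf_on_continuous)

lemma test_fun_bounded:
  assumes "test_fun D \<phi>"
  obtains B where "B > 0" "\<And>x. norm (iter_partial is \<phi> x) \<le> B"
proof -
  have "compact (iter_partial is \<phi> ` supp \<phi>)"
    using assms test_fun_continuous[OF assms] by (auto simp: test_fun_def intro!: compact_continuous_image
      intro: continuous_on_subset)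
  then have "bounded (iter_partial is \<phi> ` supp \<phi>)" by (rule compact_imp_bounded)
  then obtain B where B: "B > 0" "\<forall>v \<in> iter_partial is \<phi> ` supp \<phi>. norm v \<le> B"
    unfolding bounded_pos by blast
  have "norm (iter_partial is \<phi> x) \<le> B" for x
    using B iter_partial_eq_0[of x \<phi> "is"] by (cases "x \<in> supp \<phi>") auto
  with B(1) show ?thesis using that by blast
qed

lemma integrable_mult_compact_support:
  fixes f \<psi> :: "real^'d::finite \<Rightarrow> complex"
  assumes "continuous_on K f" "continuous_on UNIV \<psi>" "compact K" "\<And>x. x \<notin> K \<Longrightarrow> \<psi> x = 0"
  shows "integrable lborel (\<lambda>y. f y * \<psi> y)"
proof -
  have "integrable lborel (\<lambda>y. indicator K y *\<^sub>R (f y * \<psi> y))"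
    using assms by (intro borel_integrable_compact continuous_intros) (auto intro: continuous_on_subset)
  moreover have "(\<lambda>y. indicator K y *\<^sub>R (f y * \<psi> y)) = (\<lambda>y. f y * \<psi> y)"
    using assms(4) by (auto simp: fun_eq_iff indicator_def)
  ultimately show ?thesis by simp
qed

lemma integrable_test_fun:
  assumes "continuous_on D f" "test_fun D \<phi>"
  shows "integrable lborel (\<lambda>y. f y * iter_partial is \<phi> y)"
  using assms
  by (intro integrable_mult_compact_support[of "supp \<phi>"] test_fun_continuous)
    (auto simp: test_fun_def iter_partial_eq_0 intro: continuous_on_subset)

section \<open>Multi-indices and anisotropic degree\<close>

lemma ex_mi_list: "\<exists>L. \<forall>i::'d::finite. count_list L i = \<beta> i"
proof -
  have "\<exists>L. \<forall>i. count_list L i = (if i \<in> I then \<beta> i else 0)" if "finite I" for I :: "'d set"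
    using that
  proof (induction I rule: finite_induct)
    case empty
    show ?case by (rule exI[of _ "[]"]) simp
  next
    case (insert j I)
    then obtain L where L: "\<And>i. count_list L i = (if i \<in> I then \<beta> i else 0)" by blast
    have rep: "count_list (replicate n j) i = (if i = j then n else 0)" for n i
      by (induction n) auto
    show ?case
      by (rule exI[of _ "replicate (\<beta> j) j @ L"]) (use insert L in \<open>auto simp: rep\<close>)
  qed
  from this[of UNIV] show ?thesis by simp
qed

lemma count_mi_list: "count_list (mi_list \<beta>) i = \<beta> i"
  unfolding mi_list_def using someI_ex[OF ex_mi_list, of \<beta>] by blast

lemma mi_list_0: "mi_list (\<lambda>_. 0) = []"
  using count_mi_list[of "\<lambda>_. 0"] by (metis count_list_0_iff list.set_intros(1) neq_Nil_conv)

text \<open>The product depends only on how often each index occurs, not on the order that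
  \<open>SOME\<close> picks in \<open>mi_list\<close>; hence no symmetry of mixed partial
  derivatives enters the scaling argument.\<close>

lemma prod_list_mi_list:
  "(\<Prod>i\<leftarrow>mi_list \<beta>. complex_of_real (inverse r ^ s i)) = complex_of_real (inverse r ^ adeg s \<beta>)"
proof -
  have "(\<Prod>i\<leftarrow>L. complex_of_real (inverse r ^ s i)) = complex_of_real (inverse r ^ (\<Sum>i\<leftarrow>L. s i))" for L
    by (induction L) (auto simp: power_add)
  moreover have "(\<Sum>i\<leftarrow>mi_list \<beta>. s i) = (\<Sum>i\<in>UNIV. count_list (mi_list \<beta>) i * s i)"
    using sum_list_map_eq_sum_count2[of "mi_list \<beta>" UNIV s] by simp
  ultimately show ?thesis by (simp add: count_mi_list adeg_def mult.commute)
qed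

text \<open>All weights are at least 1, so each component is at most \<open>adeg s \<beta>\<close>.
  Finiteness matters because sums over infinite sets are 0 by convention.\<close>

lemma finite_adeg_le:
  fixes s :: "'d::finite \<Rightarrow> nat"
  assumes "\<forall>i. 1 \<le> s i"
  shows "finite {\<beta>. adeg s \<beta> \<le> k}"
proof -
  have le: "\<beta> i \<le> adeg s \<beta>" for \<beta> i
  proof -
    have "\<beta> i \<le> s i * \<beta> i" using assms[rule_format, of i] by simp
    also have "\<dots> \<le> adeg s \<beta>" unfolding adeg_def by (rule member_le_sum) auto
    finally show ?thesis .
  qed
  have "{\<beta>. adeg s \<beta> \<le> k} \<subseteq> PiE UNIV (\<lambda>_. {..k})"
    by (auto intro: order.trans[OF le])
  then show ?thesis by (rule finite_subset) (intro finite_PiE; simp)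
qed

section \<open>Bump functions\<close>

text \<open>Functions of the form \<^term>\<open>flat p\<close> are closed under differentiation; this avoids any bookkeeping of higher derivatives.\<close>

definition flat :: "real poly \<Rightarrow> real \<Rightarrow> real" where
  "flat p t = (if t > 0 then poly p (1 / t) * exp (- (1 / t)) else 0)"

lemma poly_exp_minus_tendsto_0: "((\<lambda>x::real. poly p x * exp (- x)) \<longlongrightarrow> 0) at_top"
proof -
  have "((\<lambda>x. \<Sum>i\<le>degree p. coeff p i * (x ^ i / exp x)) \<longlongrightarrow> (\<Sum>i\<le>degree p. coeff p i * 0)) at_top"
    by (intro tendsto_intros tendsto_power_div_exp_0)
  then show ?thesis
    by (simp add: poly_altdef sum_distrib_right exp_minus divide_inverse mult.assoc)
qed

lemma flat_tendsto_0: "(flat p \<longlongrightarrow> 0) (at_right 0)"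
proof -
  have "((\<lambda>t. poly p (inverse t) * exp (- (inverse t))) \<longlongrightarrow> 0) (at_right 0)"
    by (rule filterlim_compose[OF poly_exp_minus_tendsto_0 filterlim_inverse_at_top_right])
  then show ?thesis
    by (rule Lim_transform_eventually) (auto simp: flat_def eventually_at_filter inverse_eq_divide)
qed

text \<open>With u = 1/t, the derivative of p(u) exp(-u) in t is u^2 (p(u) - p'(u)) exp(-u), which
  explains the polynomial \<open>[:0, 0, 1:] * (p - pderiv p)\<close>.\<close>

lemma flat_has_derivative:
  "(flat p has_real_derivative flat ([:0, 0, 1:] * (p - pderiv p)) t) (at t)"
proof -
  consider "t > 0" | "t < 0" | "t = 0" by linarith
  then show ?thesis
  proof cases
    case 1
    have "((\<lambda>t. poly p (1 / t) * exp (- (1 / t))) has_real_derivative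
        flat ([:0, 0, 1:] * (p - pderiv p)) t) (at t)"
      using 1 by (auto intro!: derivative_eq_intros simp: flat_def power2_eq_square algebra_simps)
    then show ?thesis
      by (rule has_field_derivative_transform_within_open[of _ _ _ "{0<..}"])
        (use 1 in \<open>auto simp: flat_def\<close>)
  next
    case 2
    have "((\<lambda>t. 0) has_real_derivative flat ([:0, 0, 1:] * (p - pderiv p)) t) (at t)"
      using 2 by (simp add: flat_def)
    then show ?thesis
      by (rule has_field_derivative_transform_within_open[of _ _ _ "{..<0}"])
        (use 2 in \<open>auto simp: flat_def\<close>)
  next
    case 3
    \<comment> \<open>For h > 0 the difference quotient \<open>flat p h / h\<close> is
      \<open>flat ([:0, 1:] * p) h\<close>, so \<open>flat_tendsto_0\<close> applies again.\<close>
    have "((\<lambda>h. flat p h / h) \<longlongrightarrow> 0) (at_right 0)"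
      by (rule Lim_transform_eventually[OF flat_tendsto_0[of "[:0, 1:] * p"]])
        (auto simp: flat_def eventually_at_filter)
    moreover have "((\<lambda>h. flat p h / h) \<longlongrightarrow> 0) (at_left 0)"
      by (rule Lim_transform_eventually[OF tendsto_const])
        (auto simp: flat_def eventually_at_filter)
    ultimately have "((\<lambda>h. flat p h / h) \<longlongrightarrow> 0) (at 0)"
      by (simp add: filterlim_split_at)
    then show ?thesis using 3 by (simp add: DERIV_def flat_def)
  qed
qed

text \<open>Bump functions are products of such \<open>flat\<close> terms over the coordinates; sums
  are included so that the product rule does not lead out of the set.\<close>

inductive_set flat_class :: "(real^'d::finite \<Rightarrow> complex) set" where
  flat: "(\<lambda>x. complex_of_real (flat p (a + b * x$i))) \<in> flat_class"
| const: "(\<lambda>x. c) \<in> flat_class"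
| add: "f \<in> flat_class \<Longrightarrow> g \<in> flat_class \<Longrightarrow> (\<lambda>x. f x + g x) \<in> flat_class"
| mult: "f \<in> flat_class \<Longrightarrow> g \<in> flat_class \<Longrightarrow> (\<lambda>x. f x * g x) \<in> flat_class"

lemma flat_class_prod:
  "finite I \<Longrightarrow> (\<And>i. i \<in> I \<Longrightarrow> f i \<in> flat_class) \<Longrightarrow> (\<lambda>x. \<Prod>i\<in>I. f i x) \<in> flat_class"
  by (induction I rule: finite_induct) (auto intro: flat_class.intros)

lemma flat_class_partial:
  fixes g :: "real^'d::finite \<Rightarrow> complex"
  shows "g \<in> flat_class \<Longrightarrow>
    \<exists>h\<in>flat_class. \<forall>x. ((\<lambda>t. g (x + t *\<^sub>R axis j 1)) has_vector_derivative h x) (at 0)"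
proof (induction rule: flat_class.induct)
  case (flat p a b i)
  let ?q = "[:0, 0, 1:] * (p - pderiv p)"
  let ?h = "\<lambda>x. complex_of_real (if i = j then b else 0) * complex_of_real (flat ?q (a + b * x$i))"
  have "((\<lambda>t. complex_of_real (flat p (a + b * (x + t *\<^sub>R axis j 1)$i))) has_vector_derivative ?h x) (at 0)"
    for x :: "real^'d"
  proof -
    have "((\<lambda>t. a + b * (x + t *\<^sub>R axis j 1)$i) has_real_derivative (if i = j then b else 0)) (at 0)"
      by (auto intro!: derivative_eq_intros simp: axis_def)
    from DERIV_chain'[OF this flat_has_derivative[of p]]
    have "((\<lambda>t. flat p (a + b * (x + t *\<^sub>R axis j 1)$i)) has_vector_derivative
        (if i = j then b else 0) * flat ?q (a + b * x$i)) (at 0)"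
      by (simp add: has_real_derivative_iff_has_vector_derivative mult.commute)
    from bounded_linear.has_vector_derivative[OF bounded_linear_of_real this]
    show ?thesis by simp
  qed
  moreover have "?h \<in> flat_class" by (intro flat_class.intros)
  ultimately show ?case by (intro bexI[of _ ?h] allI)
next
  case (const c)
  then show ?case by (intro bexI[of _ "\<lambda>x. 0"]) (auto intro: flat_class.intros)
next
  case (add f g)
  then obtain f' g' where "f' \<in> flat_class" "g' \<in> flat_class"
    "\<And>x. ((\<lambda>t. f (x + t *\<^sub>R axis j 1)) has_vector_derivative f' x) (at 0)"
    "\<And>x. ((\<lambda>t. g (x + t *\<^sub>R axis j 1)) has_vector_derivative g' x) (at 0)" by blast
  then show ?case
    by (intro bexI[of _ "\<lambda>x. f' x + g' x"]) (auto intro: flat_class.intros has_vector_derivative_add)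
next
  case (mult f g)
  then obtain f' g' where *: "f' \<in> flat_class" "g' \<in> flat_class"
    "\<And>x. ((\<lambda>t. f (x + t *\<^sub>R axis j 1)) has_vector_derivative f' x) (at 0)"
    "\<And>x. ((\<lambda>t. g (x + t *\<^sub>R axis j 1)) has_vector_derivative g' x) (at 0)" by blast
  have "((\<lambda>t. f (x + t *\<^sub>R axis j 1) * g (x + t *\<^sub>R axis j 1)) has_vector_derivative f x * g' x + f' x * g x) (at 0)" for x
    using has_vector_derivative_mult[OF *(3,4), of x] by simp
  moreover have "(\<lambda>x. f x * g' x + f' x * g x) \<in> flat_class"
    by (intro flat_class.intros * mult.hyps)
  ultimately show ?case by (intro bexI) auto
qed

lemma flat_class_continuous:
  fixes g :: "real^'d::finite \<Rightarrow> complex"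
  shows "g \<in> flat_class \<Longrightarrow> continuous_on UNIV g"
proof (induction rule: flat_class.induct)
  case (flat p a b i)
  have "continuous_on UNIV (flat p)"
    by (meson DERIV_continuous_on flat_has_derivative has_field_derivative_at_within)
  moreover have "continuous_on UNIV (\<lambda>x::real^'d. a + b * x$i)"
    by (intro continuous_intros)
  ultimately have "continuous_on UNIV (\<lambda>x::real^'d. flat p (a + b * x$i))"
    by (rule continuous_on_compose2) simp
  then show ?case by (rule continuous_on_of_real)
next
  case (const c)
  show ?case by (rule continuous_on_const)
next
  case (add f g)
  then show ?case by (intro continuous_on_add)
next
  case (mult f g)
  then show ?case by (intro continuous_on_mult)
qed

text \<open>A product over the coordinates of \<open>flat 1\<close>, evaluated at the signed
  distances to the two faces of the cube of half-width \<open>\<epsilon>\<close> around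
  \<open>q\<close>; \<open>flat 1 t\<close> is positive exactly for t > 0.\<close>

lemma ex_bump:
  fixes q :: "real^'d::finite"
  assumes "\<epsilon> > 0"
  obtains \<psi> :: "real^'d \<Rightarrow> real" where
    "Cinf_on UNIV (\<lambda>x. complex_of_real (\<psi> x))" "\<And>x. \<psi> x \<ge> 0"
    "\<And>x. \<psi> x > 0 \<longleftrightarrow> (\<forall>i. \<bar>x$i - q$i\<bar> < \<epsilon>)"
proof
  define \<psi> :: "real^'d \<Rightarrow> real" where
    "\<psi> x = (\<Prod>i\<in>UNIV. flat 1 ((\<epsilon> - q$i) + 1 * x$i) * flat 1 ((\<epsilon> + q$i) + (-1) * x$i))" for x
  have "(\<lambda>x. complex_of_real (\<psi> x)) \<in> flat_class"
    unfolding \<psi>_def of_real_prod of_real_mult by (intro flat_class_prod flat_class.intros) simp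
  then show "Cinf_on UNIV (\<lambda>x. complex_of_real (\<psi> x))"
    by (rule Cinf_on_UNIV_closed_class[OF _ flat_class_continuous flat_class_partial])
  have nn: "flat 1 t \<ge> 0" "flat 1 t = 0 \<longleftrightarrow> t \<le> 0" for t by (auto simp: flat_def)
  then show "\<psi> x \<ge> 0" for x unfolding \<psi>_def by (intro prod_nonneg) simp
  have "\<psi> x = 0 \<longleftrightarrow> (\<exists>i. \<not> \<bar>x$i - q$i\<bar> < \<epsilon>)" for x
  proof -
    have "\<not> \<bar>x$i - q$i\<bar> < \<epsilon> \<longleftrightarrow> (\<epsilon> - q$i) + 1 * x$i \<le> 0 \<or> (\<epsilon> + q$i) + (-1) * x$i \<le> 0" for i
      by linarith
    then show ?thesis by (simp add: \<psi>_def nn)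
  qed
  then show "\<psi> x > 0 \<longleftrightarrow> (\<forall>i. \<bar>x$i - q$i\<bar> < \<epsilon>)" for x
    using \<open>\<psi> x \<ge> 0\<close> by (metis less_eq_real_def less_irrefl)
qed

text \<open>If h(q) is nonzero, multiplying h by the conjugate of h(q) makes its real part positive
  near q. Against a nonnegative bump near q the integral could vanish only if the integrand vanished
  almost everywhere, but it is positive on a box.\<close>

lemma fundamental_lemma_calculus_of_variations:
  fixes h :: "real^'d::finite \<Rightarrow> complex"
  assumes "open D" "continuous_on D h" and zero: "\<And>\<phi>. test_fun D \<phi> \<Longrightarrow> fdist h \<phi> = 0" and "q \<in> D"
  shows "h q = 0"
proof (rule ccontr)
  assume "h q \<noteq> 0"
  define F where "F x = Re (cnj (h q) * h x)" for x
  have "continuous_on D F" unfolding F_def by (intro continuous_intros assms)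
  then have "open (D \<inter> F -` {0<..})" using \<open>open D\<close> by (intro continuous_open_preimage) auto
  moreover have "F q > 0"
    using \<open>h q \<noteq> 0\<close> by (simp add: F_def complex_mult_cnj mult.commute[of "cnj _"] sum_power2_gt_zero_iff complex_eq_iff)
  ultimately obtain e where e: "e > 0" "cball q e \<subseteq> D \<inter> F -` {0<..}"
    using \<open>q \<in> D\<close> open_contains_cball by (metis Int_iff greaterThan_iff vimageI)
  \<comment> \<open>The l1 bound on the Euclidean norm puts the cube of half-width
    \<open>\<epsilon>\<close> inside \<open>cball q e\<close>.\<close>
  define \<epsilon> where "\<epsilon> = e / real CARD('d)"
  have "\<epsilon> > 0" using e by (simp add: \<epsilon>_def)
  then obtain \<psi> :: "real^'d \<Rightarrow> real" where \<psi>: "Cinf_on UNIV (\<lambda>x. complex_of_real (\<psi> x))" "\<And>x. \<psi> x \<ge> 0"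
    "\<And>x. \<psi> x > 0 \<longleftrightarrow> (\<forall>i. \<bar>x$i - q$i\<bar> < \<epsilon>)" using ex_bump[of \<epsilon> q] by blast
  have ball: "x \<in> cball q e" if "\<psi> x \<noteq> 0" for x
  proof -
    have "\<forall>i. \<bar>x$i - q$i\<bar> < \<epsilon>" using that \<psi>(2)[of x] \<psi>(3)[of x] by auto
    then have "norm (x - q) \<le> (\<Sum>i\<in>(UNIV::'d set). \<epsilon>)"
      by (intro order.trans[OF norm_le_l1_cart] sum_mono) (simp add: less_imp_le)
    then show ?thesis using e by (simp add: \<epsilon>_def dist_norm norm_minus_commute)
  qed
  let ?\<phi> = "\<lambda>x. complex_of_real (\<psi> x)"
  have sub: "supp ?\<phi> \<subseteq> cball q e"
    unfolding supp_def by (rule closure_minimal) (use ball in auto)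
  then have "test_fun D ?\<phi>"
    using \<psi>(1) e(2) by (auto simp: test_fun_def supp_def compact_eq_bounded_closed intro: bounded_subset[OF bounded_cball])
  then have int: "integrable lborel (\<lambda>x. h x * ?\<phi> x)" and z: "fdist h ?\<phi> = 0"
    using integrable_test_fun[OF assms(2), of ?\<phi> "[]"] zero by auto
  have F: "F x * \<psi> x = Re (cnj (h q) * (h x * ?\<phi> x))" for x by (simp add: F_def algebra_simps)
  have int': "integrable lborel (\<lambda>x. cnj (h q) * (h x * ?\<phi> x))" using int by simp
  have intF: "integrable lborel (\<lambda>x. F x * \<psi> x)" unfolding F using integrable_Re[OF int'] .
  have "(LINT x|lborel. F x * \<psi> x) = Re (LINT x|lborel. cnj (h q) * (h x * ?\<phi> x))"
    unfolding F by (rule integral_Re[OF int'])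
  also have "\<dots> = 0" using z by (simp add: fdist_def)
  finally have "(LINT x|lborel. F x * \<psi> x) = 0" .
  moreover have "F x * \<psi> x \<ge> 0" for x
    using ball[of x] \<psi>(2)[of x] e(2) by (cases "\<psi> x = 0") (auto intro!: mult_nonneg_nonneg dest!: subsetD[of "cball q e"])
  ultimately have "AE x in lborel. F x * \<psi> x = 0"
    using integral_nonneg_eq_0_iff_AE[OF intF] by simp
  moreover have "F x * \<psi> x \<noteq> 0" if "x \<in> box (q - (\<chi> i. \<epsilon>)) (q + (\<chi> i. \<epsilon>))" for x
  proof -
    have "\<bar>x$i - q$i\<bar> < \<epsilon>" for i
      using that[unfolded mem_box_cart, rule_format, of i] by (simp add: abs_less_iff)
    then have "\<psi> x > 0" using \<psi>(3) by blast
    then show ?thesis using ball[of x] e(2) by fastforce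
  qed
  ultimately have "AE x in lborel. x \<notin> box (q - (\<chi> i. \<epsilon>)) (q + (\<chi> i. \<epsilon>))"
    by (auto elim!: eventually_mono)
  then have "box (q - (\<chi> i. \<epsilon>)) (q + (\<chi> i. \<epsilon>)) \<in> null_sets lborel"
    by (subst (asm) AE_iff_null_sets[symmetric]) auto
  then have "negligible (box (q - (\<chi> i. \<epsilon>)) (q + (\<chi> i. \<epsilon>)))"
    by (simp add: negligible_iff_null_sets null_sets_completionI)
  moreover have "q \<in> box (q - (\<chi> i. \<epsilon>)) (q + (\<chi> i. \<epsilon>))"
    using \<open>\<epsilon> > 0\<close> by (simp add: mem_box_cart)
  ultimately show False using open_not_negligible[OF open_box] by blast
qed

section \<open>Anisotropic dilations\<close>

text \<open>With natural powers instead of \<open>powr\<close>, the curve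
  \<open>\<lambda>t. dil s t w\<close> is defined and differentiable across t = 0, and derivatives
  along it are taken on all of {-1<..<1} later.\<close>

definition dil :: "('d::finite \<Rightarrow> nat) \<Rightarrow> real \<Rightarrow> real^'d \<Rightarrow> real^'d" where
  "dil s r z = (\<chi> i. r ^ s i * z$i)"

lemma adist_nonneg: "0 \<le> adist s x y"
  by (simp add: adist_def sum_nonneg)

lemma adist_self [simp]: "adist s x x = 0"
  by (simp add: adist_def)

lemma continuous_on_adist:
  assumes "\<forall>i. 1 \<le> s i" "continuous_on A f" "continuous_on A g"
  shows "continuous_on A (\<lambda>x. adist s (f x) (g x))"
  unfolding adist_def using assms(2,3)
  by (intro continuous_on_sum continuous_on_powr' continuous_intros) (use assms(1) in \<open>auto simp: Suc_le_eq\<close>)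

lemma open_adist_ball: "\<forall>i. 1 \<le> s i \<Longrightarrow> open {y. adist s x y < r}"
  by (intro open_Collect_less continuous_on_adist continuous_intros)

lemma adist_eq_0_iff [simp]: "adist s x y = 0 \<longleftrightarrow> x = y"
  by (auto simp: adist_def sum_nonneg_eq_0_iff vec_eq_iff)

lemma powr_inverse_nat_power: "0 \<le> r \<Longrightarrow> 1 \<le> k \<Longrightarrow> (r ^ k) powr (1 / real k) = r"
  by (cases "r = 0") (auto simp: powr_realpow[symmetric] powr_powr)

lemma adist_dil:
  assumes "\<forall>i. 1 \<le> s i"
  shows "adist s (x + dil s r y) (x + dil s r z) = \<bar>r\<bar> * adist s y z"
proof -
  have "\<bar>r ^ s i * y$i - r ^ s i * z$i\<bar> powr (1 / real (s i)) = \<bar>r\<bar> * \<bar>y$i - z$i\<bar> powr (1 / real (s i))" for i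
  proof -
    have "\<bar>r ^ s i * y$i - r ^ s i * z$i\<bar> = \<bar>r\<bar> ^ s i * \<bar>y$i - z$i\<bar>"
      by (simp add: abs_mult power_abs flip: right_diff_distrib)
    then show ?thesis using assms by (simp add: powr_mult powr_inverse_nat_power)
  qed
  then show ?thesis by (simp add: adist_def dil_def sum_distrib_left)
qed

lemma adist_0_dil: "\<forall>i. 1 \<le> s i \<Longrightarrow> adist s 0 (dil s r z) = \<bar>r\<bar> * adist s 0 z"
  using adist_dil[of s 0 r 0 z] by (simp add: dil_def flip: zero_vec_def)

lemma continuous_on_dil: "continuous_on A f \<Longrightarrow> continuous_on A (\<lambda>z. dil s r (f z))"
  unfolding dil_def by (intro continuous_intros) auto

lemma dil_dil: "dil s r (dil s r' z) = dil s (r * r') z"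
  by (simp add: dil_def power_mult_distrib mult.assoc)

lemma dil_1 [simp]: "dil s 1 z = z"
  by (simp add: dil_def)

lemma abs_component_le_adist:
  assumes "\<forall>i. 1 \<le> s i"
  shows "\<bar>z$i\<bar> \<le> adist s 0 z ^ s i"
proof -
  have "\<bar>z$i\<bar> powr (1 / real (s i)) \<le> adist s 0 z"
    using member_le_sum[of i UNIV "\<lambda>i. \<bar>z$i\<bar> powr (1 / real (s i))"] by (simp add: adist_def)
  then have "(\<bar>z$i\<bar> powr (1 / real (s i))) ^ s i \<le> adist s 0 z ^ s i"
    by (intro power_mono) auto
  moreover have "s i > 0" using assms by (simp add: Suc_le_eq)
  then have "(\<bar>z$i\<bar> powr (1 / real (s i))) ^ s i = \<bar>z$i\<bar>"
    by (cases "z$i = 0") (auto simp: powr_realpow[symmetric] powr_powr power_0_left)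
  ultimately show ?thesis by simp
qed

text \<open>Enlarging \<open>K\<close> to \<open>K + 1\<close> makes the base at least 1, so that
  the exponents 1/s_i, which are at most 1, can only decrease it.\<close>

lemma adist_0_le:
  fixes z :: "real^'d::finite"
  assumes "\<forall>i. 1 \<le> s i" "\<And>i. \<bar>z$i\<bar> \<le> K"
  shows "adist s 0 z \<le> real CARD('d) * (K + 1)"
proof -
  have "\<bar>z$i\<bar> powr (1 / real (s i)) \<le> K + 1" for i
  proof -
    have "\<bar>z$i\<bar> powr (1 / real (s i)) \<le> (K + 1) powr (1 / real (s i))"
      using assms(2)[of i] by (intro powr_mono2) auto
    also have "\<dots> \<le> (K + 1) powr 1"
      using assms(2)[of i] assms(1)[rule_format, of i] by (intro powr_mono) (auto simp: field_simps)
    finally show ?thesis using assms(2)[of i] by simp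
  qed
  then have "adist s 0 z \<le> (\<Sum>i\<in>(UNIV::'d set). K + 1)"
    unfolding adist_def by (intro sum_mono) simp
  then show ?thesis by simp
qed

lemma integral_lborel_dil:
  fixes G :: "real^'d::finite \<Rightarrow> complex"
  assumes "\<mu> > 0" and [measurable]: "G \<in> borel_measurable borel"
  shows "(LINT y|lborel. G y) = of_real (\<mu> ^ (\<Sum>i\<in>UNIV. s i)) * (LINT z|lborel. G (x + dil s \<mu> z))"
proof -
  \<comment> \<open>\<open>lborel_affine_euclidean\<close> wants one factor per basis vector; this
    linear form returns \<open>\<mu> ^ s j\<close> on the j-th one, so no inverse of
    \<open>axis\<close> has to be chosen.\<close>
  define c :: "real^'d \<Rightarrow> real" where "c b = (\<Sum>i\<in>UNIV. \<mu> ^ s i * b$i)" for b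
  have ca: "c (axis j 1) = \<mu> ^ s j" for j
    by (simp add: c_def axis_def if_distrib sum.If_cases cong: if_cong)
  have inj: "inj (\<lambda>i::'d. axis i (1::real))" by (simp add: inj_on_def axis_eq_axis)
  have B: "(Basis :: (real^'d) set) = range (\<lambda>i. axis i 1)" by (auto simp: Basis_vec_def)
  have T: "x + (\<Sum>j\<in>Basis. (c j * (z \<bullet> j)) *\<^sub>R j) = x + dil s \<mu> z" for z
  proof -
    have "(\<Sum>j\<in>Basis. (c j * (z \<bullet> j)) *\<^sub>R j) = (\<Sum>i\<in>UNIV. (\<mu> ^ s i * z$i) *\<^sub>R axis i 1)"
      unfolding B by (simp add: sum.reindex[OF inj] ca inner_axis)
    also have "\<dots> = dil s \<mu> z"
      by (simp add: dil_def vec_eq_iff axis_def if_distrib cong: if_cong)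
    finally show ?thesis by simp
  qed
  have P: "(\<Prod>j\<in>Basis. \<bar>c j\<bar>) = \<mu> ^ (\<Sum>i\<in>UNIV. s i)"
    unfolding B using \<open>\<mu> > 0\<close> by (simp add: prod.reindex[OF inj] ca power_sum)
  have [measurable]: "(\<lambda>z. x + dil s \<mu> z) \<in> borel_measurable borel"
    by (intro borel_measurable_continuous_onI continuous_intros continuous_on_dil)
  have "lborel = density (distr lborel borel (\<lambda>z. x + dil s \<mu> z)) (\<lambda>_. ennreal (\<mu> ^ (\<Sum>i\<in>UNIV. s i)))"
  proof -
    have "c j \<noteq> 0" if "j \<in> Basis" for j using that \<open>\<mu> > 0\<close> by (auto simp: B ca)
    from lborel_affine_euclidean[of c x, OF this] show ?thesis by (simp only: T P)
  qed
  then have "(LINT y|lborel. G y) = (LINT y|density (distr lborel borel (\<lambda>z. x + dil s \<mu> z)) (\<lambda>_. ennreal (\<mu> ^ (\<Sum>i\<in>UNIV. s i))). G y)"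
    by simp
  also have "\<dots> = of_real (\<mu> ^ (\<Sum>i\<in>UNIV. s i)) * (LINT z|lborel. G (x + dil s \<mu> z))"
    using \<open>\<mu> > 0\<close> by (subst integral_density) (auto simp: integral_distr scaleR_conv_of_real)
  finally show ?thesis .
qed

text \<open>Every term of the operator has anisotropic order exactly m and contributes the same
  factor mu^(-m); the normalisation in \<open>rescale\<close> cancels against the Jacobian of the
  dilation. Thus bounds at scale mu become bounds at unit scale for the dilated function.\<close>

lemma Lop_rescale:
  fixes U :: "real^'d::finite \<Rightarrow> complex"
  assumes "\<mu> > 0" "continuous_on UNIV U" "test_fun UNIV \<phi>"
  shows "Lop s m a (fdist U) (rescale s \<phi> \<mu> x) =
    of_real (inverse \<mu> ^ m) * Lop s m a (fdist (\<lambda>z. U (x + dil s \<mu> z))) \<phi>"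
proof -
  let ?S = "\<Sum>i\<in>UNIV. s i"
  have pw: "\<mu> powr (- real k) = inverse \<mu> ^ k" for k
    using \<open>\<mu> > 0\<close> by (simp add: powr_minus powr_realpow power_inverse)
  have Cinf: "Cinf_on UNIV \<phi>" using assms by (simp add: test_fun_def)
  have pd: "pd \<gamma> (rescale s \<phi> \<mu> x) = (\<lambda>y. of_real (inverse \<mu> ^ ?S) * of_real (inverse \<mu> ^ adeg s \<gamma>) *
      pd \<gamma> \<phi> (\<chi> i. inverse \<mu> ^ s i * (y$i - x$i)))" for \<gamma>
    unfolding rescale_def pw pd_def by (subst iter_partial_affine[OF Cinf]) (simp only: prod_list_mi_list)
  have fd: "fdist U (pd \<gamma> (rescale s \<phi> \<mu> x)) =
      of_real (inverse \<mu> ^ m) * fdist (\<lambda>z. U (x + dil s \<mu> z)) (pd \<gamma> \<phi>)" if "adeg s \<gamma> = m" for \<gamma>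
  proof -
    have cont: "continuous_on UNIV (pd \<gamma> \<phi>)" using assms(3) by (simp add: pd_def test_fun_continuous)
    have "continuous_on UNIV (\<lambda>y. U y * pd \<gamma> (rescale s \<phi> \<mu> x) y)"
      unfolding pd using assms(2)
      by (intro continuous_intros continuous_on_compose2[OF cont]) auto
    then have meas: "(\<lambda>y. U y * pd \<gamma> (rescale s \<phi> \<mu> x) y) \<in> borel_measurable borel"
      by (rule borel_measurable_continuous_onI)
    have inv: "(\<chi> i. inverse \<mu> ^ s i * ((x + dil s \<mu> z)$i - x$i)) = z" for z
      using \<open>\<mu> > 0\<close> by (simp add: dil_def vec_eq_iff power_inverse)
    show ?thesis
      unfolding fdist_def integral_lborel_dil[OF \<open>\<mu> > 0\<close> meas, of s x]
      using \<open>\<mu> > 0\<close> that unfolding pd inv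
      by (simp add: mult_ac power_inverse flip: integral_mult_right_zero) (simp add: field_simps)
  qed
  show ?thesis unfolding Lop_def sum_distrib_left
    by (rule sum.cong) (auto simp: fd mult_ac)
qed

text \<open>All derivatives sit on the test function, so dominated convergence asks only for
  pointwise convergence and a uniform bound on the set \<open>D\<close> that contains the
  support.\<close>

lemma Lop_tendsto:
  fixes f :: "nat \<Rightarrow> real^'d::finite \<Rightarrow> complex"
  assumes "test_fun D \<phi>" "\<And>n. continuous_on UNIV (f n)" "continuous_on UNIV F"
    and lim: "\<And>z. z \<in> D \<Longrightarrow> (\<lambda>n. f n z) \<longlonglongrightarrow> F z"
    and B: "\<And>n z. z \<in> D \<Longrightarrow> norm (f n z) \<le> B"
  shows "(\<lambda>n. Lop s m a (fdist (f n)) \<phi>) \<longlonglongrightarrow> Lop s m a (fdist F) \<phi>"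
proof -
  have "(\<lambda>n. fdist (f n) (pd \<gamma> \<phi>)) \<longlonglongrightarrow> fdist F (pd \<gamma> \<phi>)" for \<gamma>
    unfolding fdist_def
  proof (rule integral_dominated_convergence[where w="\<lambda>y. B * norm (pd \<gamma> \<phi> y)"])
    have cont: "continuous_on UNIV (pd \<gamma> \<phi>)" using assms(1) by (simp add: pd_def test_fun_continuous)
    have z: "pd \<gamma> \<phi> y = 0" if "y \<notin> D" for y
      unfolding pd_def using that assms(1) by (intro iter_partial_eq_0) (auto simp: test_fun_def)
    show "(\<lambda>y. F y * pd \<gamma> \<phi> y) \<in> borel_measurable lborel"
      "(\<lambda>y. f n y * pd \<gamma> \<phi> y) \<in> borel_measurable lborel" for n
      using cont assms by (auto intro!: borel_measurable_continuous_onI continuous_intros)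
    have "integrable lborel (\<lambda>y. 1 * pd \<gamma> \<phi> y)"
      unfolding pd_def using integrable_test_fun[OF _ assms(1), of "\<lambda>_. 1"] by simp
    then show "integrable lborel (\<lambda>y. B * norm (pd \<gamma> \<phi> y))" by simp
    show "AE y in lborel. (\<lambda>n. f n y * pd \<gamma> \<phi> y) \<longlonglongrightarrow> F y * pd \<gamma> \<phi> y"
    proof (rule AE_I2)
      fix y
      show "(\<lambda>n. f n y * pd \<gamma> \<phi> y) \<longlonglongrightarrow> F y * pd \<gamma> \<phi> y"
        using lim[of y] z[of y] by (cases "y \<in> D") (auto intro: tendsto_intros)
    qed
    show "AE y in lborel. norm (f n y * pd \<gamma> \<phi> y) \<le> B * norm (pd \<gamma> \<phi> y)" for n
    proof (rule AE_I2)
      fix y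
      show "norm (f n y * pd \<gamma> \<phi> y) \<le> B * norm (pd \<gamma> \<phi> y)"
        using B[of y n] z[of y] by (cases "y \<in> D") (auto simp: norm_mult intro: mult_right_mono)
    qed
  qed
  then show ?thesis unfolding Lop_def by (intro tendsto_intros)
qed

lemma Lop_cmult_fun: "Lop s m a (fdist (\<lambda>z. c * f z)) \<phi> = c * Lop s m a (fdist f) \<phi>"
  by (simp add: Lop_def fdist_def sum_distrib_left mult_ac flip: integral_mult_right_zero)

lemma Lop_add_fun:
  assumes "test_fun D \<phi>" "continuous_on UNIV f" "continuous_on UNIV g"
  shows "Lop s m a (fdist (\<lambda>z. f z + g z)) \<phi> = Lop s m a (fdist f) \<phi> + Lop s m a (fdist g) \<phi>"
proof -
  have "fdist (\<lambda>z. f z + g z) (pd \<gamma> \<phi>) = fdist f (pd \<gamma> \<phi>) + fdist g (pd \<gamma> \<phi>)" for \<gamma>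
    unfolding fdist_def pd_def distrib_right
    by (intro Bochner_Integration.integral_add integrable_test_fun[of D] assms)
      (use assms in \<open>auto intro: continuous_on_subset\<close>)
  then show ?thesis by (simp add: Lop_def sum.distrib algebra_simps)
qed

lemma Lop_cmult_test:
  assumes "test_fun D \<phi>"
  shows "Lop s m a (fdist f) (\<lambda>y. c * \<phi> y) = c * Lop s m a (fdist f) \<phi>"
  using assms
  by (simp add: Lop_def fdist_def pd_def test_fun_def iter_partial_cmult sum_distrib_left mult_ac
      flip: integral_mult_right_zero)

lemma ex_scale_testB:
  fixes \<phi> :: "real^'d::finite \<Rightarrow> complex"
  assumes s: "\<forall>i. 1 \<le> s i" and \<phi>: "test_fun {y. adist s 0 y < 1} \<phi>"
  shows "\<exists>c>0. (\<lambda>y. complex_of_real c * \<phi> y) \<in> testB s k"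
proof -
  have "\<exists>B>0. \<forall>x. norm (pd \<beta> \<phi> x) \<le> B" for \<beta>
    unfolding pd_def by (rule test_fun_bounded[OF \<phi>]) blast
  then obtain B where B: "\<And>\<beta>. B \<beta> > 0" "\<And>\<beta> x. norm (pd \<beta> \<phi> x) \<le> B \<beta>" by metis
  define c where "c = 1 / (1 + (\<Sum>\<beta>\<in>{\<beta>. adeg s \<beta> \<le> k}. B \<beta>))"
  have pos: "1 + (\<Sum>\<beta>\<in>{\<beta>. adeg s \<beta> \<le> k}. B \<beta>) > 0"
    using B(1) by (intro add_pos_nonneg sum_nonneg) (auto intro: less_imp_le)
  then have "c > 0" by (simp add: c_def)
  have \<phi>': "Cinf_on UNIV \<phi>" using \<phi> by (simp add: test_fun_def)
  have "norm (pd \<beta> (\<lambda>y. complex_of_real c * \<phi> y) x) \<le> 1" if "adeg s \<beta> \<le> k" for \<beta> x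
  proof -
    have "norm (pd \<beta> \<phi> x) \<le> B \<beta>" by (rule B)
    also have "\<dots> \<le> (\<Sum>\<beta>\<in>{\<beta>. adeg s \<beta> \<le> k}. B \<beta>)"
      using that finite_adeg_le[OF s] B(1) by (intro member_le_sum) (auto intro: less_imp_le)
    finally have "c * norm (pd \<beta> \<phi> x) \<le> 1"
      using pos by (simp add: c_def divide_simps)
    then show ?thesis
      using \<open>c > 0\<close> by (simp add: pd_def iter_partial_cmult[OF \<phi>'] norm_mult)
  qed
  moreover have "supp (\<lambda>y. complex_of_real c * \<phi> y) = supp \<phi>"
    using \<open>c > 0\<close> by (simp add: supp_def)
  ultimately have "(\<lambda>y. complex_of_real c * \<phi> y) \<in> testB s k"
    using \<phi> by (simp add: testB_def test_fun_def Cinf_on_cmult)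
  with \<open>c > 0\<close> show ?thesis by blast
qed

text \<open>The negative seminorm tests against the normalised class \<open>testB\<close>, whereas
  ellipticity speaks of all test functions on an open set. A nonzero multiple of every test function
  on the unit ball lies in \<open>testB\<close>, so linearity closes the gap.\<close>

lemma Lop_eq_0_on_ball:
  assumes "\<forall>i. 1 \<le> s i" and zero: "\<And>\<phi>. \<phi> \<in> testB s k \<Longrightarrow> Lop s m a (fdist f) \<phi> = 0"
    and \<phi>: "test_fun {y. adist s 0 y < 1} \<phi>"
  shows "Lop s m a (fdist f) \<phi> = 0"
proof -
  obtain c where "c > 0" "(\<lambda>y. complex_of_real c * \<phi> y) \<in> testB s k"
    using ex_scale_testB[OF assms(1) \<phi>] by blast
  then show ?thesis using zero Lop_cmult_test[OF \<phi>, of s m a f "complex_of_real c"] by simp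
qed

text \<open>Integration against a continuous function is a distribution of order 0: the integral of
  |u| over \<open>K\<close> times the supremum of the test function bounds it, so N = 0
  works.\<close>

lemma distribution_fdist:
  fixes u :: "real^'d::finite \<Rightarrow> complex"
  assumes cont: "continuous_on UNIV u"
  shows "distribution D (fdist u)"
  unfolding distribution_def
proof (intro conjI allI impI)
  have int: "integrable lborel (\<lambda>y. u y * \<phi> y)" if "test_fun D \<phi>" for \<phi>
    using integrable_test_fun[OF _ that, of u "[]"] cont by (auto intro: continuous_on_subset)
  show "fdist u (\<lambda>x. \<phi> x + \<psi> x) = fdist u \<phi> + fdist u \<psi>" if "test_fun D \<phi>" "test_fun D \<psi>" for \<phi> \<psi>
    using int that by (simp add: fdist_def distrib_left)
  show "fdist u (\<lambda>x. c * \<phi> x) = c * fdist u \<phi>" for c \<phi>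
    by (simp add: fdist_def mult_ac flip: integral_mult_right_zero)
  fix K :: "(real^'d) set" assume K: "compact K \<and> K \<subseteq> D"
  have intK: "integrable lborel (\<lambda>y. indicator K y *\<^sub>R norm (u y))"
    using K by (intro borel_integrable_compact continuous_intros) (auto intro: continuous_on_subset[OF cont])
  have "norm (fdist u \<phi>) \<le> (LINT y|lborel. indicator K y *\<^sub>R norm (u y)) *
      (\<Sum>\<beta>\<in>{\<beta>. \<forall>i. \<beta> i \<le> 0}. SUP x. norm (pd \<beta> \<phi> x))" if \<phi>: "test_fun D \<phi> \<and> supp \<phi> \<subseteq> K" for \<phi>
  proof -
    define M where "M = (SUP x. norm (\<phi> x))"
    obtain B where B: "\<And>x. norm (\<phi> x) \<le> B"
      using test_fun_bounded[of D \<phi> "[]", unfolded iter_partial_Nil] \<phi> by metis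
    have M: "norm (\<phi> x) \<le> M" for x
      unfolding M_def by (rule cSUP_upper) (auto intro!: bdd_aboveI2[of _ _ B] B)
    \<comment> \<open>With N = 0 only the zero multi-index remains, and its \<open>mi_list\<close>
      is empty.\<close>
    have "{\<beta>::'d\<Rightarrow>nat. \<forall>i. \<beta> i \<le> 0} = {\<lambda>_. 0}" by auto
    then have "(\<Sum>\<beta>\<in>{\<beta>. \<forall>i. \<beta> i \<le> 0}. SUP x. norm (pd \<beta> \<phi> x)) = M"
      by (simp add: pd_def mi_list_0 M_def)
    moreover have "norm (fdist u \<phi>) \<le> (LINT y|lborel. (indicator K y *\<^sub>R norm (u y)) * M)"
      unfolding fdist_def
    proof (rule order.trans[OF integral_norm_bound integral_mono])
      show "integrable lborel (\<lambda>y. norm (u y * \<phi> y))" using int \<phi> by simp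
      show "integrable lborel (\<lambda>y. indicator K y *\<^sub>R norm (u y) * M)" using intK by simp
      show "norm (u y * \<phi> y) \<le> indicator K y *\<^sub>R norm (u y) * M" for y
      proof (cases "y \<in> K")
        case False
        then have "\<phi> y = 0" using iter_partial_eq_0[of y \<phi> "[]"] \<phi> by auto
        with False show ?thesis by simp
      qed (use M[of y] in \<open>auto simp: norm_mult intro!: mult_left_mono\<close>)
    qed
    ultimately show ?thesis by simp
  qed
  then show "\<exists>C N. \<forall>\<phi>. test_fun D \<phi> \<and> supp \<phi> \<subseteq> K \<longrightarrow>
      norm (fdist u \<phi>) \<le> C * (\<Sum>\<beta>\<in>{\<beta>. \<forall>i. \<beta> i \<le> N}. SUP x. norm (pd \<beta> \<phi> x))" by blast
qed

section \<open>Finite differences and uniform boundedness\<close>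

text \<open>The k-th forward difference with step \<open>h\<close>.\<close>

primrec fd :: "real \<Rightarrow> nat \<Rightarrow> (real \<Rightarrow> complex) \<Rightarrow> real \<Rightarrow> complex" where
  "fd h 0 g t = g t"
| "fd h (Suc k) g t = fd h k g (t + h) - fd h k g t"

lemma fd_norm_le:
  "(\<And>j. j \<le> k \<Longrightarrow> norm (g (t + real j * h)) \<le> B) \<Longrightarrow> norm (fd h k g t) \<le> 2 ^ k * B"
proof (induction k arbitrary: t)
  case 0
  from 0[of 0] show ?case by simp
next
  case (Suc k)
  have "norm (fd h k g (t + h)) \<le> 2 ^ k * B"
    using Suc.prems[of "Suc _"] by (intro Suc.IH) (simp add: algebra_simps)
  moreover have "norm (fd h k g t) \<le> 2 ^ k * B"
    by (intro Suc.IH Suc.prems) simp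
  ultimately show ?case
    using norm_triangle_ineq4[of "fd h k g (t + h)" "fd h k g t"] by simp
qed

lemma fd_cong:
  "(\<And>j. j \<le> k \<Longrightarrow> f (t + real j * h) = g (t + real j * h)) \<Longrightarrow> fd h k f t = fd h k g t"
proof (induction k arbitrary: t)
  case 0
  from 0[of 0] show ?case by simp
next
  case (Suc k)
  have "fd h k f (t + h) = fd h k g (t + h)"
    using Suc.prems[of "Suc _"] by (intro Suc.IH) (simp add: algebra_simps)
  moreover have "fd h k f t = fd h k g t" by (intro Suc.IH Suc.prems) simp
  ultimately show ?case by simp
qed

lemma fd_sums:
  "(\<And>t. (\<lambda>i. c i * f i t) sums g t) \<Longrightarrow> (\<lambda>i. c i * fd h k (f i) t) sums fd h k g t"
proof (induction k arbitrary: t)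
  case (Suc k)
  from sums_diff[OF Suc.IH[OF Suc.prems] Suc.IH[OF Suc.prems]]
  show ?case by (simp add: right_diff_distrib)
qed simp

lemma fd_scale: "fd h k (\<lambda>\<tau>. c * g (r * \<tau>)) t = c * fd (r * h) k g (r * t)"
  by (induction k arbitrary: t) (simp_all add: algebra_simps)

text \<open>The binomial expansion of the n-th power of the shift, written as identity plus forward
  difference; the induction step is Pascal's rule.\<close>

lemma newton_forward: "g (t + real n * h) = (\<Sum>i\<le>n. of_nat (n choose i) * fd h i g t)"
proof (induction n arbitrary: t)
  case (Suc n)
  have "g (t + real (Suc n) * h) = g ((t + h) + real n * h)" by (simp add: algebra_simps)
  also have "\<dots> = (\<Sum>i\<le>n. of_nat (n choose i) * fd h i g (t + h))" by (rule Suc.IH)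
  also have "\<dots> = (\<Sum>i\<le>n. of_nat (n choose i) * fd h (Suc i) g t) + (\<Sum>i\<le>n. of_nat (n choose i) * fd h i g t)"
    by (simp add: algebra_simps sum_subtractf flip: sum.distrib)
  also have "(\<Sum>i\<le>n. of_nat (n choose i) * fd h i g t) = (\<Sum>i\<le>Suc n. of_nat (n choose i) * fd h i g t)"
    by (simp add: binomial_eq_0)
  also have "\<dots> = fd h 0 g t + (\<Sum>i\<le>n. of_nat (n choose Suc i) * fd h (Suc i) g t)"
    by (subst sum.atMost_Suc_shift) simp
  also have "(\<Sum>i\<le>n. of_nat (n choose i) * fd h (Suc i) g t) +
      (fd h 0 g t + (\<Sum>i\<le>n. of_nat (n choose Suc i) * fd h (Suc i) g t)) =
      (\<Sum>i\<le>Suc n. of_nat (Suc n choose i) * fd h i g t)"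
    by (subst sum.atMost_Suc_shift) (simp add: distrib_right sum.distrib algebra_simps del: fd.simps)
  finally show ?case .
qed simp

text \<open>On the grid of step 1/n, g(1) is a combination of differences at 0 of order at most K.
  These see g only up to K/n, where it is at most (K/n)^eta, while the binomial coefficients are at
  most n^K; the product decays because K < eta.\<close>

lemma eq_0_of_vanishing_differences:
  assumes zero: "\<And>t h. 0 \<le> t \<Longrightarrow> 0 < h \<Longrightarrow> fd h (Suc K) g t = 0"
    and g: "\<And>t. 0 \<le> t \<Longrightarrow> norm (g t) \<le> t powr \<eta>" and "real K < \<eta>"
  shows "g 1 = 0"
proof -
  have fd0: "fd h i g t = 0" if "0 < h" "K < i" "0 \<le> t" for h i t
    using that
  proof (induction i arbitrary: t)
    case (Suc i)
    show ?case
    proof (cases "i = K")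
      case True
      then show ?thesis using zero Suc.prems by blast
    next
      case False
      then show ?thesis using Suc.prems Suc.IH[of t] Suc.IH[of "t + h"] by simp
    qed
  qed simp
  \<comment> \<open>K + 1 terms, a factor 2^K from the differences, and K^eta from the largest
    sample point.\<close>
  define A where "A = real (Suc K) * 2 ^ K * real K powr \<eta>"
  have le: "norm (g 1) \<le> A * real n powr (real K - \<eta>)" if "n \<ge> Suc K" for n
  proof -
    have n: "real n > 0" using that by simp
    have "g 1 = (\<Sum>i\<le>n. of_nat (n choose i) * fd (1 / real n) i g 0)"
      using newton_forward[of g 0 n "1 / real n"] n by simp
    also have "\<dots> = (\<Sum>i\<le>K. of_nat (n choose i) * fd (1 / real n) i g 0)"
      using that n by (intro sum.mono_neutral_right) (auto simp: fd0)
    also have "norm \<dots> \<le> (\<Sum>i\<le>K. real n ^ K * (2 ^ K * (real K / real n) powr \<eta>))"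
    proof (rule sum_norm_le)
      fix i assume i: "i \<in> {..K}"
      have "real (n choose i) \<le> real (n ^ i)"
        using binomial_le_pow[of i n] that i by simp
      also have "\<dots> \<le> real n ^ K" using n i that by (simp add: power_increasing)
      finally have 1: "real (n choose i) \<le> real n ^ K" .
      have "norm (fd (1 / real n) i g 0) \<le> 2 ^ i * (real K / real n) powr \<eta>"
      proof (rule fd_norm_le)
        fix j assume "j \<le> i"
        have "norm (g (0 + real j * (1 / real n))) \<le> (real j / real n) powr \<eta>"
          using g[of "real j / real n"] by simp
        also have "\<dots> \<le> (real K / real n) powr \<eta>"
          using i \<open>j \<le> i\<close> n \<open>real K < \<eta>\<close> by (intro powr_mono2 divide_right_mono) auto
        finally show "norm (g (0 + real j * (1 / real n))) \<le> (real K / real n) powr \<eta>" .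
      qed
      also have "\<dots> \<le> 2 ^ K * (real K / real n) powr \<eta>"
        using i by (intro mult_right_mono power_increasing) auto
      finally show "norm (of_nat (n choose i) * fd (1 / real n) i g 0) \<le> real n ^ K * (2 ^ K * (real K / real n) powr \<eta>)"
        using 1 by (simp add: norm_mult mult_mono)
    qed
    also have "\<dots> = A * (real n ^ K * real n powr (- \<eta>))"
      using n by (simp add: A_def powr_divide powr_minus_divide)
    also have "real n ^ K * real n powr (- \<eta>) = real n powr (real K - \<eta>)"
      using n by (simp add: powr_realpow[symmetric] flip: powr_add)
    finally show ?thesis .
  qed
  have "(\<lambda>n. A * real n powr (real K - \<eta>)) \<longlonglongrightarrow> A * 0"
    using \<open>real K < \<eta>\<close> by (intro tendsto_mult tendsto_const tendsto_neg_powr filterlim_real_sequentially) simp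
  moreover have "eventually (\<lambda>n. norm (g 1) \<le> A * real n powr (real K - \<eta>)) sequentially"
    using le eventually_ge_at_top[of "Suc K"] by (rule eventually_mono[rotated])
  ultimately have "norm (g 1) \<le> A * 0" by (intro tendsto_lowerbound) auto
  then show ?thesis by simp
qed

text \<open>The mean value inequality bounds the (k+1)-th difference of f by h times a bound on the
  k-th difference of f'. The family \<open>S\<close>, closed under differentiation, replaces an
  explicit sequence of derivatives. Sample points up to 1/2 stay in a compact part of (-1,1), where
  the derivatives exist.\<close>

lemma fd_bound_smooth:
  assumes der: "\<And>f. f \<in> S \<Longrightarrow> \<exists>f'\<in>S. \<forall>t\<in>{-1<..<1}. (f has_vector_derivative f' t) (at t)"
  shows "f \<in> S \<Longrightarrow> \<exists>C\<ge>0. \<forall>t h. 0 \<le> t \<longrightarrow> 0 < h \<longrightarrow> t + real k * h \<le> 1/2 \<longrightarrow> norm (fd h k f t) \<le> C * h ^ k"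
proof (induction k arbitrary: f)
  case 0
  obtain f' where "\<And>t. t \<in> {-1<..<1} \<Longrightarrow> (f has_vector_derivative f' t) (at t)"
    using der[OF 0] by blast
  then have "continuous (at t) f" if "t \<in> {0..1/2}" for t
    using that by (intro has_vector_derivative_continuous[of f "f' t"]) auto
  then have "continuous_on {0..1/2} f"
    by (intro continuous_at_imp_continuous_on ballI)
  then have "compact (f ` {0..1/2})" by (intro compact_continuous_image) auto
  then obtain B where "B > 0" "\<forall>v\<in>f ` {0..1/2}. norm v \<le> B"
    using compact_imp_bounded bounded_pos by metis
  then show ?case by (intro exI[of _ B]) auto
next
  case (Suc k)
  obtain f' where f': "f' \<in> S" "\<And>t. t \<in> {-1<..<1} \<Longrightarrow> (f has_vector_derivative f' t) (at t)"
    using der[OF Suc.prems] by blast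
  obtain C where C: "C \<ge> 0" "\<And>t h. 0 \<le> t \<Longrightarrow> 0 < h \<Longrightarrow> t + real k * h \<le> 1/2 \<Longrightarrow> norm (fd h k f' t) \<le> C * h ^ k"
    using Suc.IH[OF f'(1)] by blast
  have fd': "(fd h j f has_vector_derivative fd h j f' t) (at t)"
    if "0 \<le> t" "0 < h" "t + real j * h \<le> 1/2" for t h j
    using that
  proof (induction j arbitrary: t)
    case 0
    have "fd h 0 f = f" "fd h 0 f' t = f' t" by auto
    then show ?case using f'(2)[of t] 0 by simp
  next
    case (Suc j)
    have "(fd h j f has_vector_derivative fd h j f' (t + h)) (at (t + h))"
      using Suc.prems by (intro Suc.IH) (auto simp: algebra_simps)
    moreover have "((\<lambda>t. t + h) has_vector_derivative 1) (at t)"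
      by (auto intro!: derivative_eq_intros)
    ultimately have "((fd h j f \<circ> (\<lambda>t. t + h)) has_vector_derivative 1 *\<^sub>R fd h j f' (t + h)) (at t)"
      by (rule vector_diff_chain_at[rotated])
    then have "((\<lambda>t. fd h j f (t + h)) has_vector_derivative fd h j f' (t + h)) (at t)"
      by (simp add: o_def)
    moreover have "(fd h j f has_vector_derivative fd h j f' t) (at t)"
      using Suc.prems by (intro Suc.IH) (auto simp: algebra_simps)
    ultimately have "((\<lambda>t. fd h j f (t + h) - fd h j f t) has_vector_derivative fd h (Suc j) f' t) (at t)"
      by (simp add: has_vector_derivative_diff)
    moreover have "fd h (Suc j) f = (\<lambda>t. fd h j f (t + h) - fd h j f t)" by auto
    ultimately show ?case by simp
  qed
  show ?case
  proof (intro exI[of _ C] conjI allI impI C)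
    fix t h :: real assume th: "0 \<le> t" "0 < h" "t + real (Suc k) * h \<le> 1/2"
    have "norm (fd h k f (t + h) - fd h k f t) \<le> (C * h ^ k) * norm ((t + h) - t)"
    proof (rule differentiable_bound[of "{t..t+h}" _ "\<lambda>\<tau> u. u *\<^sub>R fd h k f' \<tau>"])
      fix \<tau> assume \<tau>: "\<tau> \<in> {t..t + h}"
      have b: "\<tau> + real k * h \<le> 1/2" using th \<tau> by (auto simp: algebra_simps)
      show "(fd h k f has_derivative (\<lambda>u. u *\<^sub>R fd h k f' \<tau>)) (at \<tau> within {t..t + h})"
        using fd'[of \<tau> h k] b th \<tau> by (auto simp: has_vector_derivative_def intro: has_derivative_at_withinI)
      have "norm (fd h k f' \<tau>) \<le> C * h ^ k" using C(2)[of \<tau> h] b th \<tau> by auto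
      then show "onorm (\<lambda>u. u *\<^sub>R fd h k f' \<tau>) \<le> C * h ^ k"
        by (intro onorm_le) (simp add: mult.commute mult_left_mono)
    qed (use th in auto)
    then show "norm (fd h (Suc k) f t) \<le> C * h ^ Suc k" using th by (simp add: mult_ac)
  qed
qed

text \<open>The signs of a gliding hump: each one is chosen so that the new term does not cancel the previous ones.\<close>

fun hump :: "(nat \<Rightarrow> nat \<Rightarrow> complex) \<Rightarrow> nat \<Rightarrow> real" where
  "hump a i = (if (1/3) ^ i * norm (a i i) \<le>
      norm ((\<Sum>l<i. of_real (hump a l) * a i l) + of_real ((1/3) ^ i) * a i i)
    then (1/3) ^ i else - ((1/3) ^ i))"

declare hump.simps [simp del]

lemma abs_hump: "\<bar>hump a i\<bar> = (1/3) ^ i"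
  by (subst hump.simps) (auto simp: power_abs)

text \<open>With P the earlier terms and Q the new one, 2 Q = (P + Q) - (P - Q), so at least one of
  P + Q and P - Q has norm at least that of Q; \<open>hump\<close> picks the sign
  accordingly.\<close>

lemma hump_lower: "(1/3) ^ i * norm (a i i) \<le> norm (\<Sum>l\<le>i. of_real (hump a l) * a i l)"
proof -
  let ?P = "\<Sum>l<i. of_real (hump a l) * a i l" and ?Q = "complex_of_real ((1/3) ^ i) * a i i"
  have sum: "(\<Sum>l\<le>i. of_real (hump a l) * a i l) = ?P + of_real (hump a i) * a i i"
    by (simp flip: lessThan_Suc_atMost)
  show ?thesis
  proof (cases "(1/3) ^ i * norm (a i i) \<le> norm (?P + ?Q)")
    case True
    then have "hump a i = (1/3) ^ i" by (simp add: hump.simps[of a i])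
    with True sum show ?thesis by simp
  next
    case False
    then have h: "hump a i = - ((1/3) ^ i)" by (simp add: hump.simps[of a i])
    have "norm (2 * ?Q) = norm ((?P + ?Q) - (?P - ?Q))" by (simp add: algebra_simps)
    also have "\<dots> \<le> norm (?P + ?Q) + norm (?P - ?Q)" by (rule norm_triangle_ineq4)
    finally have "2 * ((1/3) ^ i * norm (a i i)) \<le> norm (?P + ?Q) + norm (?P - ?Q)"
      by (simp add: norm_mult norm_power norm_divide)
    with False have "(1/3) ^ i * norm (a i i) \<le> norm (?P - ?Q)" by linarith
    with sum h show ?thesis by simp
  qed
qed

text \<open>The uniform boundedness principle for the functionals on l1 given by the rows of
  \<open>T\<close>: rows that are bounded, but without a common bound, are unbounded on a single
  summable sequence.\<close>

lemma uniform_boundedness_l1: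
  fixes T :: "'a \<Rightarrow> 'b \<Rightarrow> complex"
  assumes bd: "\<And>x. \<exists>S. \<forall>y. norm (T x y) \<le> S" and unb: "\<And>B. \<exists>x y. norm (T x y) > B"
  obtains c :: "nat \<Rightarrow> real" and y :: "nat \<Rightarrow> 'b"
  where "\<And>i. \<bar>c i\<bar> \<le> (1/3) ^ i" "\<And>B. \<exists>x. norm (\<Sum>i. of_real (c i) * T x (y i)) > B"
proof -
  define S where "S x = (SUP y. norm (T x y))" for x
  have bdd: "bdd_above (range (\<lambda>y. norm (T x y)))" for x
    using bd[of x] by (auto intro: bdd_aboveI2)
  have S: "norm (T x y) \<le> S x" for x y unfolding S_def by (rule cSUP_upper[OF _ bdd]) simp
  \<comment> \<open>Choice of the constants: with ratio 1/3 the tail after i is at most half of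
    3^(-i) S(x_i), so reaching 3/4 of the supremum leaves a surplus of a quarter. As S(x_i) > 4^i,
    this surplus is at least (4/3)^i / 4, which is unbounded.\<close>
  have "\<exists>x y. S x > 4 ^ i \<and> norm (T x y) > 3 / 4 * S x" for i :: nat
  proof -
    obtain x y where "norm (T x y) > 4 ^ i" using unb by blast
    then have x: "S x > 4 ^ i" using S[of x y] by linarith
    then have "S x > 0" by (meson less_trans zero_less_numeral zero_less_power)
    then have "3 / 4 * S x < S x" by simp
    then have "3 / 4 * S x < (SUP y. norm (T x y))" by (simp only: S_def)
    then obtain y where "norm (T x y) > 3 / 4 * S x"
      using less_cSUP_iff[OF UNIV_not_empty bdd] by blast
    with x show ?thesis by blast
  qed
  then obtain x y where x: "\<And>i::nat. S (x i) > 4 ^ i" and y: "\<And>i. norm (T (x i) (y i)) > 3 / 4 * S (x i)"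
    by metis
  define a where "a i l = T (x i) (y l)" for i l
  define c where "c = hump a"
  show thesis
  proof
    show "\<bar>c i\<bar> \<le> (1/3) ^ i" for i by (simp add: c_def abs_hump)
    have low: "norm (\<Sum>l. of_real (c l) * T (x i) (y l)) \<ge> (4/3) ^ i / 4" for i
    proof -
      let ?f = "\<lambda>l. of_real (c l) * T (x i) (y l)"
      have f: "norm (?f l) \<le> (1/3) ^ l * S (x i)" for l
        using S[of "x i" "y l"] by (simp add: norm_mult c_def abs_hump mult_left_mono)
      have sg: "summable (\<lambda>l. (1/3) ^ l * S (x i))" by (intro summable_mult2 summable_geometric) simp
      have sf: "summable ?f" by (rule summable_comparison_test'[OF sg f])
      have "suminf ?f = (\<Sum>l. ?f (l + Suc i)) + (\<Sum>l<Suc i. ?f l)"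
        by (rule suminf_split_initial_segment[OF sf])
      moreover have "norm (\<Sum>l. ?f (l + Suc i)) \<le> (1/3) ^ i * S (x i) / 2"
      proof -
        have s1: "summable (\<lambda>l. (1/3) ^ (l + Suc i) * S (x i))" using sg by (subst summable_iff_shift)
        have "norm (\<Sum>l. ?f (l + Suc i)) \<le> (\<Sum>l. (1/3) ^ (l + Suc i) * S (x i))"
          by (rule norm_suminf_le[OF f s1])
        also have "\<dots> = (\<Sum>l. (1/3) ^ l * ((1/3) ^ Suc i * S (x i)))"
          by (simp add: power_add mult_ac)
        also have "\<dots> = (\<Sum>l. (1/3) ^ l) * ((1/3) ^ Suc i * S (x i))"
          by (rule suminf_mult2[symmetric]) (simp add: summable_geometric)
        also have "\<dots> = (1/3) ^ i * S (x i) / 2"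
          by (simp add: suminf_geometric)
        finally show ?thesis .
      qed
      moreover have "norm (\<Sum>l<Suc i. ?f l) \<ge> (1/3) ^ i * (3 / 4 * S (x i))"
      proof -
        have "(1/3) ^ i * (3 / 4 * S (x i)) \<le> (1/3) ^ i * norm (a i i)"
          using y[of i] by (intro mult_left_mono) (auto simp: a_def)
        also have "\<dots> \<le> norm (\<Sum>l\<le>i. of_real (hump a l) * a i l)" by (rule hump_lower)
        finally show ?thesis by (simp add: a_def c_def lessThan_Suc_atMost)
      qed
      moreover have "norm (\<Sum>l<Suc i. ?f l) - norm (\<Sum>l. ?f (l + Suc i)) \<le>
          norm ((\<Sum>l. ?f (l + Suc i)) + (\<Sum>l<Suc i. ?f l))"
        using norm_diff_ineq[of "\<Sum>l<Suc i. ?f l" "\<Sum>l. ?f (l + Suc i)"] by (simp only: add.commute)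
      ultimately have "norm (suminf ?f) \<ge> (1/3) ^ i * (3 / 4 * S (x i)) - (1/3) ^ i * S (x i) / 2"
        by (smt (verit))
      moreover have "(1/3) ^ i * 4 ^ i \<le> (1/3) ^ i * S (x i)" using x[of i] by (intro mult_left_mono) auto
      moreover have "(1/3) ^ i * 4 ^ i = (4/3 :: real) ^ i" by (simp flip: power_mult_distrib)
      ultimately show ?thesis by linarith
    qed
    show "\<exists>x. norm (\<Sum>i. of_real (c i) * T x (y i)) > B" for B
    proof -
      obtain i where "4 * B < (4/3) ^ i" using real_arch_pow[of "4/3" "4 * B"] by auto
      then show ?thesis using low[of i] by (intro exI[of _ "x i"]) linarith
    qed
  qed
qed

section \<open>Smooth functions along anisotropic curves\<close>

text \<open>Continuity of the partials makes them nearly constant around x; a nearby point is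
  reached by changing one coordinate at a time, and each change is a one-dimensional mean value
  estimate.\<close>

lemma has_derivative_of_partials:
  fixes F :: "real^'d::finite \<Rightarrow> complex"
  assumes "open D" "x \<in> D" and cont: "\<And>i. continuous_on D (G i)"
    and der: "\<And>i y. y \<in> D \<Longrightarrow> ((\<lambda>t. F (y + t *\<^sub>R axis i 1)) has_vector_derivative G i y) (at 0)"
  shows "(F has_derivative (\<lambda>h. \<Sum>i\<in>UNIV. h$i *\<^sub>R G i x)) (at x)"
  unfolding has_derivative_at_alt
proof (intro conjI allI impI)
  show "bounded_linear (\<lambda>h. \<Sum>i\<in>UNIV. h$i *\<^sub>R G i x)"
    by (intro bounded_linear_sum bounded_linear_scaleR_const[OF bounded_linear_vec_nth])
  fix e :: real assume "e > 0"
  define e' where "e' = e / real CARD('d)"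
  have "e' > 0" using \<open>e > 0\<close> by (simp add: e'_def)
  have "\<exists>d>0. \<forall>z. dist z x < d \<longrightarrow> norm (G i z - G i x) < e'" for i
    using cont[of i] \<open>open D\<close> \<open>x \<in> D\<close> \<open>e' > 0\<close>
    by (simp add: continuous_on_eq_continuous_at continuous_at_eps_delta dist_norm)
  then obtain d where d: "\<And>i. d i > 0" "\<And>i z. dist z x < d i \<Longrightarrow> norm (G i z - G i x) < e'" by metis
  obtain d0 where d0: "d0 > 0" "ball x d0 \<subseteq> D" using \<open>open D\<close> \<open>x \<in> D\<close> open_contains_ball by blast
  define \<delta> where "\<delta> = min d0 (Min (range d))"
  have "\<delta> > 0" using d0 d(1) by (auto simp: \<delta>_def)
  have \<delta>: "z \<in> D" "norm (G i z - G i x) \<le> e'" if "norm (z - x) < \<delta>" for z i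
  proof -
    have "Min (range d) \<le> d i" by (rule Min_le) auto
    then have "\<delta> \<le> d i" unfolding \<delta>_def by (rule min.coboundedI2)
    then show "norm (G i z - G i x) \<le> e'" using d(2)[of z i] that by (simp add: dist_norm)
    show "z \<in> D" using that d0 by (auto simp: \<delta>_def dist_norm norm_minus_commute)
  qed
  show "\<exists>d>0. \<forall>y. norm (y - x) < d \<longrightarrow>
      norm (F y - F x - (\<Sum>i\<in>UNIV. (y - x)$i *\<^sub>R G i x)) \<le> e * norm (y - x)"
  proof (intro exI[of _ \<delta>] conjI allI impI \<open>\<delta> > 0\<close>)
    fix y assume y: "norm (y - x) < \<delta>"
    define h where "h = y - x"
    \<comment> \<open>\<open>H I\<close> carries out the coordinate changes in \<open>I\<close>
      only; the induction below adds one coordinate at a time.\<close>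
    define H where "H I = (\<chi> i. if i \<in> I then h$i else 0)" for I
    have main: "norm (F (x + H I) - F x - (\<Sum>i\<in>I. h$i *\<^sub>R G i x)) \<le> (\<Sum>i\<in>I. e' * \<bar>h$i\<bar>)"
      if "finite I" for I
      using that
    proof (induction I rule: finite_induct)
      case empty
      have "H {} = 0" by (simp add: H_def vec_eq_iff)
      then show ?case by simp
    next
      case (insert j I)
      let ?p = "\<lambda>\<tau>. x + H I + \<tau> *\<^sub>R axis j 1"
      have Hj: "x + H (insert j I) = ?p (h$j)"
        using insert by (auto simp: H_def vec_eq_iff axis_def)
      have near: "norm (?p \<tau> - x) < \<delta>" if "\<tau> \<in> closed_segment 0 (h$j)" for \<tau>
      proof -
        have "\<bar>\<tau>\<bar> \<le> \<bar>h$j\<bar>" using that by (auto simp: closed_segment_eq_real_ivl split: if_splits)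
        then have "norm (H I + \<tau> *\<^sub>R axis j 1) \<le> norm h"
          using insert by (intro norm_le_componentwise_cart) (auto simp: H_def axis_def)
        then show ?thesis using y by (simp add: h_def add.assoc)
      qed
      \<comment> \<open>Subtracting the linear part before the mean value inequality leaves the
        derivative \<open>G j (?p \<tau>) - G j x\<close>, which has norm at most \<open>e'\<close>
        near x.\<close>
      have "norm ((F (?p (h$j)) - (h$j) *\<^sub>R G j x) - (F (?p 0) - 0 *\<^sub>R G j x)) \<le> e' * norm (h$j - 0)"
      proof (rule differentiable_bound[of "closed_segment 0 (h$j)" _ "\<lambda>\<tau> u. u *\<^sub>R (G j (?p \<tau>) - G j x)"])
        fix \<tau> assume \<tau>: "\<tau> \<in> closed_segment 0 (h$j)"
        have "((\<lambda>t. F (?p \<tau> + t *\<^sub>R axis j 1)) has_vector_derivative G j (?p \<tau>)) (at (\<tau> - \<tau>))"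
          using der[OF \<delta>(1)[OF near[OF \<tau>]]] by simp
        moreover have "((\<lambda>t. t - \<tau>) has_vector_derivative 1) (at \<tau>)" by (auto intro!: derivative_eq_intros)
        ultimately have "(((\<lambda>t. F (?p \<tau> + t *\<^sub>R axis j 1)) \<circ> (\<lambda>t. t - \<tau>)) has_vector_derivative 1 *\<^sub>R G j (?p \<tau>)) (at \<tau>)"
          by (rule vector_diff_chain_at[rotated])
        moreover have "((\<lambda>t. F (?p \<tau> + t *\<^sub>R axis j 1)) \<circ> (\<lambda>t. t - \<tau>)) = (\<lambda>t. F (?p t))"
          by (auto simp: fun_eq_iff algebra_simps)
        ultimately have "((\<lambda>t. F (?p t)) has_vector_derivative G j (?p \<tau>)) (at \<tau>)" by simp
        then have "((\<lambda>t. F (?p t) - t *\<^sub>R G j x) has_vector_derivative G j (?p \<tau>) - G j x) (at \<tau>)"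
          by (auto intro!: derivative_eq_intros)
        then show "((\<lambda>t. F (?p t) - t *\<^sub>R G j x) has_derivative (\<lambda>u. u *\<^sub>R (G j (?p \<tau>) - G j x)))
            (at \<tau> within closed_segment 0 (h$j))"
          unfolding has_vector_derivative_def by (rule has_derivative_at_withinI)
        show "onorm (\<lambda>u. u *\<^sub>R (G j (?p \<tau>) - G j x)) \<le> e'"
        proof (rule onorm_le)
          show "norm (u *\<^sub>R (G j (?p \<tau>) - G j x)) \<le> e' * norm u" for u :: real
            using mult_left_mono[OF \<delta>(2)[OF near[OF \<tau>], of j], of "\<bar>u\<bar>"] by (simp add: mult.commute)
        qed
      qed auto
      then have "norm (F (x + H (insert j I)) - F (x + H I) - (h$j) *\<^sub>R G j x) \<le> e' * \<bar>h$j\<bar>"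
        unfolding Hj by (simp add: algebra_simps)
      moreover have "F (x + H (insert j I)) - F x - (\<Sum>i\<in>insert j I. h$i *\<^sub>R G i x) =
          (F (x + H (insert j I)) - F (x + H I) - (h$j) *\<^sub>R G j x) +
          (F (x + H I) - F x - (\<Sum>i\<in>I. h$i *\<^sub>R G i x))"
        using insert by simp
      moreover have "(\<Sum>i\<in>insert j I. e' * \<bar>h$i\<bar>) = e' * \<bar>h$j\<bar> + (\<Sum>i\<in>I. e' * \<bar>h$i\<bar>)"
        using insert by simp
      ultimately show ?case
        using insert.IH by (simp only:) (rule norm_triangle_mono)
    qed
    have "H UNIV = h" by (simp add: H_def vec_eq_iff)
    with main[of UNIV]
    have "norm (F y - F x - (\<Sum>i\<in>UNIV. h$i *\<^sub>R G i x)) \<le> (\<Sum>i\<in>UNIV. e' * \<bar>h$i\<bar>)"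
      by (simp add: h_def)
    also have "\<dots> \<le> (\<Sum>i\<in>(UNIV::'d set). e' * norm h)"
      using \<open>e' > 0\<close> by (intro sum_mono mult_left_mono component_le_norm_cart) auto
    also have "\<dots> = e * norm h" by (simp add: e'_def)
    finally show "norm (F y - F x - (\<Sum>i\<in>UNIV. (y - x)$i *\<^sub>R G i x)) \<le> e * norm (y - x)"
      by (simp add: h_def)
  qed
qed

text \<open>Differentiating \<open>comp\<close> gives partials of \<open>g\<close> times s_i t^(s_i
  - 1) w_i; constants, the identity, sums and products are there to absorb these factors.\<close>

inductive_set curve_class :: "(real^'d::finite \<Rightarrow> complex) \<Rightarrow> ('d \<Rightarrow> nat) \<Rightarrow> real^'d \<Rightarrow> (real \<Rightarrow> complex) set"
  for g s w where
  comp: "(\<lambda>t. iter_partial is g (dil s t w)) \<in> curve_class g s w"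
| const: "(\<lambda>t. c) \<in> curve_class g s w"
| ident: "(\<lambda>t. complex_of_real t) \<in> curve_class g s w"
| add: "f \<in> curve_class g s w \<Longrightarrow> f' \<in> curve_class g s w \<Longrightarrow> (\<lambda>t. f t + f' t) \<in> curve_class g s w"
| mult: "f \<in> curve_class g s w \<Longrightarrow> f' \<in> curve_class g s w \<Longrightarrow> (\<lambda>t. f t * f' t) \<in> curve_class g s w"

lemma curve_class_sum:
  "finite I \<Longrightarrow> (\<And>i. i \<in> I \<Longrightarrow> f i \<in> curve_class g s w) \<Longrightarrow> (\<lambda>t. \<Sum>i\<in>I. f i t) \<in> curve_class g s w"
  by (induction I rule: finite_induct) (auto intro: curve_class.intros)

lemma curve_class_power:
  "f \<in> curve_class g s w \<Longrightarrow> (\<lambda>t. f t ^ n) \<in> curve_class g s w"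
  by (induction n) (auto intro: curve_class.intros)

lemma dil_has_vector_derivative:
  "((\<lambda>t. dil s t w) has_vector_derivative (\<chi> i. (real (s i) * t ^ (s i - 1)) * w$i)) (at t)"
proof -
  have eq: "(\<chi> i. f i) = (\<Sum>i\<in>UNIV. f i *\<^sub>R axis i (1::real))" for f :: "'a \<Rightarrow> real"
    by (simp add: vec_eq_iff axis_def if_distrib cong: if_cong)
  have "((\<lambda>t. t ^ s i * w$i) has_vector_derivative (real (s i) * t ^ (s i - 1)) * w$i) (at t)" for i
    unfolding has_real_derivative_iff_has_vector_derivative[symmetric]
    by (auto intro!: derivative_eq_intros)
  from bounded_linear.has_vector_derivative[OF bounded_linear_scaleR_left this]
  show ?thesis
    unfolding dil_def eq by (intro has_vector_derivative_sum)
qed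

text \<open>For |t| < 1 the point \<open>dil s t w\<close> lies in the open unit ball, where
  \<open>g\<close> is smooth; there the partials of \<open>g\<close> are totally differentiable, so
  the chain rule applies.\<close>

lemma curve_class_derivative:
  assumes s: "\<forall>i. 1 \<le> s i" and g: "Cinf_on {y. adist s 0 y < 1} g" and w: "adist s 0 w \<le> 1"
  shows "f \<in> curve_class g s w \<Longrightarrow>
    \<exists>f'\<in>curve_class g s w. \<forall>t\<in>{-1<..<1}. (f has_vector_derivative f' t) (at t)"
proof (induction rule: curve_class.induct)
  case (comp "is")
  let ?f' = "\<lambda>t. \<Sum>i\<in>UNIV. (of_real (real (s i)) * complex_of_real t ^ (s i - 1) * of_real (w$i)) *
      iter_partial (i # is) g (dil s t w)"
  have "((\<lambda>t. iter_partial is g (dil s t w)) has_vector_derivative ?f' t) (at t)"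
    if t: "t \<in> {-1<..<1}" for t
  proof -
    have "adist s 0 (dil s t w) \<le> \<bar>t\<bar> * 1"
      unfolding adist_0_dil[OF s] using w by (intro mult_left_mono) auto
    then have D: "dil s t w \<in> {y. adist s 0 y < 1}" using t by auto
    have "(iter_partial is g has_derivative
        (\<lambda>h. \<Sum>i\<in>UNIV. h$i *\<^sub>R iter_partial (i # is) g (dil s t w))) (at (dil s t w))"
      by (rule has_derivative_of_partials[OF open_adist_ball[OF s] D, of "\<lambda>i. iter_partial (i # is) g"])
        (rule Cinf_on_continuous[OF g], rule Cinf_on_has_partial_at_0[OF g])
    from has_derivative_compose[OF dil_has_vector_derivative[of s w t, unfolded has_vector_derivative_def] this]
    show ?thesis
      unfolding has_vector_derivative_def
    proof (rule has_derivative_eq_rhs, intro ext)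
      fix u :: real
      show "(\<Sum>i\<in>UNIV. (u *\<^sub>R (\<chi> i. real (s i) * t ^ (s i - 1) * w$i))$i *\<^sub>R iter_partial (i # is) g (dil s t w)) =
          u *\<^sub>R ?f' t"
        unfolding vector_scaleR_component vec_lambda_beta scaleR_sum_right
        by (rule sum.cong) (simp_all add: scaleR_conv_of_real mult_ac)
    qed
  qed
  moreover have "?f' \<in> curve_class g s w"
    by (intro curve_class_sum curve_class.mult curve_class_power curve_class.const curve_class.ident curve_class.comp) auto
  ultimately show ?case by (intro bexI[of _ ?f'] ballI)
next
  case (const c)
  then show ?case by (intro bexI[of _ "\<lambda>t. 0"]) (auto intro: curve_class.intros)
next
  case ident
  have "(complex_of_real has_vector_derivative 1) (at t)" for t
    using bounded_linear.has_vector_derivative[OF bounded_linear_of_real has_vector_derivative_id] by simp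
  then show ?case by (intro bexI[of _ "\<lambda>t. 1"]) (auto intro: curve_class.intros)
next
  case (add f h)
  then obtain f' h' where "f' \<in> curve_class g s w" "h' \<in> curve_class g s w"
    "\<And>t. t \<in> {-1<..<1} \<Longrightarrow> (f has_vector_derivative f' t) (at t)"
    "\<And>t. t \<in> {-1<..<1} \<Longrightarrow> (h has_vector_derivative h' t) (at t)" by metis
  then show ?case
    by (intro bexI[of _ "\<lambda>t. f' t + h' t"]) (auto intro: curve_class.intros has_vector_derivative_add)
next
  case (mult f h)
  then obtain f' h' where *: "f' \<in> curve_class g s w" "h' \<in> curve_class g s w"
    "\<And>t. t \<in> {-1<..<1} \<Longrightarrow> (f has_vector_derivative f' t) (at t)"
    "\<And>t. t \<in> {-1<..<1} \<Longrightarrow> (h has_vector_derivative h' t) (at t)" by metis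
  have "(\<lambda>t. f t * h' t + f' t * h t) \<in> curve_class g s w"
    by (intro curve_class.intros * mult.hyps)
  then show ?case
    using *(3,4) by (intro bexI[of _ "\<lambda>t. f t * h' t + f' t * h t"] ballI has_vector_derivative_mult)
qed

section \<open>A Liouville theorem\<close>

lemma iter_partial_0 [simp]: "iter_partial is (\<lambda>_. 0) = (\<lambda>_. 0)"
  by (induction "is") (auto simp: partial_dir_def)

lemma Cinf_on_0: "Cinf_on D (\<lambda>_. 0)"
  by (simp add: Cinf_on_def)

text \<open>Ellipticity yields a smooth representative in the sense of distributions; as
  \<open>u\<close> is continuous, the fundamental lemma makes the two agree at every point of the
  ball, which finite differences require.\<close>

lemma elliptic_imp_smooth_on_ball:
  fixes u :: "real^'d::finite \<Rightarrow> complex"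
  assumes s: "\<forall>i. 1 \<le> s i" and ell: "elliptic s m a" and u: "continuous_on UNIV u"
    and zero: "\<And>\<phi>. test_fun {y. adist s 0 y < 1} \<phi> \<Longrightarrow> Lop s m a (fdist u) \<phi> = 0"
  obtains g where "Cinf_on {y. adist s 0 y < 1} g" "\<And>y. adist s 0 y < 1 \<Longrightarrow> u y = g y"
proof -
  define D where "D = {y. adist s 0 y < 1}"
  have "open D" unfolding D_def by (rule open_adist_ball[OF s])
  moreover have "\<exists>f. Cinf_on D f \<and> (\<forall>\<phi>. test_fun D \<phi> \<longrightarrow> Lop s m a (fdist u) \<phi> = fdist f \<phi>)"
    using zero by (intro exI[of _ "\<lambda>_. 0"]) (auto simp: D_def Cinf_on_0 fdist_def)
  ultimately obtain g where g: "Cinf_on D g" "\<And>\<phi>. test_fun D \<phi> \<Longrightarrow> fdist u \<phi> = fdist g \<phi>"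
    using ell distribution_fdist[OF u, of D] unfolding elliptic_def by blast
  have cont: "continuous_on D u" "continuous_on D g"
    using Cinf_on_continuous[OF g(1), of "[]"] u by (auto intro: continuous_on_subset)
  have "u y - g y = 0" if "y \<in> D" for y
  proof (rule fundamental_lemma_calculus_of_variations[OF \<open>open D\<close> _ _ that])
    show "continuous_on D (\<lambda>y. u y - g y)" by (intro continuous_intros cont)
    show "fdist (\<lambda>y. u y - g y) \<phi> = 0" if "test_fun D \<phi>" for \<phi>
      using g(2)[OF that] integrable_test_fun[OF cont(1) that, of "[]"] integrable_test_fun[OF cont(2) that, of "[]"]
      by (simp add: fdist_def left_diff_distrib)
  qed
  then show thesis using g(1) that by (auto simp: D_def)
qed

text \<open>If some q-th difference of g were nonzero, the rescalings \<open>v j\<close>, all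
  solutions with the same growth bound, would have scaled q-th differences \<open>T n j\<close>
  bounded in j for each n but unbounded on the diagonal. A summable combination u of them is then a
  solution whose scaled differences are unbounded in n, whereas smoothness of u bounds them by C
  h^q.\<close>

lemma liouville_growth:
  fixes V :: "real^'d::finite \<Rightarrow> complex"
  assumes s: "\<forall>i. 1 \<le> s i" and ell: "elliptic s m a" and V: "continuous_on UNIV V"
    and bd: "\<And>z. norm (V z) \<le> adist s 0 z powr \<eta>" and "\<eta> > 0" "\<eta> \<notin> \<nat>"
    and zero: "\<And>r \<phi>. r > 0 \<Longrightarrow> \<phi> \<in> testB s k \<Longrightarrow> Lop s m a (fdist (\<lambda>z. V (dil s r z))) \<phi> = 0"
    and w: "adist s 0 w = 1"
  shows "V w = 0"
proof -
  \<comment> \<open>As eta is not an integer, K < eta < q: the right inequality makes the diagonal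
    factor r^(q - eta) unbounded, the left one is needed by
    \<open>eq_0_of_vanishing_differences\<close>.\<close>
  define K where "K = nat \<lfloor>\<eta>\<rfloor>"
  define q where "q = Suc K"
  have "real K \<noteq> \<eta>" using \<open>\<eta> \<notin> \<nat>\<close> by (metis of_nat_in_Nats)
  then have K: "real K < \<eta>" "\<eta> < real q"
    unfolding K_def q_def using \<open>\<eta> > 0\<close> by linarith+
  define g where "g t = V (dil s t w)" for t
  have g: "norm (g t) \<le> t powr \<eta>" if "0 \<le> t" for t
    using bd[of "dil s t w"] that by (simp add: g_def adist_0_dil[OF s] w)
  have diff: "fd h q g t = 0" if "0 \<le> t" "0 < h" for t h
  proof (rule ccontr)
    assume "fd h q g t \<noteq> 0"
    then have A: "norm (fd h q g t) > 0" by simp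
    \<comment> \<open>The offset keeps all rescaled sample points (t + j h) / r(n) with j at most q
      in [0, 1/2]; adding n sends r to infinity.\<close>
    define r where "r n = 2 * (t + real q * h) + real n" for n
    have r: "r n > 0" "r n \<ge> 2 * (t + real q * h)" for n
      using that by (auto simp: r_def q_def add_nonneg_pos add_pos_nonneg)
    define v where "v j z = complex_of_real (r j powr (- \<eta>)) * V (dil s (r j) z)" for j z
    have v_le: "norm (v j z) \<le> adist s 0 z powr \<eta>" for j z
    proof -
      have "norm (v j z) \<le> r j powr (- \<eta>) * (r j * adist s 0 z) powr \<eta>"
        using bd[of "dil s (r j) z"] r(1)[of j]
        by (simp add: v_def norm_mult adist_0_dil[OF s] mult_left_mono)
      also have "\<dots> = (r j powr (- \<eta>) * r j powr \<eta>) * adist s 0 z powr \<eta>"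
        using r(1)[of j] by (simp add: powr_mult adist_nonneg)
      also have "r j powr (- \<eta>) * r j powr \<eta> = 1"
        using r(1)[of j] by (simp flip: powr_add)
      finally show ?thesis by simp
    qed
    have v_cont: "continuous_on UNIV (v j)" for j
      unfolding v_def
      by (intro continuous_intros continuous_on_compose2[OF V] continuous_on_dil) auto
    have pts: "0 \<le> t / r n + real j * (h / r n)" "t / r n + real j * (h / r n) \<le> 1/2" if "j \<le> q" for n j
    proof -
      have "t / r n + real j * (h / r n) = (t + real j * h) / r n" by (simp add: add_divide_distrib)
      moreover have "real j * h \<le> real q * h" using that \<open>0 < h\<close> by (intro mult_right_mono) auto
      ultimately show "t / r n + real j * (h / r n) \<le> 1/2" using r[of n] by (simp add: field_simps)
      show "0 \<le> t / r n + real j * (h / r n)" using that \<open>0 \<le> t\<close> \<open>0 < h\<close> r(1)[of n] by simp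
    qed
    \<comment> \<open>The factor r(n)^q turns a q-th difference at step h/r(n) into a difference
      quotient up to the constant h^q; for a fixed smooth function it stays bounded in n.\<close>
    define T where "T n j = complex_of_real (r n ^ q) * fd (h / r n) q (\<lambda>\<tau>. v j (dil s \<tau> w)) (t / r n)" for n j
    have T_le: "norm (T n j) \<le> r n ^ q * (2 ^ q * 1)" for n j
    proof -
      have "norm (fd (h / r n) q (\<lambda>\<tau>. v j (dil s \<tau> w)) (t / r n)) \<le> 2 ^ q * 1"
      proof (rule fd_norm_le)
        fix l assume "l \<le> q"
        have "norm (v j (dil s (t / r n + real l * (h / r n)) w)) \<le> (t / r n + real l * (h / r n)) powr \<eta>"
          using v_le[of j "dil s (t / r n + real l * (h / r n)) w"] pts[OF \<open>l \<le> q\<close>, of n]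
          by (simp only: adist_0_dil[OF s] w) simp
        also have "\<dots> \<le> 1" using pts[OF \<open>l \<le> q\<close>, of n] \<open>\<eta> > 0\<close> by (intro powr_le1) linarith+
        finally show "norm (v j (dil s (t / r n + real l * (h / r n)) w)) \<le> 1" .
      qed
      then show ?thesis using r(1)[of n] by (simp add: T_def norm_mult norm_power)
    qed
    \<comment> \<open>On the diagonal the two rescalings cancel, and the original difference of g
      reappears with the factor r(n)^(q - eta).\<close>
    have T_diag: "norm (T n n) = r n powr (real q - \<eta>) * norm (fd h q g t)" for n
    proof -
      have "(\<lambda>\<tau>. v n (dil s \<tau> w)) = (\<lambda>\<tau>. complex_of_real (r n powr (- \<eta>)) * g (r n * \<tau>))"
        by (simp add: v_def g_def dil_dil)
      then have "T n n = complex_of_real (r n ^ q) * (complex_of_real (r n powr (- \<eta>)) * fd h q g t)"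
        using r(1)[of n] by (simp add: T_def fd_scale)
      moreover have "r n ^ q * r n powr (- \<eta>) = r n powr (real q - \<eta>)"
        using r(1)[of n] by (simp add: powr_realpow[symmetric] flip: powr_add)
      ultimately show ?thesis using r(1)[of n] by (simp add: norm_mult norm_power)
    qed
    have "filterlim r at_top sequentially"
      unfolding r_def by (intro filterlim_tendsto_add_at_top[OF tendsto_const] filterlim_real_sequentially)
    then have "filterlim (\<lambda>n. exp ((real q - \<eta>) * ln (r n))) at_top sequentially"
      using K(2)
      by (intro filterlim_compose[OF exp_at_top] filterlim_tendsto_pos_mult_at_top[OF tendsto_const]
          filterlim_compose[OF ln_at_top]) auto
    then have "filterlim (\<lambda>n. r n powr (real q - \<eta>)) at_top sequentially"
      using r(1) by (simp add: powr_def less_imp_neq[symmetric])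
    then have "filterlim (\<lambda>n. r n powr (real q - \<eta>) * norm (fd h q g t)) at_top sequentially"
      using A by (intro filterlim_at_top_mult_tendsto_pos[OF tendsto_const])
    then have unb: "\<exists>n j. norm (T n j) > B" for B
      unfolding filterlim_at_top_dense T_diag[symmetric] by (meson eventually_happens' sequentially_bot)
    obtain c y where c: "\<And>i. \<bar>c i\<bar> \<le> (1/3) ^ i"
      and big: "\<And>B. \<exists>n. norm (\<Sum>i. complex_of_real (c i) * T n (y i)) > B"
      using uniform_boundedness_l1[of T, OF _ unb] T_le by metis
    define u where "u z = (\<Sum>i. complex_of_real (c i) * v (y i) z)" for z
    have term_le: "norm (complex_of_real (c i) * v (y i) z) \<le> (1/3) ^ i * adist s 0 z powr \<eta>" for i z
      using c[of i] v_le[of "y i" z] by (simp add: norm_mult mult_mono)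
    have geo: "summable (\<lambda>i. (1/3::real) ^ i * M)" for M
      by (intro summable_mult2 summable_geometric) simp
    have sums_u: "(\<lambda>i. complex_of_real (c i) * v (y i) z) sums u z" for z
      unfolding u_def by (rule summable_sums[OF summable_comparison_test'[OF geo term_le]])
    define S where "S n z = (\<Sum>i<n. complex_of_real (c i) * v (y i) z)" for n z
    have S_cont: "continuous_on UNIV (S n)" for n
      unfolding S_def by (intro continuous_intros v_cont)
    \<comment> \<open>The growth bound is uniform only on balls, so the M-test runs on each ball and
      continuity is glued over their increasing union.\<close>
    have u_cont: "continuous_on UNIV u"
    proof -
      have "continuous_on {z. adist s 0 z < real N} u" for N :: nat
      proof -
        have "uniform_limit {z. adist s 0 z < real N} S u sequentially"
          unfolding S_def u_def
        proof (rule Weierstrass_m_test[OF _ geo])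
          show "norm (complex_of_real (c i) * v (y i) z) \<le> (1/3) ^ i * real N powr \<eta>"
            if "z \<in> {z. adist s 0 z < real N}" for i z
          proof -
            have "adist s 0 z powr \<eta> \<le> real N powr \<eta>"
              using that \<open>\<eta> > 0\<close> by (intro powr_mono2) (auto simp: adist_nonneg)
            then show ?thesis by (intro order.trans[OF term_le] mult_left_mono) auto
          qed
        qed
        then show ?thesis
          by (rule uniform_limit_theorem[rotated]) (auto intro: always_eventually continuous_on_subset[OF S_cont])
      qed
      then have "continuous_on (\<Union>N. {z. adist s 0 z < real N}) u"
        by (intro continuous_on_open_UN open_adist_ball[OF s]) 
      moreover have "(\<Union>N. {z. adist s 0 z < real N}) = UNIV"
        using reals_Archimedean2 by auto
      ultimately show ?thesis by simp
    qed
    have v_zero: "Lop s m a (fdist (v j)) \<phi> = 0" if "test_fun {y. adist s 0 y < 1} \<phi>" for j \<phi>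
    proof -
      have "Lop s m a (fdist (\<lambda>z. V (dil s (r j) z))) \<phi> = 0"
        using zero[OF r(1)[of j]] by (rule Lop_eq_0_on_ball[OF s _ that])
      then show ?thesis unfolding v_def Lop_cmult_fun by simp
    qed
    have S_zero: "Lop s m a (fdist (S n)) \<phi> = 0" if \<phi>: "test_fun {y. adist s 0 y < 1} \<phi>" for n \<phi>
    proof (induction n)
      case 0
      then show ?case by (simp add: S_def Lop_def fdist_def)
    next
      case (Suc n)
      have "S (Suc n) = (\<lambda>z. S n z + complex_of_real (c n) * v (y n) z)" by (simp add: S_def fun_eq_iff)
      then show ?case
        using Suc by (simp add: Lop_add_fun[OF \<phi> S_cont] continuous_on_mult continuous_on_const v_cont Lop_cmult_fun v_zero[OF \<phi>])
    qed
    have u_zero: "Lop s m a (fdist u) \<phi> = 0" if \<phi>: "test_fun {y. adist s 0 y < 1} \<phi>" for \<phi>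
    proof -
      have "(\<lambda>n. Lop s m a (fdist (S n)) \<phi>) \<longlonglongrightarrow> Lop s m a (fdist u) \<phi>"
      proof (rule Lop_tendsto[OF \<phi> S_cont u_cont])
        show "(\<lambda>n. S n z) \<longlonglongrightarrow> u z" for z
          using sums_u[of z] by (simp add: sums_def S_def)
        show "norm (S n z) \<le> (\<Sum>i. (1/3) ^ i * 1)" if "z \<in> {y. adist s 0 y < 1}" for n z
        proof -
          have "adist s 0 z powr \<eta> \<le> 1"
            using that \<open>\<eta> > 0\<close> by (intro powr_le1) (auto simp: adist_nonneg)
          then have "norm (complex_of_real (c i) * v (y i) z) \<le> (1/3) ^ i * 1" for i
            by (intro order.trans[OF term_le] mult_left_mono) auto
          then have "norm (S n z) \<le> (\<Sum>i<n. (1/3) ^ i * 1)" unfolding S_def by (rule sum_norm_le)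
          also have "\<dots> \<le> (\<Sum>i. (1/3) ^ i * 1)" by (rule sum_le_suminf[OF geo]) auto
          finally show ?thesis .
        qed
      qed
      then show ?thesis by (simp add: S_zero[OF \<phi>] LIMSEQ_const_iff)
    qed
    obtain G where G: "Cinf_on {y. adist s 0 y < 1} G" "\<And>y. adist s 0 y < 1 \<Longrightarrow> u y = G y"
      using elliptic_imp_smooth_on_ball[OF s ell u_cont u_zero] by blast
    have "(\<lambda>\<tau>. G (dil s \<tau> w)) \<in> curve_class G s w"
      using curve_class.comp[of "[]" G s w] by simp
    from fd_bound_smooth[OF curve_class_derivative[OF s G(1)] this, of q]
    obtain C where C: "\<And>\<tau> h'. 0 \<le> \<tau> \<Longrightarrow> 0 < h' \<Longrightarrow> \<tau> + real q * h' \<le> 1/2 \<Longrightarrow>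
        norm (fd h' q (\<lambda>\<tau>. G (dil s \<tau> w)) \<tau>) \<le> C * h' ^ q"
      using w by auto
    have "norm (\<Sum>i. complex_of_real (c i) * T n (y i)) \<le> C * h ^ q" for n
    proof -
      have "(\<lambda>i. complex_of_real (c i) * fd (h / r n) q (\<lambda>\<tau>. v (y i) (dil s \<tau> w)) (t / r n)) sums
          fd (h / r n) q (\<lambda>\<tau>. u (dil s \<tau> w)) (t / r n)"
        by (rule fd_sums) (rule sums_u)
      from sums_mult[OF this, of "complex_of_real (r n ^ q)"]
      have "(\<lambda>i. complex_of_real (c i) * T n (y i)) sums
          (complex_of_real (r n ^ q) * fd (h / r n) q (\<lambda>\<tau>. u (dil s \<tau> w)) (t / r n))"
        by (simp add: T_def mult_ac)
      then have "(\<Sum>i. complex_of_real (c i) * T n (y i)) =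
          complex_of_real (r n ^ q) * fd (h / r n) q (\<lambda>\<tau>. u (dil s \<tau> w)) (t / r n)"
        by (rule sums_unique[symmetric])
      also have "fd (h / r n) q (\<lambda>\<tau>. u (dil s \<tau> w)) (t / r n) = fd (h / r n) q (\<lambda>\<tau>. G (dil s \<tau> w)) (t / r n)"
      proof (rule fd_cong)
        fix j assume "j \<le> q"
        define \<tau> where "\<tau> = t / r n + real j * (h / r n)"
        have "0 \<le> \<tau>" "\<tau> \<le> 1/2" unfolding \<tau>_def by (rule pts[OF \<open>j \<le> q\<close>])+
        then have "adist s 0 (dil s \<tau> w) < 1" by (simp add: adist_0_dil[OF s] w)
        then have "u (dil s \<tau> w) = G (dil s \<tau> w)" by (rule G(2))
        then show "u (dil s (t / r n + real j * (h / r n)) w) = G (dil s (t / r n + real j * (h / r n)) w)"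
          by (simp only: \<tau>_def)
      qed
      finally have "norm (\<Sum>i. complex_of_real (c i) * T n (y i)) =
          r n ^ q * norm (fd (h / r n) q (\<lambda>\<tau>. G (dil s \<tau> w)) (t / r n))"
        using r(1)[of n] by (simp add: norm_mult norm_power)
      also have "\<dots> \<le> r n ^ q * (C * (h / r n) ^ q)"
        using r(1)[of n] \<open>0 \<le> t\<close> \<open>0 < h\<close> pts(2)[of q n] by (intro mult_left_mono C) auto
      also have "\<dots> = C * h ^ q" using r(1)[of n] by (simp add: power_divide)
      finally show ?thesis .
    qed
    with big[of "C * h ^ q"] show False by (meson not_le)
  qed
  have "g 1 = 0"
    by (rule eq_0_of_vanishing_differences[of K g \<eta>]) (use diff g K in \<open>auto simp: q_def\<close>)
  then show ?thesis by (simp add: g_def)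
qed

section \<open>Equicontinuity\<close>

lemma poly_eq_sum_atMost:
  fixes p :: "'a::comm_semiring_1 poly"
  assumes "degree p \<le> k"
  shows "poly p x = (\<Sum>i\<le>k. coeff p i * x ^ i)"
  unfolding poly_altdef
  by (rule sum.mono_neutral_left) (use assms in \<open>auto simp: coeff_eq_0\<close>)

text \<open>Equivalence of norms on the polynomials of degree at most k, by induction on k. The
  interval excludes 0 because the bounds to which this is applied concern points z different from
  y.\<close>

lemma poly_coeff_bound:
  "\<exists>C\<ge>0. \<forall>p A. degree p \<le> k \<longrightarrow> (\<forall>t\<in>{0<..1}. norm (poly p (complex_of_real t)) \<le> A) \<longrightarrow>
    (\<forall>j. norm (coeff p j) \<le> C * A)"
proof (induction k)
  case 0
  have "norm (coeff p j) \<le> 1 * A"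
    if deg: "degree p \<le> 0" and A: "\<forall>t\<in>{0<..1}. norm (poly p (complex_of_real t)) \<le> A" for p A j
  proof -
    obtain c where "p = [:c:]" using deg degree_eq_zeroE[of p] by auto
    moreover have "norm c \<le> A" using A[rule_format, of 1] calculation by simp
    ultimately show ?thesis using order.trans[OF norm_ge_zero, of c A] by (cases j) auto
  qed
  then show ?case by (intro exI[of _ 1]) auto
next
  case (Suc k)
  then obtain C where C: "C \<ge> 0" "\<And>p A j. degree p \<le> k \<Longrightarrow>
    (\<And>t. t \<in> {0<..1} \<Longrightarrow> norm (poly p (complex_of_real t)) \<le> A) \<Longrightarrow> norm (coeff p j) \<le> C * A" by metis
  define C' where "C' = C * (1 + 2 ^ Suc k)"
  have C': "C' \<ge> 0" using C(1) by (simp add: C'_def)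
  have "norm (coeff p j) \<le> (1 + real (Suc (Suc k)) * C') * A"
    if deg: "degree p \<le> Suc k" and A: "\<forall>t\<in>{0<..1}. norm (poly p (complex_of_real t)) \<le> A" for p A j
  proof -
    have A0: "A \<ge> 0" using order.trans[OF norm_ge_zero A[rule_format, of 1]] by simp
    \<comment> \<open>subtracting a dilate cancels the leading coefficient and keeps the others away from 0\<close>
    define q where "q = p - smult (2 ^ Suc k) (pcompose p [:0, 1/2:])"
    have cq: "coeff q j = coeff p j * (1 - 2 ^ Suc k * (1/2) ^ j)" for j
      by (simp add: q_def coeff_pcompose_linear algebra_simps)
    have "degree q \<le> k"
    proof (rule degree_le, intro allI impI)
      fix j assume "k < j"
      then show "coeff q j = 0"
        using deg by (cases "j = Suc k") (auto simp: cq coeff_eq_0 power_one_over)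
    qed
    moreover have "norm (poly q (complex_of_real t)) \<le> (1 + 2 ^ Suc k) * A" if "t \<in> {0<..1}" for t
    proof -
      have e: "poly q (complex_of_real t) = poly p (complex_of_real t) - 2 ^ Suc k * poly p (complex_of_real (t / 2))"
        by (simp add: q_def poly_pcompose)
      have "norm (poly p (complex_of_real t)) \<le> A" "norm (poly p (complex_of_real (t / 2))) \<le> A"
        using that by (intro A[rule_format]; simp)+
      then have "norm (poly p (complex_of_real t)) + 2 ^ Suc k * norm (poly p (complex_of_real (t / 2))) \<le> A + 2 ^ Suc k * A"
        by (intro add_mono mult_left_mono) auto
      moreover have "norm (poly q (complex_of_real t)) \<le>
          norm (poly p (complex_of_real t)) + norm (2 ^ Suc k * poly p (complex_of_real (t / 2)))"
        unfolding e by (rule norm_triangle_ineq4)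
      ultimately show ?thesis by (simp add: norm_mult norm_power algebra_simps)
    qed
    ultimately have q: "norm (coeff q j) \<le> C * ((1 + 2 ^ Suc k) * A)" for j by (rule C(2))
    \<comment> \<open>For j at most k the factor 1 - 2^(k+1-j) has absolute value at least 1, so the
      coefficients of q control those of p.\<close>
    have low: "norm (coeff p j) \<le> C' * A" if "j \<le> k" for j
    proof -
      have "(2::real) ^ Suc k * (1/2) ^ j = 2 ^ (Suc k - j)"
        using that by (simp add: power_diff power_one_over field_simps)
      moreover have "(2::real) ^ (Suc k - j) \<ge> 2 ^ 1" using that by (intro power_increasing) auto
      ultimately have "1 \<le> \<bar>1 - (2::real) ^ Suc k * (1/2) ^ j\<bar>" by simp
      moreover have "norm (1 - 2 ^ Suc k * (1/2) ^ j :: complex) = \<bar>1 - (2::real) ^ Suc k * (1/2) ^ j\<bar>"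
        by (simp flip: norm_of_real[where 'a=complex])
      ultimately have "norm (coeff p j) * 1 \<le> norm (coeff p j) * norm (1 - 2 ^ Suc k * (1/2) ^ j :: complex)"
        by (intro mult_left_mono) auto
      also have "\<dots> = norm (coeff q j)" by (simp only: cq norm_mult)
      also have "\<dots> \<le> C' * A" using q[of j] by (simp add: C'_def mult_ac)
      finally show ?thesis by simp
    qed
    have CA: "0 \<le> C' * A" using C' A0 by simp
    consider "j \<le> k" | "j = Suc k" | "j > Suc k" by linarith
    then show ?thesis
    proof cases
      case 1
      have "C' * A \<le> (1 + real (Suc (Suc k)) * C') * A"
        using A0 C' by (intro mult_right_mono) (auto simp: algebra_simps)
      with low[OF 1] show ?thesis by linarith
    next
      case 2
      \<comment> \<open>The leading coefficient, which q has lost, is recovered from the value at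
        1.\<close>
      have "poly p 1 = (\<Sum>i\<le>Suc k. coeff p i)"
        using poly_eq_sum_atMost[OF deg, of 1] by simp
      then have "coeff p (Suc k) = poly p 1 - (\<Sum>i\<le>k. coeff p i)" by simp
      then have "norm (coeff p (Suc k)) \<le> norm (poly p 1) + norm (\<Sum>i\<le>k. coeff p i)"
        by (simp only: norm_triangle_ineq4)
      also have "\<dots> \<le> A + (\<Sum>i\<le>k. C' * A)"
        using A[rule_format, of 1] low by (intro add_mono sum_norm_le) auto
      also have "\<dots> \<le> (1 + real (Suc (Suc k)) * C') * A" using CA by (simp add: algebra_simps)
      finally show ?thesis using 2 by simp
    next
      case 3
      then show ?thesis using deg A0 C' by (simp add: coeff_eq_0)
    qed
  qed
  moreover have "1 + real (Suc (Suc k)) * C' \<ge> 0" using C' by simp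
  ultimately show ?case by blast
qed

lemma poly_lipschitz_at_0:
  "\<exists>C\<ge>0. \<forall>p A. degree p \<le> k \<longrightarrow> (\<forall>t\<in>{0<..1}. norm (poly p (complex_of_real t)) \<le> A) \<longrightarrow>
    (\<forall>t\<in>{0..1}. norm (poly p (complex_of_real t) - poly p 0) \<le> C * A * t)"
proof -
  obtain C where C: "C \<ge> 0" "\<And>p A j. degree p \<le> k \<Longrightarrow>
    (\<And>t. t \<in> {0<..1} \<Longrightarrow> norm (poly p (complex_of_real t)) \<le> A) \<Longrightarrow> norm (coeff p j) \<le> C * A"
    using poly_coeff_bound[of k] by metis
  have "norm (poly p (complex_of_real t) - poly p 0) \<le> (real (Suc k) * C) * A * t"
    if "degree p \<le> k" "\<forall>t\<in>{0<..1}. norm (poly p (complex_of_real t)) \<le> A" "t \<in> {0..1}" for p A t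
  proof -
    obtain a r where p: "p = pCons a r" by (cases p)
    have "degree r \<le> k" using that(1) by (auto simp: p split: if_splits)
    then have "poly r (complex_of_real t) = (\<Sum>i\<le>k. coeff r i * complex_of_real t ^ i)"
      by (rule poly_eq_sum_atMost)
    also have "norm \<dots> \<le> (\<Sum>i\<le>k. C * A)"
    proof (rule sum_norm_le)
      fix i
      have "norm (coeff r i) \<le> C * A" using C(2)[of p A "Suc i"] that by (simp add: p)
      moreover have "norm (coeff r i) * t ^ i \<le> norm (coeff r i) * 1"
        using that by (intro mult_left_mono power_le_one) auto
      ultimately show "norm (coeff r i * complex_of_real t ^ i) \<le> C * A"
        using that by (simp add: norm_mult norm_power)
    qed
    finally have "t * norm (poly r (complex_of_real t)) \<le> t * (real (Suc k) * (C * A))"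
      using that by (intro mult_left_mono) auto
    then show ?thesis using that by (simp add: p norm_mult mult_ac)
  qed
  then show ?thesis using C(1) by (intro exI[of _ "real (Suc k) * C"]) auto
qed

text \<open>Unlike membership in \<^term>\<open>polys s k\<close>, this weaker property is visibly stable under dilations.\<close>

definition axis_poly :: "nat \<Rightarrow> (real^'d::finite \<Rightarrow> complex) \<Rightarrow> bool" where
  "axis_poly k P \<longleftrightarrow> (\<forall>y i. \<exists>p. degree p \<le> k \<and> (\<forall>t. P (y + t *\<^sub>R axis i 1) = poly p (complex_of_real t)))"

text \<open>Since each s_i is at least 1, the ordinary degree in the single variable z_i never
  exceeds the anisotropic degree.\<close>

lemma axis_poly_polys:
  fixes s :: "'d::finite \<Rightarrow> nat"
  assumes s: "\<forall>i. 1 \<le> s i" and "P \<in> polys s k"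
  shows "axis_poly k P"
  unfolding axis_poly_def
proof (intro allI)
  fix y :: "real^'d" and i
  obtain c where P: "P = (\<lambda>z. \<Sum>\<beta>\<in>{\<beta>. adeg s \<beta> \<le> k}. c \<beta> * (\<Prod>i\<in>UNIV. complex_of_real (z$i) ^ \<beta> i))"
    using assms(2) by (auto simp: polys_def)
  define p where "p = (\<Sum>\<beta>\<in>{\<beta>. adeg s \<beta> \<le> k}.
    smult (c \<beta> * (\<Prod>j\<in>UNIV - {i}. complex_of_real (y$j) ^ \<beta> j)) ([:complex_of_real (y$i), 1:] ^ \<beta> i))"
  have "degree p \<le> k"
    unfolding p_def
  proof (rule degree_sum_le[OF finite_adeg_le[OF s]])
    fix \<beta> assume \<beta>: "\<beta> \<in> {\<beta>. adeg s \<beta> \<le> k}"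
    have "\<beta> i \<le> s i * \<beta> i" using s[rule_format, of i] by simp
    also have "\<dots> \<le> adeg s \<beta>" unfolding adeg_def by (rule member_le_sum) auto
    finally have "\<beta> i \<le> k" using \<beta> by simp
    moreover have "degree ([:complex_of_real (y$i), 1:] ^ \<beta> i) \<le> \<beta> i"
      by (rule order.trans[OF degree_power_le]) simp
    ultimately show "degree (smult (c \<beta> * (\<Prod>j\<in>UNIV - {i}. complex_of_real (y$j) ^ \<beta> j))
        ([:complex_of_real (y$i), 1:] ^ \<beta> i)) \<le> k"
      by (intro order.trans[OF degree_smult_le]) linarith
  qed
  moreover have "P (y + t *\<^sub>R axis i 1) = poly p (complex_of_real t)" for t
  proof -
    have "(\<Prod>j\<in>UNIV. complex_of_real ((y + t *\<^sub>R axis i 1)$j) ^ \<beta> j) =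
        (complex_of_real (y$i) + complex_of_real t) ^ \<beta> i * (\<Prod>j\<in>UNIV - {i}. complex_of_real (y$j) ^ \<beta> j)" for \<beta>
      by (subst prod.remove[of _ i]) (auto simp: axis_def intro!: prod.cong)
    then show ?thesis by (simp add: P p_def poly_sum mult_ac)
  qed
  ultimately show "\<exists>p. degree p \<le> k \<and> (\<forall>t. P (y + t *\<^sub>R axis i 1) = poly p (complex_of_real t))"
    by blast
qed

lemma axis_poly_dil:
  assumes "axis_poly k P"
  shows "axis_poly k (\<lambda>z. c * P (x + dil s r z))"
  unfolding axis_poly_def
proof (intro allI)
  fix y :: "real^'a" and i
  obtain p where p: "degree p \<le> k" "\<And>t. P ((x + dil s r y) + t *\<^sub>R axis i 1) = poly p (complex_of_real t)"
    using assms unfolding axis_poly_def by metis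
  have "x + dil s r (y + t *\<^sub>R axis i 1) = (x + dil s r y) + (r ^ s i * t) *\<^sub>R axis i 1" for t
    by (auto simp: dil_def vec_eq_iff axis_def algebra_simps)
  then have "c * P (x + dil s r (y + t *\<^sub>R axis i 1)) =
      poly (smult c (pcompose p [:0, complex_of_real (r ^ s i):])) (complex_of_real t)" for t
    by (simp only: p(2)) (simp add: poly_pcompose mult.commute)
  moreover have "degree (smult c (pcompose p [:0, complex_of_real (r ^ s i):])) \<le> k"
    using p(1) by (intro order.trans[OF degree_smult_le] order.trans[OF degree_pcompose_le]) auto
  ultimately show "\<exists>p. degree p \<le> k \<and> (\<forall>t. c * P (x + dil s r (y + t *\<^sub>R axis i 1)) = poly p (complex_of_real t))"
    by blast
qed

text \<open>The constant 2 only has to be independent of the germ: the bound serves for equicontinuity alone.\<close>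

definition normalized :: "('d::finite \<Rightarrow> nat) \<Rightarrow> real \<Rightarrow> real \<Rightarrow> real \<Rightarrow> (real^'d \<Rightarrow> real^'d \<Rightarrow> complex) \<Rightarrow> bool" where
  "normalized s \<eta> \<alpha> r V \<longleftrightarrow>
     (\<forall>x. continuous_on UNIV (V x)) \<and>
     (\<forall>x z. adist s x z < r \<longrightarrow> norm (V x z) \<le> adist s x z powr \<eta>) \<and>
     (\<forall>x y. 0 < adist s x y \<and> adist s x y < r \<longrightarrow>
       (\<exists>P. axis_poly (nat \<lfloor>\<eta>\<rfloor>) P \<and> (\<forall>z. 0 < adist s y z \<and> adist s y z < r \<longrightarrow>
         norm (V x z - V y z - P z) \<le>
           2 * (adist s y z powr \<alpha> * (adist s x y + adist s y z) powr (\<eta> - \<alpha>)))))"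

lemma adist_axis: "adist s y (y + t *\<^sub>R axis i 1) = \<bar>t\<bar> powr (1 / real (s i))"
proof -
  have "\<bar>y$j - (y + t *\<^sub>R axis i 1)$j\<bar> powr (1 / real (s j)) = (if j = i then \<bar>t\<bar> powr (1 / real (s i)) else 0)" for j
    by (auto simp: axis_def)
  then show ?thesis by (simp add: adist_def)
qed

text \<open>Along an axis line, V 0 z - V 0 y splits into (V 0 z - V y z - P z) + V y z + (P z - V 0
  y). The first two parts are small by the two seminorm bounds. For the third, P on the line is a
  polynomial in one variable, bounded because the other terms are, and its value at y is V 0
  y.\<close>

lemma normalized_axis_step:
  fixes s :: "'d::finite \<Rightarrow> nat"
  assumes s: "\<forall>i. 1 \<le> s i" and "0 < \<alpha>" "\<alpha> < \<eta>" and "K \<ge> 0"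
  shows "\<exists>C\<ge>0. \<exists>Q. \<exists>\<theta>>0. \<forall>V r y i t. normalized s \<eta> \<alpha> r V \<longrightarrow> Q < r \<longrightarrow> (\<forall>j. \<bar>y$j\<bar> \<le> K) \<longrightarrow>
    0 \<le> t \<longrightarrow> t \<le> 1 \<longrightarrow> norm (V 0 (y + t *\<^sub>R axis i 1) - V 0 y) \<le> C * t powr \<theta>"
proof -
  \<comment> \<open>Coordinates up to K keep y within distance Q - 1 of 0, and those up to K + 1
    keep the endpoint of a unit step within Q; so Q < r keeps all points in the range of the
    bounds.\<close>
  define Q where "Q = real CARD('d) * (K + 2) + 1"
  have Q: "Q \<ge> 1" using \<open>K \<ge> 0\<close> by (simp add: Q_def)
  define S where "S = (\<Sum>i\<in>UNIV. s i)"
  \<comment> \<open>A step t along axis i has anisotropic length t^(1/s_i), whose alpha-th power is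
    t^(alpha/s_i). S dominates every s_i, and the 1 accounts for the Lipschitz polynomial.\<close>
  define \<theta> where "\<theta> = min 1 (\<alpha> / real S)"
  have "S > 0" unfolding S_def using s by (intro sum_pos) (auto simp: Suc_le_eq)
  then have \<theta>: "\<theta> > 0" using \<open>0 < \<alpha>\<close> by (simp add: \<theta>_def)
  have \<theta>_le: "\<theta> \<le> \<alpha> / real (s i)" for i
  proof -
    have "s i \<le> S" unfolding S_def by (rule member_le_sum) auto
    then have "\<alpha> / real S \<le> \<alpha> / real (s i)"
      using s[rule_format, of i] \<open>0 < \<alpha>\<close> \<open>S > 0\<close> by (intro divide_left_mono mult_pos_pos) auto
    then show ?thesis by (simp add: \<theta>_def)
  qed
  \<comment> \<open>E is the coefficient of the alpha-th power in the comparison of base points; A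
    adds to it the bounds Q^eta for V 0 and 1 for V y, and so bounds P on the segment.\<close>
  define E where "E = 2 * Q powr (\<eta> - \<alpha>)"
  define A where "A = Q powr \<eta> + 1 + E"
  obtain Cp where Cp: "Cp \<ge> 0" "\<And>p t. degree p \<le> nat \<lfloor>\<eta>\<rfloor> \<Longrightarrow>
      (\<And>t. t \<in> {0<..1} \<Longrightarrow> norm (poly p (complex_of_real t)) \<le> A) \<Longrightarrow>
      t \<in> {0..1} \<Longrightarrow> norm (poly p (complex_of_real t) - poly p 0) \<le> Cp * A * t"
    using poly_lipschitz_at_0[of "nat \<lfloor>\<eta>\<rfloor>"] by metis
  have A: "A \<ge> 0" "E \<ge> 0" by (simp_all add: A_def E_def)
  define C where "C = E + 1 + Cp * A"
  have "norm (V 0 (y + t *\<^sub>R axis i 1) - V 0 y) \<le> C * t powr \<theta>"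
    if V: "normalized s \<eta> \<alpha> r V" and r: "Q < r" and y: "\<And>j. \<bar>y$j\<bar> \<le> K" and t: "0 \<le> t" "t \<le> 1"
    for V :: "real^'d \<Rightarrow> real^'d \<Rightarrow> complex" and r y i t
  proof (cases "t = 0")
    case False
    with t have "t > 0" by simp
    define z where "z \<tau> = y + \<tau> *\<^sub>R axis i 1" for \<tau>
    define \<delta> where "\<delta> \<tau> = \<tau> powr (1 / real (s i))" for \<tau>
    have cont: "continuous_on UNIV (V x)" for x using V by (simp add: normalized_def)
    have growth: "norm (V x z) \<le> adist s x z powr \<eta>" if "adist s x z < r" for x z
      using V that by (simp add: normalized_def)
    have yz: "adist s y (z \<tau>) = \<delta> \<tau>" if "0 \<le> \<tau>" for \<tau>
      using that by (simp add: z_def \<delta>_def adist_axis)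
    have \<delta>: "0 < \<delta> \<tau>" "\<delta> \<tau> \<le> 1" if "0 < \<tau>" "\<tau> \<le> 1" for \<tau>
      using that by (auto simp: \<delta>_def intro: powr_le1)
    have y0: "adist s 0 y \<le> Q - 1"
      using adist_0_le[OF s y] by (simp add: Q_def algebra_simps)
    have z0: "adist s 0 (z \<tau>) \<le> Q" if "0 < \<tau>" "\<tau> \<le> 1" for \<tau>
    proof -
      have "\<bar>(z \<tau>)$j\<bar> \<le> K + 1" for j
        using y[of j] that by (auto simp: z_def axis_def)
      from adist_0_le[OF s this] show ?thesis by (simp add: Q_def add.assoc)
    qed
    obtain P where P: "axis_poly (nat \<lfloor>\<eta>\<rfloor>) P" "\<And>z. 0 < adist s y z \<Longrightarrow> adist s y z < r \<Longrightarrow>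
        norm (V 0 z - V y z - P z) \<le> 2 * (adist s y z powr \<alpha> * (adist s 0 y + adist s y z) powr (\<eta> - \<alpha>))"
    \<comment> \<open>The seminorm compares distinct base points only; for y = 0 the difference
      vanishes and P = 0 serves.\<close>
    proof (cases "y = 0")
      case True
      have "axis_poly (nat \<lfloor>\<eta>\<rfloor>) (\<lambda>_::real^'d. 0)"
        unfolding axis_poly_def by (intro allI exI[of _ 0]) simp
      then show thesis by (rule that) (use True in simp)
    next
      case False
      then have "0 < adist s 0 y" by (simp add: less_le adist_nonneg)
      moreover have "adist s 0 y < r" using y0 r by linarith
      ultimately have "\<exists>P. axis_poly (nat \<lfloor>\<eta>\<rfloor>) P \<and> (\<forall>z. 0 < adist s y z \<and> adist s y z < r \<longrightarrow>
         norm (V 0 z - V y z - P z) \<le> 2 * (adist s y z powr \<alpha> * (adist s 0 y + adist s y z) powr (\<eta> - \<alpha>)))"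
        using V unfolding normalized_def by blast
      then show thesis using that by blast
    qed
    obtain p where p: "degree p \<le> nat \<lfloor>\<eta>\<rfloor>" "\<And>\<tau>. P (z \<tau>) = poly p (complex_of_real \<tau>)"
      using P(1) unfolding axis_poly_def z_def by metis
    have err: "norm (V 0 (z \<tau>) - V y (z \<tau>) - P (z \<tau>)) \<le> \<delta> \<tau> powr \<alpha> * E" if "0 < \<tau>" "\<tau> \<le> 1" for \<tau>
    proof -
      have "norm (V 0 (z \<tau>) - V y (z \<tau>) - P (z \<tau>)) \<le> 2 * (\<delta> \<tau> powr \<alpha> * (adist s 0 y + \<delta> \<tau>) powr (\<eta> - \<alpha>))"
        using P(2)[of "z \<tau>"] yz[of \<tau>] \<delta>[OF that] that r Q by simp
      also have "\<dots> \<le> 2 * (\<delta> \<tau> powr \<alpha> * Q powr (\<eta> - \<alpha>))"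
        using y0 \<delta>[OF that] \<open>\<alpha> < \<eta>\<close> adist_nonneg[of s 0 y]
        by (intro mult_left_mono powr_mono2) auto
      finally show ?thesis by (simp add: E_def mult_ac)
    qed
    have Vy: "norm (V y (z \<tau>)) \<le> \<delta> \<tau> powr \<eta>" if "0 < \<tau>" "\<tau> \<le> 1" for \<tau>
      using growth[of y "z \<tau>"] yz[of \<tau>] \<delta>[OF that] that r Q by simp
    have pA: "norm (poly p (complex_of_real \<tau>)) \<le> A" if "\<tau> \<in> {0<..1}" for \<tau>
    proof -
      have \<tau>: "0 < \<tau>" "\<tau> \<le> 1" using that by auto
      have "norm (V 0 (z \<tau>)) \<le> adist s 0 (z \<tau>) powr \<eta>"
        using growth[of 0 "z \<tau>"] z0[OF \<tau>] r by simp
      also have "\<dots> \<le> Q powr \<eta>"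
        using z0[OF \<tau>] \<open>0 < \<alpha>\<close> \<open>\<alpha> < \<eta>\<close> adist_nonneg[of s 0 "z \<tau>"] by (intro powr_mono2) auto
      finally have 1: "norm (V 0 (z \<tau>)) \<le> Q powr \<eta>" .
      have "\<delta> \<tau> powr \<eta> \<le> 1" "\<delta> \<tau> powr \<alpha> \<le> 1"
        using \<delta>[OF \<tau>] \<open>0 < \<alpha>\<close> \<open>\<alpha> < \<eta>\<close> by (auto intro: powr_le1)
      then have 2: "norm (V y (z \<tau>)) \<le> 1" "norm (V 0 (z \<tau>) - V y (z \<tau>) - P (z \<tau>)) \<le> 1 * E"
        using order.trans[OF Vy[OF \<tau>]] order.trans[OF err[OF \<tau>] mult_right_mono[OF _ A(2)]] by blast+
      have "P (z \<tau>) = V 0 (z \<tau>) - V y (z \<tau>) - (V 0 (z \<tau>) - V y (z \<tau>) - P (z \<tau>))" by simp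
      then have "norm (P (z \<tau>)) \<le> norm (V 0 (z \<tau>)) + norm (V y (z \<tau>)) + norm (V 0 (z \<tau>) - V y (z \<tau>) - P (z \<tau>))"
        using norm_triangle_ineq4[of "V 0 (z \<tau>) - V y (z \<tau>)" "V 0 (z \<tau>) - V y (z \<tau>) - P (z \<tau>)"]
          norm_triangle_ineq4[of "V 0 (z \<tau>)" "V y (z \<tau>)"] by simp
      then show ?thesis using 1 2 by (simp add: A_def p(2))
    qed
    \<comment> \<open>The estimate for P excludes z = y, so P y is identified by letting
      \<open>\<tau>\<close> tend to 0, using continuity and V y y = 0.\<close>
    have p0: "poly p 0 = V 0 y"
    proof -
      have ez: "(z \<longlongrightarrow> y) (at_right 0)"
        unfolding z_def by (auto intro!: tendsto_eq_intros)
      have Vz: "((\<lambda>\<tau>. V x (z \<tau>)) \<longlongrightarrow> V x y) (at_right 0)" for x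
        using cont[of x] ez by (intro isCont_tendsto_compose[of y "V x"]) (auto simp: continuous_on_eq_continuous_at)
      have ev: "eventually (\<lambda>\<tau>. 0 < \<tau> \<and> \<tau> \<le> 1) (at_right (0::real))"
        by (rule eventually_at_rightI[of 0 1]) auto
      have \<delta>0: "((\<lambda>\<tau>. \<delta> \<tau> powr \<alpha> * E) \<longlongrightarrow> 0) (at_right 0)"
      proof -
        have "(\<delta> \<longlongrightarrow> 0) (at_right 0)"
          unfolding \<delta>_def using s[rule_format, of i]
          by (intro tendsto_eq_intros tendsto_powr') (auto intro!: tendsto_eq_intros simp: eventually_at_filter)
        then have "((\<lambda>\<tau>. \<delta> \<tau> powr \<alpha>) \<longlongrightarrow> 0 powr \<alpha>) (at_right 0)"
        proof (rule tendsto_powr'[OF _ tendsto_const])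
          have "\<delta> \<tau> \<ge> 0" for \<tau> by (simp add: \<delta>_def)
          then show "0 \<noteq> 0 \<or> 0 < \<alpha> \<and> eventually (\<lambda>\<tau>. 0 \<le> \<delta> \<tau>) (at_right 0)"
            using \<open>0 < \<alpha>\<close> by simp
        qed
        then have "((\<lambda>\<tau>. \<delta> \<tau> powr \<alpha> * E) \<longlongrightarrow> 0 powr \<alpha> * E) (at_right 0)"
          by (rule tendsto_mult_right)
        then show ?thesis by simp
      qed
      have "((\<lambda>\<tau>. V 0 (z \<tau>) - V y (z \<tau>) - P (z \<tau>)) \<longlongrightarrow> 0) (at_right 0)"
        by (rule Lim_null_comparison[OF eventually_mono[OF ev] \<delta>0]) (use err in auto)
      moreover have "((\<lambda>\<tau>. V 0 (z \<tau>) - V y (z \<tau>) - P (z \<tau>)) \<longlongrightarrow> V 0 y - V y y - poly p (complex_of_real 0)) (at_right 0)"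
        unfolding p(2) by (intro tendsto_diff Vz tendsto_poly tendsto_of_real) (auto intro!: tendsto_eq_intros)
      ultimately have "V 0 y - V y y - poly p 0 = 0"
        using tendsto_unique[OF trivial_limit_at_right_real] by fastforce
      moreover have "V y y = 0" using growth[of y y] r Q by simp
      ultimately show ?thesis by simp
    qed
    have powr_le: "t powr b \<le> t powr \<theta>" if "\<theta> \<le> b" for b
      using that t \<open>t > 0\<close> by (intro powr_mono') auto
    have "\<delta> t powr \<alpha> \<le> t powr \<theta>"
      using \<theta>_le[of i] by (simp add: \<delta>_def powr_powr powr_le)
    then have 1: "norm (V 0 (z t) - V y (z t) - P (z t)) \<le> E * t powr \<theta>"
      using err[of t] \<open>t > 0\<close> t A(2) by (smt (verit) mult.commute mult_right_mono)
    have "\<alpha> / real (s i) \<le> \<eta> / real (s i)" using \<open>\<alpha> < \<eta>\<close> by (intro divide_right_mono) auto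
    then have "\<delta> t powr \<eta> \<le> t powr \<theta>"
      using \<theta>_le[of i] by (simp add: \<delta>_def powr_powr powr_le)
    then have 2: "norm (V y (z t)) \<le> 1 * t powr \<theta>" using Vy[of t] \<open>t > 0\<close> t by simp
    have "t powr 1 \<le> t powr \<theta>" by (rule powr_le) (simp add: \<theta>_def)
    then have "Cp * A * t \<le> (Cp * A) * t powr \<theta>" using Cp(1) A(1) \<open>t > 0\<close> by (intro mult_left_mono) auto
    moreover have "norm (P (z t) - V 0 y) \<le> Cp * A * t"
      using Cp(2)[OF p(1) pA, of t] t by (simp add: p0 p(2))
    ultimately have 3: "norm (P (z t) - V 0 y) \<le> (Cp * A) * t powr \<theta>" by linarith
    have "V 0 (z t) - V 0 y = (V 0 (z t) - V y (z t) - P (z t)) + V y (z t) + (P (z t) - V 0 y)" by simp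
    then have "norm (V 0 (z t) - V 0 y) \<le>
        norm (V 0 (z t) - V y (z t) - P (z t)) + norm (V y (z t)) + norm (P (z t) - V 0 y)"
      by (simp only:) (intro order.trans[OF norm_triangle_ineq] add_mono norm_triangle_ineq order_refl)
    also have "\<dots> \<le> C * t powr \<theta>" using 1 2 3 by (simp add: C_def algebra_simps)
    finally show ?thesis by (simp add: z_def)
  qed simp
  moreover have "C \<ge> 0" using A Cp(1) by (simp add: C_def)
  ultimately show ?thesis using \<theta> by blast
qed

text \<open>Axis steps of length at most \<open>norm (y - z)\<close> lead from z to y and stay in
  the coordinate box; a negative step is the reverse of a positive one.\<close>

lemma normalized_equicontinuous:
  fixes s :: "'d::finite \<Rightarrow> nat"
  assumes s: "\<forall>i. 1 \<le> s i" and "0 < \<alpha>" "\<alpha> < \<eta>" and "K \<ge> 0"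
  shows "\<exists>C\<ge>0. \<exists>Q. \<exists>\<theta>>0. \<forall>V r y z. normalized s \<eta> \<alpha> r V \<longrightarrow> Q < r \<longrightarrow>
    (\<forall>j. \<bar>y$j\<bar> \<le> K) \<longrightarrow> (\<forall>j. \<bar>z$j\<bar> \<le> K) \<longrightarrow> norm (y - z) \<le> 1 \<longrightarrow>
    norm (V 0 y - V 0 z) \<le> C * norm (y - z) powr \<theta>"
proof -
  obtain C Q \<theta> where C: "C \<ge> 0" and \<theta>: "\<theta> > 0"
    and step: "\<And>V r y i t. normalized s \<eta> \<alpha> r V \<Longrightarrow> Q < r \<Longrightarrow> (\<And>j. \<bar>y$j\<bar> \<le> K) \<Longrightarrow>
      0 \<le> t \<Longrightarrow> t \<le> 1 \<Longrightarrow> norm (V 0 (y + t *\<^sub>R axis i 1) - V 0 y) \<le> C * t powr \<theta>"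
    using normalized_axis_step[OF assms] by metis
  have "norm (V 0 y - V 0 z) \<le> (real CARD('d) * C) * norm (y - z) powr \<theta>"
    if V: "normalized s \<eta> \<alpha> r V" "Q < r" and y: "\<And>j. \<bar>y$j\<bar> \<le> K" and z: "\<And>j. \<bar>z$j\<bar> \<le> K"
      and d: "norm (y - z) \<le> 1"
    for V :: "real^'d \<Rightarrow> real^'d \<Rightarrow> complex" and r y z
  proof -
    define H where "H I = (\<chi> i. if i \<in> I then y$i else z$i)" for I
    have box: "\<bar>(H I)$j\<bar> \<le> K" for I j using y z by (simp add: H_def)
    have "norm (V 0 (H I) - V 0 z) \<le> real (card I) * (C * norm (y - z) powr \<theta>)" if "finite I" for I
      using that
    proof (induction I rule: finite_induct)
      case empty
      have "H {} = z" by (simp add: H_def vec_eq_iff)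
      then show ?case by simp
    next
      case (insert j I)
      define t where "t = y$j - z$j"
      have t: "\<bar>t\<bar> \<le> norm (y - z)" using component_le_norm_cart[of "y - z" j] by (simp add: t_def)
      have eq: "H (insert j I) = H I + t *\<^sub>R axis j 1"
        using insert by (auto simp: H_def vec_eq_iff axis_def t_def)
      then have eq': "H I = H (insert j I) + (- t) *\<^sub>R axis j 1" by simp
      have "norm (V 0 (H (insert j I)) - V 0 (H I)) \<le> C * \<bar>t\<bar> powr \<theta>"
      proof (cases "t \<ge> 0")
        case True
        then show ?thesis using step[OF V box[of I], of t j] t d by (simp add: eq)
      next
        case False
        then have "norm (V 0 (H I) - V 0 (H (insert j I))) \<le> C * \<bar>t\<bar> powr \<theta>"
          using step[OF V box[of "insert j I"], of "- t" j] t d unfolding eq'[symmetric] by simp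
        then show ?thesis by (simp add: norm_minus_commute)
      qed
      also have "\<dots> \<le> C * norm (y - z) powr \<theta>"
        using t \<theta> C by (intro mult_left_mono powr_mono2) auto
      finally have 1: "norm (V 0 (H (insert j I)) - V 0 (H I)) \<le> C * norm (y - z) powr \<theta>" .
      have "V 0 (H (insert j I)) - V 0 z = (V 0 (H (insert j I)) - V 0 (H I)) + (V 0 (H I) - V 0 z)" by simp
      then have "norm (V 0 (H (insert j I)) - V 0 z) \<le>
          norm (V 0 (H (insert j I)) - V 0 (H I)) + norm (V 0 (H I) - V 0 z)"
        by (metis norm_triangle_ineq)
      with 1 insert show ?case by (simp add: algebra_simps)
    qed
    from this[of UNIV] have "norm (V 0 (H UNIV) - V 0 z) \<le> real CARD('d) * (C * norm (y - z) powr \<theta>)" by simp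
    moreover have "H UNIV = y" by (simp add: H_def vec_eq_iff)
    ultimately show ?thesis by (simp add: mult_ac)
  qed
  moreover have "real CARD('d) * C \<ge> 0" using C by simp
  ultimately show ?thesis using \<theta> by blast
qed

section \<open>Blow-up\<close>

text \<open>Arzela-Ascoli in pointwise form. Equicontinuity at z is asked only from some index on,
  since the n-th function of the blow-up is controlled only on a ball of radius \<open>r n\<close>;
  pointwise convergence suffices for the dominated convergence in
  \<open>Lop_tendsto\<close>.\<close>

lemma equicontinuous_convergent_subsequence:
  fixes f :: "nat \<Rightarrow> 'a::{metric_space, second_countable_topology} \<Rightarrow> complex"
  assumes bd: "\<And>z. \<exists>B. \<forall>n. norm (f n z) \<le> B"
    and eq: "\<And>z e. e > 0 \<Longrightarrow> \<exists>d>0. \<exists>N. \<forall>n\<ge>N. \<forall>y. dist y z < d \<longrightarrow> norm (f n y - f n z) < e"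
  obtains \<sigma> F where "strict_mono \<sigma>" "\<And>z. (\<lambda>n. f (\<sigma> n) z) \<longlonglongrightarrow> F z" "continuous_on UNIV F"
proof -
  obtain X :: "'a set" where X: "countable X" "\<And>S. open S \<Longrightarrow> S \<noteq> {} \<Longrightarrow> \<exists>x\<in>X. x \<in> S"
    using countable_dense_exists[where 'a='a] by metis
  obtain B where B: "\<And>n z. norm (f n z) \<le> B z" using bd by metis
  have Bpos: "1 + B z > 0" for z using order.trans[OF norm_ge_zero B[of 0 z]] by simp
  \<comment> \<open>The diagonal lemma wants one bound for all points of X, so the values are
    divided by the positive number 1 + B x first.\<close>
  obtain \<sigma> where \<sigma>: "strict_mono \<sigma>"
    and X_lim: "\<And>x. x \<in> X \<Longrightarrow> \<exists>l. (\<lambda>n. f (\<sigma> n) x / complex_of_real (1 + B x)) \<longlonglongrightarrow> l"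
  proof (rule function_convergent_subsequence[OF X(1), of "\<lambda>n x. f n x / complex_of_real (1 + B x)" 1])
    show "norm (f n x / complex_of_real (1 + B x)) \<le> 1" for n x
      using B[of n x] Bpos[of x] by (simp add: norm_divide del: of_real_add)
  qed blast
  have X_conv: "convergent (\<lambda>n. f (\<sigma> n) x)" if x: "x \<in> X" for x
  proof -
    obtain l where "(\<lambda>n. f (\<sigma> n) x / complex_of_real (1 + B x)) \<longlonglongrightarrow> l" using X_lim[OF x] by blast
    then have "(\<lambda>n. f (\<sigma> n) x / complex_of_real (1 + B x) * complex_of_real (1 + B x)) \<longlonglongrightarrow>
        l * complex_of_real (1 + B x)" by (intro tendsto_intros)
    moreover have "complex_of_real (1 + B x) \<noteq> 0" using Bpos[of x] by (simp only: of_real_eq_0_iff)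
    ultimately show ?thesis by (auto simp: convergent_def)
  qed
  have "Cauchy (\<lambda>n. f (\<sigma> n) z)" for z
  proof (rule metric_CauchyI)
    fix e :: real assume "e > 0"
    then have e3: "e / 3 > 0" by simp
    then obtain d N where d: "d > 0" "\<And>n y. n \<ge> N \<Longrightarrow> dist y z < d \<Longrightarrow> norm (f n y - f n z) < e / 3"
      using eq by meson
    obtain x where x: "x \<in> X" "dist x z < d"
      using X(2)[of "ball z d"] d(1) by (auto simp: dist_commute)
    obtain M where M: "\<And>i j. i \<ge> M \<Longrightarrow> j \<ge> M \<Longrightarrow> dist (f (\<sigma> i) x) (f (\<sigma> j) x) < e / 3"
      using metric_CauchyD[OF convergent_Cauchy[OF X_conv[OF x(1)]] e3] by blast
    have "dist (f (\<sigma> i) z) (f (\<sigma> j) z) < e" if "i \<ge> max M N" "j \<ge> max M N" for i j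
    proof -
      have "\<sigma> i \<ge> N" "\<sigma> j \<ge> N" using that seq_suble[OF \<sigma>] by (meson le_trans max.boundedE)+
      then have "dist (f (\<sigma> i) x) (f (\<sigma> i) z) < e / 3" "dist (f (\<sigma> j) x) (f (\<sigma> j) z) < e / 3"
        using d(2) x(2) by (auto simp: dist_norm)
      moreover have "dist (f (\<sigma> i) x) (f (\<sigma> j) x) < e / 3" using M that by simp
      moreover have "dist (f (\<sigma> i) z) (f (\<sigma> j) z) \<le>
          dist (f (\<sigma> i) x) (f (\<sigma> i) z) + dist (f (\<sigma> i) x) (f (\<sigma> j) x) + dist (f (\<sigma> j) x) (f (\<sigma> j) z)"
        using dist_triangle[of "f (\<sigma> i) z" "f (\<sigma> j) z" "f (\<sigma> i) x"]
          dist_triangle[of "f (\<sigma> i) x" "f (\<sigma> j) z" "f (\<sigma> j) x"] by (simp add: dist_commute)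
      ultimately show ?thesis by linarith
    qed
    then show "\<exists>M. \<forall>m\<ge>M. \<forall>n\<ge>M. dist (f (\<sigma> m) z) (f (\<sigma> n) z) < e" by blast
  qed
  then obtain F where F: "\<And>z. (\<lambda>n. f (\<sigma> n) z) \<longlonglongrightarrow> F z"
    unfolding Cauchy_convergent_iff convergent_def by metis
  have "isCont F z" for z
    unfolding continuous_at_eps_delta
  proof (intro allI impI)
    fix e :: real assume "e > 0"
    then obtain d N where d: "d > 0" "\<And>n y. n \<ge> N \<Longrightarrow> dist y z < d \<Longrightarrow> norm (f n y - f n z) < e / 2"
      using eq[of "e / 2" z] by (metis half_gt_zero)
    have "dist (F y) (F z) < e" if "dist y z < d" for y
    proof -
      have "(\<lambda>n. norm (f (\<sigma> n) y - f (\<sigma> n) z)) \<longlonglongrightarrow> norm (F y - F z)" by (intro tendsto_intros F)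
      moreover have "norm (f (\<sigma> n) y - f (\<sigma> n) z) \<le> e / 2" if "n \<ge> N" for n
        using d(2)[of "\<sigma> n" y] \<open>dist y z < d\<close> that le_trans[OF that seq_suble[OF \<sigma>]] by (intro less_imp_le)
      ultimately have "norm (F y - F z) \<le> e / 2" by (intro LIMSEQ_le_const2) auto
      then show ?thesis using \<open>e > 0\<close> by (simp add: dist_norm)
    qed
    then show "\<exists>d>0. \<forall>y. dist y z < d \<longrightarrow> dist (F y) (F z) < e" using d(1) by blast
  qed
  then show thesis using that[OF \<sigma> F] by (simp add: continuous_at_imp_continuous_on)
qed

text \<open>The points \<open>w n\<close> move with n, so they too pass to a limit w0 on the compact
  unit sphere; equicontinuity carries the lower bound 1/2 over to w0 up to a small error, while the
  Liouville theorem gives F w0 = 0.\<close>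

lemma blow_up_contradiction:
  fixes V :: "nat \<Rightarrow> real^'d::finite \<Rightarrow> real^'d \<Rightarrow> complex"
  assumes s: "\<forall>i. 1 \<le> s i" and ell: "elliptic s m a" and "0 < \<alpha>" "\<alpha> < \<eta>" "\<eta> \<notin> \<nat>"
    and r: "filterlim r at_top sequentially"
    and V: "\<And>n. normalized s \<eta> \<alpha> (r n) (V n)"
    and Lop: "\<And>\<mu> \<phi>. \<mu> > 0 \<Longrightarrow> \<phi> \<in> testB s k \<Longrightarrow>
      (\<lambda>n. Lop s m a (fdist (\<lambda>z. V n 0 (dil s \<mu> z))) \<phi>) \<longlonglongrightarrow> 0"
    and w: "\<And>n. adist s 0 (w n) = 1" "\<And>n. norm (V n 0 (w n)) \<ge> 1/2"
  shows False
proof -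
  have "\<eta> > 0" using \<open>0 < \<alpha>\<close> \<open>\<alpha> < \<eta>\<close> by simp
  have "compact {x :: real^'d. adist s 0 x = 1}"
    unfolding compact_eq_bounded_closed
  proof
    have "norm x \<le> real CARD('d)" if "adist s 0 x = 1" for x :: "real^'d"
    proof -
      have "norm x \<le> (\<Sum>i\<in>(UNIV::'d set). 1)"
        using abs_component_le_adist[OF s, of x] that
        by (intro order.trans[OF norm_le_l1_cart] sum_mono) simp
      then show ?thesis by simp
    qed
    then show "bounded {x :: real^'d. adist s 0 x = 1}" by (auto simp: bounded_iff)
    show "closed {x :: real^'d. adist s 0 x = 1}"
      by (intro closed_Collect_eq continuous_on_adist[OF s] continuous_intros)
  qed
  then obtain w0 \<sigma>1 where w0: "adist s 0 w0 = 1" and \<sigma>1: "strict_mono \<sigma>1" "(w \<circ> \<sigma>1) \<longlonglongrightarrow> w0"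
    using w(1) unfolding compact_def by (metis (mono_tags, lifting) mem_Collect_eq)
  define f where "f n = V (\<sigma>1 n) 0" for n
  have r1: "filterlim (r \<circ> \<sigma>1) at_top sequentially"
    unfolding o_def using filterlim_compose[OF r filterlim_subseq[OF \<sigma>1(1)]] .
  have cont: "continuous_on UNIV (f n)" for n using V by (simp add: f_def normalized_def)
  have growth: "norm (f n z) \<le> adist s 0 z powr \<eta>" if "adist s 0 z < r (\<sigma>1 n)" for n z
    using V[of "\<sigma>1 n"] that by (simp add: f_def normalized_def)
  have bd: "\<exists>B. \<forall>n. norm (f n z) \<le> B" for z
  proof -
    have "eventually (\<lambda>n. adist s 0 z < r (\<sigma>1 n)) sequentially"
      using r1 by (simp add: filterlim_at_top_dense)
    then have "eventually (\<lambda>n. norm (f n z) \<le> adist s 0 z powr \<eta>) sequentially"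
      by (rule eventually_mono) (rule growth)
    then have "Bseq (\<lambda>n. f n z)" by (rule BfunI)
    then show ?thesis by (auto simp: Bseq_def)
  qed
  have eq: "\<exists>d>0. \<exists>N. \<forall>n\<ge>N. \<forall>y. dist y z < d \<longrightarrow> norm (f n y - f n z) < e" if "e > 0" for z e
  proof -
    have "norm z + 1 \<ge> 0" by simp
    from normalized_equicontinuous[OF s \<open>0 < \<alpha>\<close> \<open>\<alpha> < \<eta>\<close> this]
    obtain C Q \<theta> where C: "C \<ge> 0" and \<theta>: "\<theta> > 0"
      and eqc: "\<And>V r x y. normalized s \<eta> \<alpha> r V \<Longrightarrow> Q < r \<Longrightarrow> (\<And>j. \<bar>x$j\<bar> \<le> norm z + 1) \<Longrightarrow>
        (\<And>j. \<bar>y$j\<bar> \<le> norm z + 1) \<Longrightarrow> norm (x - y) \<le> 1 \<Longrightarrow> norm (V 0 x - V 0 y) \<le> C * norm (x - y) powr \<theta>"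
      by metis
    \<comment> \<open>Chosen so that C d^theta is at most C e / (C + 1) < e; the cap 1 meets the
      hypothesis of \<open>normalized_equicontinuous\<close>.\<close>
    define d where "d = min 1 ((e / (C + 1)) powr (1 / \<theta>))"
    have "d > 0" using C \<open>e > 0\<close> by (simp add: d_def)
    obtain N where N: "\<And>n. n \<ge> N \<Longrightarrow> Q < r (\<sigma>1 n)"
      using r1 by (auto simp: filterlim_at_top_dense eventually_sequentially)
    have "norm (f n y - f n z) < e" if "n \<ge> N" "dist y z < d" for n y
    proof -
      have yz: "norm (y - z) < d" "norm (y - z) \<le> 1" using that(2) by (auto simp: dist_norm d_def)
      have "\<bar>z$j\<bar> \<le> norm z + 1" "\<bar>y$j\<bar> \<le> norm z + 1" for j
        using component_le_norm_cart[of z j] component_le_norm_cart[of y j] yz(2) norm_triangle_sub[of y z] by auto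
      then have "norm (f n y - f n z) \<le> C * norm (y - z) powr \<theta>"
        unfolding f_def using V N[OF that(1)] yz(2) by (intro eqc)
      also have "\<dots> \<le> C * (e / (C + 1))"
      proof (rule mult_left_mono[OF _ C])
        have "norm (y - z) powr \<theta> \<le> ((e / (C + 1)) powr (1 / \<theta>)) powr \<theta>"
          using yz \<theta> by (intro powr_mono2) (auto simp: d_def)
        also have "\<dots> = e / (C + 1)" using \<theta> C \<open>e > 0\<close> by (simp add: powr_powr)
        finally show "norm (y - z) powr \<theta> \<le> e / (C + 1)" .
      qed
      also have "\<dots> < e" using C \<open>e > 0\<close> by (simp add: field_simps)
      finally show ?thesis .
    qed
    then show ?thesis using \<open>d > 0\<close> by blast
  qed
  obtain \<sigma>2 F where \<sigma>2: "strict_mono \<sigma>2" and F: "\<And>z. (\<lambda>n. f (\<sigma>2 n) z) \<longlonglongrightarrow> F z" and F_cont: "continuous_on UNIV F"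
    using equicontinuous_convergent_subsequence[OF bd eq] by blast
  have r2: "eventually (\<lambda>n. B < r (\<sigma>1 (\<sigma>2 n))) sequentially" for B
    using filterlim_compose[OF r1 filterlim_subseq[OF \<sigma>2]] by (simp add: filterlim_at_top_dense)
  have F_growth: "norm (F z) \<le> adist s 0 z powr \<eta>" for z
  proof (rule tendsto_upperbound[OF tendsto_norm[OF F]])
    show "eventually (\<lambda>n. norm (f (\<sigma>2 n) z) \<le> adist s 0 z powr \<eta>) sequentially"
      using r2 by (rule eventually_mono) (rule growth)
  qed simp
  have F_zero: "Lop s m a (fdist (\<lambda>z. F (dil s \<mu> z))) \<phi> = 0" if \<mu>: "\<mu> > 0" and \<phi>: "\<phi> \<in> testB s k" for \<mu> \<phi>
  proof -
    \<comment> \<open>The growth bound covers the ball of radius \<open>\<mu>\<close> only once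
      \<open>\<mu>\<close> is below the radius; dropping the first N terms makes it hold for every
      index, as \<open>Lop_tendsto\<close> requires.\<close>
    obtain N where N: "\<And>n. n \<ge> N \<Longrightarrow> \<mu> < r (\<sigma>1 (\<sigma>2 n))"
      using r2[of \<mu>] by (auto simp: eventually_sequentially)
    have "test_fun {y. adist s 0 y < 1} \<phi>" using \<phi> by (auto simp: testB_def test_fun_def)
    then have "(\<lambda>n. Lop s m a (fdist (\<lambda>z. f (\<sigma>2 (n + N)) (dil s \<mu> z))) \<phi>) \<longlonglongrightarrow> Lop s m a (fdist (\<lambda>z. F (dil s \<mu> z))) \<phi>"
    proof (rule Lop_tendsto)
      show "continuous_on UNIV (\<lambda>z. f (\<sigma>2 (n + N)) (dil s \<mu> z))" for n
        by (intro continuous_on_compose2[OF cont] continuous_on_dil continuous_intros) auto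
      show "continuous_on UNIV (\<lambda>z. F (dil s \<mu> z))"
        by (intro continuous_on_compose2[OF F_cont] continuous_on_dil continuous_intros) auto
      show "(\<lambda>n. f (\<sigma>2 (n + N)) (dil s \<mu> z)) \<longlonglongrightarrow> F (dil s \<mu> z)" for z
        using LIMSEQ_ignore_initial_segment[OF F] .
      show "norm (f (\<sigma>2 (n + N)) (dil s \<mu> z)) \<le> \<mu> powr \<eta>" if "z \<in> {y. adist s 0 y < 1}" for n z
      proof -
        have le: "adist s 0 (dil s \<mu> z) \<le> \<mu>"
          using that \<mu> by (simp add: adist_0_dil[OF s] mult_le_cancel_left1 less_imp_le)
        then have "norm (f (\<sigma>2 (n + N)) (dil s \<mu> z)) \<le> adist s 0 (dil s \<mu> z) powr \<eta>"
          using N[of "n + N"] by (intro growth) simp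
        also have "\<dots> \<le> \<mu> powr \<eta>" using le \<open>\<eta> > 0\<close> by (intro powr_mono2) (auto simp: adist_nonneg)
        finally show ?thesis .
      qed
    qed
    moreover have "(\<lambda>n. Lop s m a (fdist (\<lambda>z. f (\<sigma>2 (n + N)) (dil s \<mu> z))) \<phi>) \<longlonglongrightarrow> 0"
      using LIMSEQ_ignore_initial_segment[OF LIMSEQ_subseq_LIMSEQ[OF LIMSEQ_subseq_LIMSEQ[OF Lop[OF \<mu> \<phi>] \<sigma>1(1)] \<sigma>2], of N]
      by (simp add: f_def o_def)
    ultimately show ?thesis by (rule LIMSEQ_unique)
  qed
  have "F w0 = 0"
    by (rule liouville_growth[OF s ell F_cont F_growth \<open>\<eta> > 0\<close> \<open>\<eta> \<notin> \<nat>\<close> F_zero w0])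
  \<comment> \<open>Two errors below 1/4, from equicontinuity and from F w0 = 0, contradict the
    lower bound 1/2.\<close>
  obtain d N where d: "d > 0" "\<And>n y. n \<ge> N \<Longrightarrow> dist y w0 < d \<Longrightarrow> norm (f n y - f n w0) < 1/4"
    using eq[of "1/4" w0] by auto
  have "eventually (\<lambda>n. dist (w (\<sigma>1 (\<sigma>2 n))) w0 < d) sequentially"
    using tendstoD[OF LIMSEQ_subseq_LIMSEQ[OF \<sigma>1(2) \<sigma>2] d(1)] by simp
  moreover have "eventually (\<lambda>n. dist (f (\<sigma>2 n) w0) 0 < 1/4) sequentially"
    using F[of w0] \<open>F w0 = 0\<close> by (intro tendstoD) auto
  moreover have "eventually (\<lambda>n. N \<le> n) sequentially" by (rule eventually_ge_at_top)
  ultimately have "eventually (\<lambda>n. False) sequentially"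
  proof eventually_elim
    case (elim n)
    let ?y = "w (\<sigma>1 (\<sigma>2 n))"
    have "norm (f (\<sigma>2 n) ?y - f (\<sigma>2 n) w0) < 1/4"
      using elim(1,3) seq_suble[OF \<sigma>2, of n] by (intro d(2)) auto
    moreover have "norm (f (\<sigma>2 n) w0) < 1/4" using elim(2) by simp
    moreover have "norm (f (\<sigma>2 n) ?y) \<ge> 1/2" using w(2) by (simp add: f_def)
    ultimately show False using norm_triangle_ineq2[of "f (\<sigma>2 n) ?y" "f (\<sigma>2 n) w0"] by linarith
  qed
  then show False by simp
qed

section \<open>Extended real seminorms and their pointwise consequences\<close>

lemma ex_adist_eq:
  fixes y :: "real^'d::finite"
  assumes "\<forall>i. 1 \<le> s i" "0 \<le> d"
  shows "\<exists>z. adist s y z = d"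
proof -
  obtain i :: 'd where True by simp
  have "adist s y (y + (d ^ s i) *\<^sub>R axis i 1) = d"
    using assms by (simp add: adist_axis powr_inverse_nat_power)
  then show ?thesis ..
qed

text \<open>In \<open>ereal\<close> a supremum over the empty set is minus infinity, so
  nonnegativity of each seminorm needs a witness in its index set. It is what lets a bound on the
  sum of the three terms bound each of them.\<close>

lemma germ_sup_nonneg: "0 < \<rho> \<Longrightarrow> 0 \<le> germ_sup s \<rho> U"
  unfolding germ_sup_def by (rule SUP_upper2[of "(0, 0)"]) auto

lemma germ_hoelder2_nonneg:
  fixes s :: "'d::finite \<Rightarrow> nat"
  assumes s: "\<forall>i. 1 \<le> s i" and "0 < \<rho>"
  shows "0 \<le> germ_hoelder2 s \<gamma> \<alpha> \<rho> U"
proof -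
  have half: "\<exists>z. 0 < adist s y z \<and> adist s y z < \<rho>" for y :: "real^'d"
    using ex_adist_eq[OF s, of "\<rho> / 2" y] \<open>0 < \<rho>\<close> by force
  obtain y where y: "0 < adist s 0 y" "adist s 0 y < \<rho>" using half by blast
  obtain z where z: "0 < adist s y z" "adist s y z < \<rho>" using half by blast
  show ?thesis
    unfolding germ_hoelder2_def
    by (rule SUP_upper2[of "(0, y)"]) (use y z in \<open>auto intro!: INF_greatest SUP_upper2[of z]\<close>)
qed

lemma neg_hoelder_nonneg:
  fixes V :: "real^'d::finite \<Rightarrow> (real^'d \<Rightarrow> complex) \<Rightarrow> complex"
  assumes "0 < \<rho>"
  shows "0 \<le> neg_hoelder s \<gamma> \<rho> V"
proof -
  have "(\<lambda>_. 0) \<in> testB s (nat \<lceil>\<bar>\<gamma>\<bar>\<rceil>)"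
    by (auto simp: testB_def test_fun_def supp_def Cinf_on_0 pd_def iter_partial_0)
  then show ?thesis
    unfolding neg_hoelder_def using assms
    by (intro SUP_upper2[of "(\<lambda>_. 0, \<rho> / 2, 0)"]) auto
qed

text \<open>Finiteness of \<open>h\<close> excludes infinite summands, so the violated estimate can
  be read in the reals; \<open>h\<close> is positive because it strictly exceeds a nonnegative
  quantity.\<close>

lemma ereal_scaled_sum_less:
  fixes a b c h :: ereal
  assumes "0 \<le> a" "0 \<le> b" "0 \<le> c" "C > 0" "ereal C * (a + b + c) < h" "h < \<infinity>"
  obtains M where "M > 0" "h = ereal M" "a \<le> ereal (M / C)" "b \<le> ereal (M / C)" "c \<le> ereal (M / C)"
proof -
  have "a \<noteq> \<infinity>" "b \<noteq> \<infinity>" "c \<noteq> \<infinity>" using assms by auto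
  then obtain a' b' c' where r: "a = ereal a'" "b = ereal b'" "c = ereal c'"
    using assms by (cases a; cases b; cases c) auto
  then obtain M where M: "h = ereal M" using assms by (cases h) auto
  have nn: "a' \<ge> 0" "b' \<ge> 0" "c' \<ge> 0" and lt: "C * (a' + b' + c') < M" using assms r M by auto
  moreover have "0 \<le> C * (a' + b' + c')" using nn \<open>C > 0\<close> by simp
  moreover have "a' + b' + c' < M / C" using lt \<open>C > 0\<close> by (simp add: field_simps)
  ultimately show thesis using that[of M] r M by auto
qed

text \<open>The seminorm says nothing at z = x; there continuity of \<open>U x\<close> forces the
  value 0.\<close>

lemma germ_hoelder_bound:
  fixes s :: "'d::finite \<Rightarrow> nat"
  assumes s: "\<forall>i. 1 \<le> s i" and "\<eta> > 0" and cont: "\<forall>x. continuous_on UNIV (U x)"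
    and M: "germ_hoelder s \<eta> \<rho> U = ereal M" and d: "adist s x z < \<rho>"
  shows "norm (U x z) \<le> M * adist s x z powr \<eta>"
proof -
  have pos: "norm (U x z) \<le> M * adist s x z powr \<eta>" if "0 < adist s x z" "adist s x z < \<rho>" for z
  proof -
    have "ereal (norm (U x z) / adist s x z powr \<eta>) \<le> ereal M"
      unfolding M[symmetric] germ_hoelder_def
      by (rule SUP_upper2[of "(x, z)"]) (use that in auto)
    moreover have "adist s x z powr \<eta> > 0" using that(1) by (metis less_irrefl powr_gt_zero)
    ultimately show ?thesis by (simp add: pos_divide_le_eq)
  qed
  show ?thesis
  proof (cases "x = z")
    case False
    then show ?thesis using pos[of z] d by (simp add: less_le adist_nonneg)
  next
    case True
    have cd: "continuous_on UNIV (\<lambda>z. adist s x z)"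
      by (intro continuous_on_adist[OF s] continuous_intros)
    then have "(adist s x \<longlongrightarrow> adist s x x) (at x)"
      unfolding continuous_on_def by blast
    then have tend: "(adist s x \<longlongrightarrow> 0) (at x)" by simp
    have "((\<lambda>z. M * adist s x z powr \<eta>) \<longlongrightarrow> M * 0 powr \<eta>) (at x)"
      using \<open>\<eta> > 0\<close> by (intro tendsto_mult tendsto_const tendsto_powr' tend) (auto simp: adist_nonneg)
    moreover have "((\<lambda>z. norm (U x z)) \<longlongrightarrow> norm (U x x)) (at x)"
      using cont by (intro tendsto_norm) (auto simp: continuous_on_def)
    moreover have "eventually (\<lambda>z. norm (U x z) \<le> M * adist s x z powr \<eta>) (at x)"
    proof -
      have "eventually (\<lambda>z. adist s x z < \<rho>) (at x)"
        using tend d True by (intro order_tendstoD(2)[OF tend]) simp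
      moreover have "eventually (\<lambda>z. z \<noteq> x) (at x)" by (simp add: eventually_at_filter)
      ultimately show ?thesis
        by eventually_elim (intro pos, auto simp: less_le adist_nonneg)
    qed
    ultimately have "norm (U x x) \<le> M * 0 powr \<eta>" by (intro tendsto_le[of "at x"]) auto
    then show ?thesis using True by simp
  qed
qed

text \<open>The infimum over polynomials need not be attained; the strict bound \<open>B\<close>
  buys an actual polynomial.\<close>

lemma germ_hoelder2_bound:
  fixes s :: "'d::finite \<Rightarrow> nat"
  assumes G: "germ_hoelder2 s \<eta> \<alpha> \<rho> U < ereal B" and xy: "0 < adist s x y" "adist s x y < \<rho>"
  obtains P where "P \<in> polys s (nat \<lfloor>\<eta>\<rfloor>)" "\<And>z. 0 < adist s y z \<Longrightarrow> adist s y z < \<rho> \<Longrightarrow>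
    norm (U x z - U y z - P z) \<le> B * (adist s y z powr \<alpha> * (adist s x y + adist s y z) powr (\<eta> - \<alpha>))"
proof -
  let ?q = "\<lambda>P z. ereal (norm (U x z - U y z - P z) /
                 (adist s y z powr \<alpha> * (adist s x y + adist s y z) powr (\<eta> - \<alpha>)))"
  have "(INF P\<in>polys s (nat \<lfloor>\<eta>\<rfloor>). SUP z\<in>{z. 0 < adist s y z \<and> adist s y z < \<rho>}. ?q P z) \<le>
      germ_hoelder2 s \<eta> \<alpha> \<rho> U"
    unfolding germ_hoelder2_def by (rule SUP_upper2[of "(x, y)"]) (use xy in auto)
  also note G
  finally obtain P where P: "P \<in> polys s (nat \<lfloor>\<eta>\<rfloor>)"
    "(SUP z\<in>{z. 0 < adist s y z \<and> adist s y z < \<rho>}. ?q P z) < ereal B"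
    by (auto simp: INF_less_iff)
  show thesis
  proof (rule that[OF P(1)])
    fix z assume z: "0 < adist s y z" "adist s y z < \<rho>"
    have "?q P z < ereal B"
      by (rule le_less_trans[OF SUP_upper P(2)]) (use z in auto)
    moreover have "adist s y z powr \<alpha> * (adist s x y + adist s y z) powr (\<eta> - \<alpha>) > 0"
    proof (rule mult_pos_pos)
      show "adist s y z powr \<alpha> > 0" using z(1) by (metis less_irrefl powr_gt_zero)
      have "adist s x y + adist s y z \<noteq> 0" using z(1) xy(1) by linarith
      then show "(adist s x y + adist s y z) powr (\<eta> - \<alpha>) > 0" by (simp only: powr_gt_zero not_False_eq_True)
    qed
    ultimately show "norm (U x z - U y z - P z) \<le> B * (adist s y z powr \<alpha> * (adist s x y + adist s y z) powr (\<eta> - \<alpha>))"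
      by (simp add: pos_divide_less_eq)
  qed
qed

lemma neg_hoelder_bound:
  assumes "neg_hoelder s \<gamma> \<rho> V \<le> ereal B" "\<phi> \<in> testB s (nat \<lceil>\<bar>\<gamma>\<bar>\<rceil>)" "0 < \<mu>" "\<mu> < \<rho>"
  shows "norm (V x (rescale s \<phi> \<mu> x)) \<le> B * \<mu> powr \<gamma>"
proof -
  have "ereal (\<mu> powr (- \<gamma>) * norm (V x (rescale s \<phi> \<mu> x))) \<le> neg_hoelder s \<gamma> \<rho> V"
    unfolding neg_hoelder_def by (rule SUP_upper2[of "(\<phi>, \<mu>, x)"]) (use assms in auto)
  then have "ereal (\<mu> powr (- \<gamma>) * norm (V x (rescale s \<phi> \<mu> x))) \<le> ereal B" using assms(1) by (rule order.trans)
  then show ?thesis using \<open>0 < \<mu>\<close> by (simp add: powr_minus field_simps)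
qed

text \<open>A pair (x, y) within a factor 2 of the supremum M is moved to base point 0 and distance
  1 by dilating with l = \<open>adist s x y\<close> and dividing by M l^eta. Each term bounded by
  M/C then supplies one property: the supremum a large radius, the operator term near-harmonicity,
  the second seminorm the comparison of base points.\<close>

lemma blow_up_normalization:
  fixes s :: "'d::finite \<Rightarrow> nat" and U :: "real^'d \<Rightarrow> real^'d \<Rightarrow> complex"
  assumes s: "\<forall>i. 1 \<le> s i" and "0 < \<alpha>" "\<alpha> < \<eta>" and "0 < \<rho>" and cont: "\<forall>x. continuous_on UNIV (U x)"
    and "M > 0" "C \<ge> 4"
    and H: "germ_hoelder s \<eta> \<rho> U = ereal M"
    and N: "neg_hoelder s (\<eta> - real m) \<rho> (\<lambda>x. Lop s m a (fdist (U x))) \<le> ereal (M / C)"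
    and G: "germ_hoelder2 s \<eta> \<alpha> \<rho> U \<le> ereal (M / C)"
    and S: "ereal (\<rho> powr (- \<eta>)) * germ_sup s \<rho> U \<le> ereal (M / C)"
  shows "\<exists>V r w. normalized s \<eta> \<alpha> r V \<and> 0 < r \<and> C / 2 \<le> r powr \<eta> \<and> adist s 0 w = 1 \<and> 1/2 \<le> norm (V 0 w) \<and>
    (\<forall>\<mu> \<phi>. 0 < \<mu> \<longrightarrow> \<mu> < r \<longrightarrow> \<phi> \<in> testB s (nat \<lceil>\<bar>\<eta> - real m\<bar>\<rceil>) \<longrightarrow>
      norm (Lop s m a (fdist (\<lambda>z. V 0 (dil s \<mu> z))) \<phi>) \<le> \<mu> powr \<eta> / C)"
proof -
  have "\<eta> > 0" using \<open>0 < \<alpha>\<close> \<open>\<alpha> < \<eta>\<close> by simp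
  have "ereal (M / 2) < germ_hoelder s \<eta> \<rho> U" using H \<open>M > 0\<close> by simp
  then obtain x y where xy: "0 < adist s x y" "adist s x y < \<rho>"
    and big': "M / 2 < norm (U x y) / adist s x y powr \<eta>"
    unfolding germ_hoelder_def less_SUP_iff by auto
  define l where "l = adist s x y"
  have l: "0 < l" "l < \<rho>" using xy by (simp_all add: l_def)
  have "l powr \<eta> > 0" using l by simp
  then have big: "M / 2 * l powr \<eta> < norm (U x y)"
    using big' unfolding l_def[symmetric] by (simp only: pos_less_divide_eq)
  define r where "r = \<rho> / l"
  have "r > 0" using l by (simp add: r_def)
  \<comment> \<open>Here (M/2) l^eta < |U x y|, which is at most rho^eta M/C; so for large C the
    extremal distance l is small compared with rho.\<close>
  have r_powr: "C / 2 \<le> r powr \<eta>"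
  proof -
    have "ereal (norm (U x y)) \<le> germ_sup s \<rho> U"
      unfolding germ_sup_def by (rule SUP_upper2[of "(x, y)"]) (use xy in auto)
    then have "ereal (\<rho> powr (- \<eta>)) * ereal (norm (U x y)) \<le> ereal (\<rho> powr (- \<eta>)) * germ_sup s \<rho> U"
      by (rule ereal_mult_left_mono) simp
    then have "\<rho> powr (- \<eta>) * norm (U x y) \<le> M / C" using S by (auto dest: order.trans)
    moreover have "\<rho> powr (- \<eta>) * (M / 2 * l powr \<eta>) \<le> \<rho> powr (- \<eta>) * norm (U x y)"
      using big by (intro mult_left_mono) auto
    ultimately have "\<rho> powr (- \<eta>) * (M / 2 * l powr \<eta>) \<le> M / C" by linarith
    then have "M * (l powr \<eta> * C) \<le> M * (2 * \<rho> powr \<eta>)"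
      using \<open>0 < \<rho>\<close> \<open>C \<ge> 4\<close> by (simp add: powr_minus field_simps)
    then have "l powr \<eta> * C \<le> 2 * \<rho> powr \<eta>" using \<open>M > 0\<close> by simp
    then show ?thesis using l \<open>0 < \<rho>\<close> by (simp add: r_def powr_divide field_simps)
  qed
  define c where "c = 1 / (M * l powr \<eta>)"
  have "c > 0" using \<open>M > 0\<close> l by (simp add: c_def)
  define V where "V u z = complex_of_real c * U (x + dil s l u) (x + dil s l z)" for u z
  have scale: "adist s (x + dil s l u) (x + dil s l z) = l * adist s u z" for u z
    using l by (simp add: adist_dil[OF s])
  have in_ball: "l * d < \<rho>" if "d < r" for d
    using that l by (simp add: r_def field_simps)
  have "normalized s \<eta> \<alpha> r V"
    unfolding normalized_def
  proof (intro conjI allI impI)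
    show "continuous_on UNIV (V u)" for u
      unfolding V_def
      by (intro continuous_intros continuous_on_compose2[OF cont[rule_format]] continuous_on_dil) auto
  next
    fix u z assume d: "adist s u z < r"
    have "norm (V u z) \<le> c * (M * (l * adist s u z) powr \<eta>)"
      using germ_hoelder_bound[OF s \<open>\<eta> > 0\<close> cont H, of "x + dil s l u" "x + dil s l z"] in_ball[OF d] \<open>c > 0\<close>
      by (simp add: V_def norm_mult scale)
    also have "\<dots> = adist s u z powr \<eta>"
      using \<open>M > 0\<close> l by (simp add: c_def powr_mult adist_nonneg)
    finally show "norm (V u z) \<le> adist s u z powr \<eta>" .
  next
    fix u v assume uv: "0 < adist s u v \<and> adist s u v < r"
    let ?X = "x + dil s l u" and ?Y = "x + dil s l v"
    \<comment> \<open>The strict inequality yields a polynomial with the constant 2 M, which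
      division by M turns into the 2 of \<open>normalized\<close>.\<close>
    have "M / C < 2 * M" using \<open>M > 0\<close> \<open>C \<ge> 4\<close> by (simp add: field_simps)
    then have G': "germ_hoelder2 s \<eta> \<alpha> \<rho> U < ereal (2 * M)" using le_less_trans[OF G] by simp
    have XY: "0 < adist s ?X ?Y" "adist s ?X ?Y < \<rho>" using uv l in_ball by (auto simp: scale)
    obtain P where P: "P \<in> polys s (nat \<lfloor>\<eta>\<rfloor>)" "\<And>z. 0 < adist s ?Y z \<Longrightarrow> adist s ?Y z < \<rho> \<Longrightarrow>
        norm (U ?X z - U ?Y z - P z) \<le> 2 * M * (adist s ?Y z powr \<alpha> * (adist s ?X ?Y + adist s ?Y z) powr (\<eta> - \<alpha>))"
      using germ_hoelder2_bound[OF G' XY] by blast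
    show "\<exists>P. axis_poly (nat \<lfloor>\<eta>\<rfloor>) P \<and> (\<forall>z. 0 < adist s v z \<and> adist s v z < r \<longrightarrow>
         norm (V u z - V v z - P z) \<le> 2 * (adist s v z powr \<alpha> * (adist s u v + adist s v z) powr (\<eta> - \<alpha>)))"
    proof (intro exI conjI allI impI)
      show "axis_poly (nat \<lfloor>\<eta>\<rfloor>) (\<lambda>z. complex_of_real c * P (x + dil s l z))"
        by (intro axis_poly_dil axis_poly_polys[OF s P(1)])
      fix z assume z: "0 < adist s v z \<and> adist s v z < r"
      let ?Z = "x + dil s l z"
      have "V u z - V v z - complex_of_real c * P ?Z = complex_of_real c * (U ?X ?Z - U ?Y ?Z - P ?Z)"
        by (simp add: V_def algebra_simps)
      then have "norm (V u z - V v z - complex_of_real c * P ?Z) = c * norm (U ?X ?Z - U ?Y ?Z - P ?Z)"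
        using \<open>c > 0\<close> by (simp only: norm_mult norm_of_real abs_of_pos)
      also have "\<dots> \<le> c * (2 * M * ((l * adist s v z) powr \<alpha> * (l * adist s u v + l * adist s v z) powr (\<eta> - \<alpha>)))"
        using P(2)[of ?Z] z l in_ball \<open>c > 0\<close> by (intro mult_left_mono) (auto simp: scale)
      also have "(l * adist s u v + l * adist s v z) powr (\<eta> - \<alpha>) = l powr (\<eta> - \<alpha>) * (adist s u v + adist s v z) powr (\<eta> - \<alpha>)"
        using l by (simp add: powr_mult adist_nonneg flip: distrib_left)
      also have "c * (2 * M * ((l * adist s v z) powr \<alpha> * (l powr (\<eta> - \<alpha>) * (adist s u v + adist s v z) powr (\<eta> - \<alpha>)))) =
          (c * M * (l powr \<alpha> * l powr (\<eta> - \<alpha>))) * (2 * (adist s v z powr \<alpha> * (adist s u v + adist s v z) powr (\<eta> - \<alpha>)))"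
        using l by (simp add: powr_mult adist_nonneg mult_ac)
      also have "c * M * (l powr \<alpha> * l powr (\<eta> - \<alpha>)) = 1"
        using l \<open>M > 0\<close> by (simp add: c_def flip: powr_add)
      finally show "norm (V u z - V v z - complex_of_real c * P ?Z) \<le>
          2 * (adist s v z powr \<alpha> * (adist s u v + adist s v z) powr (\<eta> - \<alpha>))" by simp
    qed
  qed
  define w where "w = dil s (1 / l) (y - x)"
  have xw: "x + dil s l w = y" using l by (simp add: w_def dil_dil)
  have x0: "x + dil s l 0 = x" by (simp add: dil_def vec_eq_iff)
  have w: "adist s 0 w = 1"
    using scale[of 0 w] \<open>0 < l\<close> unfolding xw x0 l_def[symmetric] by simp
  have "1/2 \<le> norm (V 0 w)"
  proof -
    have "norm (V 0 w) = c * norm (U x y)"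
      using \<open>c > 0\<close> unfolding V_def xw x0 by (simp only: norm_mult norm_of_real abs_of_pos)
    moreover have "c * (M / 2 * l powr \<eta>) \<le> c * norm (U x y)"
      using big \<open>c > 0\<close> by (intro mult_left_mono) auto
    moreover have "c * (M / 2 * l powr \<eta>) = 1/2"
      using \<open>M > 0\<close> \<open>0 < l\<close> by (simp add: c_def)
    ultimately show ?thesis by linarith
  qed
  \<comment> \<open>Undoing \<open>rescale\<close> costs (l mu)^m, which raises the order of the
    seminorm bound from eta - m to eta; the normalisation \<open>c\<close> then removes M
    l^eta.\<close>
  have "norm (Lop s m a (fdist (\<lambda>z. V 0 (dil s \<mu> z))) \<phi>) \<le> \<mu> powr \<eta> / C"
    if \<mu>: "0 < \<mu>" "\<mu> < r" and \<phi>: "\<phi> \<in> testB s (nat \<lceil>\<bar>\<eta> - real m\<bar>\<rceil>)" for \<mu> \<phi>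
  proof -
    define L where "L = Lop s m a (fdist (\<lambda>z. U x (x + dil s (l * \<mu>) z))) \<phi>"
    have l\<mu>: "0 < l * \<mu>" "l * \<mu> < \<rho>" using l \<mu> in_ball by auto
    have "test_fun UNIV \<phi>" using \<phi> by (simp add: testB_def)
    then have resc: "Lop s m a (fdist (U x)) (rescale s \<phi> (l * \<mu>) x) = of_real (inverse (l * \<mu>) ^ m) * L"
      unfolding L_def using l\<mu> cont by (intro Lop_rescale) auto
    have "norm (Lop s m a (fdist (U x)) (rescale s \<phi> (l * \<mu>) x)) \<le> M / C * (l * \<mu>) powr (\<eta> - real m)"
      by (rule neg_hoelder_bound[OF N \<phi> l\<mu>])
    moreover have "norm (Lop s m a (fdist (U x)) (rescale s \<phi> (l * \<mu>) x)) = inverse (l * \<mu>) ^ m * norm L"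
      unfolding resc using l\<mu> by (simp only: norm_mult norm_of_real abs_of_pos zero_less_power positive_imp_inverse_positive)
    ultimately have "(l * \<mu>) ^ m * (inverse (l * \<mu>) ^ m * norm L) \<le> (l * \<mu>) ^ m * (M / C * (l * \<mu>) powr (\<eta> - real m))"
      using l\<mu> by (intro mult_left_mono) auto
    also have "\<dots> = M / C * ((l * \<mu>) powr real m * (l * \<mu>) powr (\<eta> - real m))"
      using l\<mu> by (simp add: powr_realpow)
    also have "(l * \<mu>) powr real m * (l * \<mu>) powr (\<eta> - real m) = l powr \<eta> * \<mu> powr \<eta>"
      using l \<mu> by (simp only: powr_add[symmetric]) (simp add: powr_mult)
    also have "(l * \<mu>) ^ m * (inverse (l * \<mu>) ^ m * norm L) = norm L"
    proof -
      have "(l * \<mu>) ^ m * inverse (l * \<mu>) ^ m = 1"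
        using less_imp_neq[OF l\<mu>(1), symmetric]
        by (simp only: power_mult_distrib[symmetric] right_inverse power_one not_False_eq_True)
      then show ?thesis by (simp only: mult.assoc[symmetric] mult_1_left)
    qed
    finally have "c * norm L \<le> c * (M / C * (l powr \<eta> * \<mu> powr \<eta>))"
      using \<open>c > 0\<close> by (intro mult_left_mono) auto
    also have "\<dots> = \<mu> powr \<eta> / C" using \<open>M > 0\<close> l by (simp add: c_def)
    finally have "c * norm L \<le> \<mu> powr \<eta> / C" .
    moreover have "Lop s m a (fdist (\<lambda>z. V 0 (dil s \<mu> z))) \<phi> = complex_of_real c * L"
      unfolding V_def x0 dil_dil Lop_cmult_fun L_def ..
    ultimately show ?thesis using \<open>c > 0\<close> by (simp add: norm_mult)
  qed
  with \<open>normalized s \<eta> \<alpha> r V\<close> \<open>r > 0\<close> r_powr w \<open>1/2 \<le> norm (V 0 w)\<close> show ?thesis by blast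
qed

theorem theorem3p7:
  fixes s :: "'d::finite \<Rightarrow> nat" and m :: nat and a :: "('d \<Rightarrow> nat) \<Rightarrow> complex"
    and \<alpha> \<eta> :: real
  assumes "\<forall>i. 1 \<le> s i"
    and "elliptic s m a"
    and "0 < \<alpha>" and "\<alpha> < \<eta>" and "\<eta> < real m"
    and "\<alpha> \<notin> \<nat>" and "\<eta> \<notin> \<nat>"
  shows "\<exists>C::real. \<forall>\<rho>>0. \<forall>U :: real^'d \<Rightarrow> real^'d \<Rightarrow> complex.
           (\<forall>x. continuous_on UNIV (U x)) \<longrightarrow> germ_hoelder s \<eta> \<rho> U < \<infinity> \<longrightarrow>
           germ_hoelder s \<eta> \<rho> U \<le> ereal C * (neg_hoelder s (\<eta> - real m) \<rho> (\<lambda>x. Lop s m a (fdist (U x)))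
              + germ_hoelder2 s \<eta> \<alpha> \<rho> U + ereal (\<rho> powr (- \<eta>)) * germ_sup s \<rho> U)"
proof (rule ccontr)
  note s = assms(1)
  have "\<eta> > 0" using assms(3,4) by simp
  let ?k = "nat \<lceil>\<bar>\<eta> - real m\<bar>\<rceil>"
  assume contra: "\<not> ?thesis"
  \<comment> \<open>The n-th germ violates the estimate with the constant n + 4, which is at least 4
    for \<open>blow_up_normalization\<close> and tends to infinity, so that the radii grow and the
    operator bound tends to 0.\<close>
  have "\<exists>V r w. normalized s \<eta> \<alpha> r V \<and> 0 < r \<and> (real n + 4) / 2 \<le> r powr \<eta> \<and> adist s 0 w = 1 \<and> 1/2 \<le> norm (V 0 w) \<and>
    (\<forall>\<mu> \<phi>. 0 < \<mu> \<longrightarrow> \<mu> < r \<longrightarrow> \<phi> \<in> testB s ?k \<longrightarrow>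
      norm (Lop s m a (fdist (\<lambda>z. V 0 (dil s \<mu> z))) \<phi>) \<le> \<mu> powr \<eta> / (real n + 4))" for n :: nat
  proof -
    let ?C = "real n + 4"
    obtain \<rho> U where \<rho>: "\<rho> > 0" and cont: "\<forall>x. continuous_on UNIV (U x)" and fin: "germ_hoelder s \<eta> \<rho> U < \<infinity>"
      and gt: "ereal ?C * (neg_hoelder s (\<eta> - real m) \<rho> (\<lambda>x. Lop s m a (fdist (U x)))
              + germ_hoelder2 s \<eta> \<alpha> \<rho> U + ereal (\<rho> powr (- \<eta>)) * germ_sup s \<rho> U) < germ_hoelder s \<eta> \<rho> U"
      using contra unfolding not_ex not_all not_imp not_le by blast
    show ?thesis
    proof (rule ereal_scaled_sum_less[OF neg_hoelder_nonneg[OF \<rho>] germ_hoelder2_nonneg[OF s \<rho>] _ _ gt fin])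
      show "0 \<le> ereal (\<rho> powr (- \<eta>)) * germ_sup s \<rho> U"
        using germ_sup_nonneg[OF \<rho>] by (intro ereal_0_le_mult) auto
    qed (use blow_up_normalization[OF s assms(3,4) \<rho> cont, of _ ?C m a] in auto)
  qed
  then obtain V r w where V: "\<And>n. normalized s \<eta> \<alpha> (r n) (V n)" and r: "\<And>n. 0 < r n"
    "\<And>n. (real n + 4) / 2 \<le> r n powr \<eta>"
    and w: "\<And>n. adist s 0 (w n) = 1" "\<And>n. 1/2 \<le> norm (V n 0 (w n))"
    and L: "\<And>n \<mu> \<phi>. 0 < \<mu> \<Longrightarrow> \<mu> < r n \<Longrightarrow> \<phi> \<in> testB s ?k \<Longrightarrow>
      norm (Lop s m a (fdist (\<lambda>z. V n 0 (dil s \<mu> z))) \<phi>) \<le> \<mu> powr \<eta> / (real n + 4)" by metis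
  have r_lim: "filterlim r at_top sequentially"
    unfolding filterlim_at_top_dense
  proof
    fix B :: real
    have "eventually (\<lambda>n. 2 * (max B 0) powr \<eta> < real n) sequentially"
      using filterlim_real_sequentially by (simp add: filterlim_at_top_dense)
    then show "eventually (\<lambda>n. B < r n) sequentially"
    proof (rule eventually_mono)
      fix n assume "2 * (max B 0) powr \<eta> < real n"
      then have "(max B 0) powr \<eta> < r n powr \<eta>" using r(2)[of n] by simp
      then have "max B 0 < r n" using \<open>\<eta> > 0\<close> r(1)[of n] by (meson not_le powr_mono2 less_imp_le)
      then show "B < r n" by simp
    qed
  qed
  show False
  proof (rule blow_up_contradiction[OF s assms(2,3,4,7) r_lim V _ w])
    fix \<mu> \<phi> assume \<mu>: "(0::real) < \<mu>" and \<phi>: "\<phi> \<in> testB s ?k"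
    have "(\<lambda>n. \<mu> powr \<eta> / (real n + 4)) \<longlonglongrightarrow> 0"
      unfolding add.commute[of "real _"]
      by (intro tendsto_divide_0[OF tendsto_const] filterlim_at_top_imp_at_infinity
          filterlim_tendsto_add_at_top[OF tendsto_const] filterlim_real_sequentially)
    moreover have "eventually (\<lambda>n. \<mu> < r n) sequentially"
      using r_lim by (simp add: filterlim_at_top_dense)
    then have "eventually (\<lambda>n. norm (Lop s m a (fdist (\<lambda>z. V n 0 (dil s \<mu> z))) \<phi>) \<le> \<mu> powr \<eta> / (real n + 4)) sequentially"
      by (rule eventually_mono) (rule L[OF \<mu> _ \<phi>])
    ultimately show "(\<lambda>n. Lop s m a (fdist (\<lambda>z. V n 0 (dil s \<mu> z))) \<phi>) \<longlonglongrightarrow> 0"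
      by (rule Lim_null_comparison[rotated])
  qed
qed

end
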